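(* Let $(S,\mathcal S)$ be a metric space with its Borel $\sigma$-field, let $X=(X_n,n\in\mathbb T)$ be a bifurcating Markov chain on $S$ with initial distribution $\nu$ and $\mathbb T$-transition probability $P$, and let $\Pi$ be a uniform generation-preserving random permutation independent of $X$. Let $F$ be an admissible space of functions with limit probability $\mu$. Let $f_1,\dots,f_d:S^3\to\mathbb R$ be measurable functions such that $Pf_i$, $P(f_if_j)$ and $P(f_if_jf_kf_l)$ exist and belong to $F$ for all $i,j,k,l\in\{1,\dots,d\}$. Let $f=(f_1,\dots,f_d)$. Then $n^{-1/2}\big(M_n^{\Pi}(f)-M_n^{\Pi}(Pf)\big)$ converges in distribution, as $n\to\infty$, to the $d$-dimensional Gaussian law $\mathcal N_d(0,\Sigma)$, where $\Sigma_{ij}=(\mu,P(f_if_j))-(\mu,Pf_i\,Pf_j)$.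
   Context: Tree. $\mathbb T=\mathbb N^*=\{1,2,\dots\}$ is the binary tree: vertex $n$ has two daughters $2n$ and $2n+1$, the root is $1$. $\mathbb G_q=\{2^q,\dots,2^{q+1}-1\}$ is the $q$th generation, $\mathbb T_r=\bigcup_{q=0}^r\mathbb G_q$, $r_n=\lfloor\log_2 n\rfloor$ is the generation of $n$. $\mathbb T$-transition probability. A map $P:S\times\mathcal S^2\to[0,1]$ ($\mathcal S^2$ the product $\sigma$-field on $S^2$) such that $P(\cdot,A)$ is measurable for all $A\in\mathcal S^2$ and $P(x,\cdot)$ is a probability on $(S^2,\mathcal S^2)$ for all $x\in S$. Put $P_0(x,B)=P(x,B\times S)$, $P_1(x,B)=P(x,S\times B)$, $Q=(P_0+P_1)/2$; $Q^r$ is the $r$th iterate of $Q$ and $Q^rf(x)=\int_S f(y)Q^r(x,dy)$. When defined, $Pf(x)=\int_{S^2}f(y,z)P(x,dy\,dz)$ for measurable $f:S^2\to\mathbb R$, and $Pf(x)=\int_{S^2}f(x,y,z)P(x,dy\,dz)$ for measurable $f:S^3\to\mathbb R$. Bifurcating Markov chain. On a filtered probability space $(\Omega,\mathcal F,(\mathcal F_r)_{r\in\mathbb N},\mathbb P)$, a family $(X_n,n\in\mathbb T)$ of $S$-valued random variables is a bifurcating Markov chain with initial distribution $\nu$ and $\mathbb T$-transition probability $P$ if $X_n$ is $\mathcal F_{r_n}$-measurable for all $n$, $X_1$ has law $\nu$, and for all $q\in\mathbb N$ and all families $(f_n,n\in\mathbb G_q)$ of bounded measurable functions on $S^2$, $\mathbb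 E[\prod_{n\in\mathbb G_q}f_n(X_{2n},X_{2n+1})\mid\mathcal F_q]=\prod_{n\in\mathbb G_q}Pf_n(X_n)$. The default filtration is $\mathcal F_r=\sigma(X_i,i\in\mathbb T_r)$. Admissible space. Let $\mathcal B(S)$ be the set of measurable functions $S\to\mathbb R$, and $(f\otimes g)(y,z)=f(y)g(z)$. A linear subspace $F\subset\mathcal B(S)$ is called admissible with limit probability $\mu$ (relative to $P,\nu$) if: (i) $F$ contains the constants; (ii) $f^2\in F$ for all $f\in F$; (iii) for all $f,g\in F$, $f\otimes g\in L^1(P(x,\cdot))$ for all $x\in S$, and $P(f\otimes g)\in F$; (iv) $\mu$ is a probability on $(S,\mathcal S)$ with $F\subset L^1(\mu)$ and $\lim_{r\to\infty}Q^rf(x)=\int_S f\,d\mu$ for all $x\in S$ and $f\in F$; (v) for all $f\in F$ there is $g\in F$ such that $|Q^rf|\le g$ for all $r\in\mathbb N$; (vi) $F\subset L^1(\nu)$. (Conditions (i) and (iii) imply that $Q^rf$ is well defined for $f\in F$.) Random permutation. $\Pi$ is a random permutation of $\mathbb N^*$ leaving each $\mathbb G_q$ invariant, whose restrictions to the $\mathbb G_q$ are independent over $q$, each uniform among the $(2^q)!$ permutations of $\mathbb G_q$. Sums. $\Delta_i=(X_i,X_{2i},X_{2i+1})$. $M_n^\Pi(f)=\sum_{i=1}^n f(\Delta_{\Pi(i)})$ for measurable $f$ on $S^3$, and $M_n^\Pi(g)=\sum_{i=1}^n g(X_{\Pi(i)})$ for measurable $g$ on $S$. For vector-valued $f=(f_1,\dots,f_d)$,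 $M_n^\Pi(f)$ and $Pf$ are taken componentwise. $(\mu,g)=\int_S g\,d\mu$. *)

theory Defs
  imports "HOL-Probability.Probability" "HOL-Combinatorics.Permutations"
begin

text \<open>
  The vertices of the binary tree are the positive natural numbers; the value that a family indexed
  by \<^typ>\<open>nat\<close> takes at \<open>0\<close> is never constrained and never used. The state space is the whole type
  \<open>'s\<close> with its Borel sets. Its square and cube carry the product sigma-fields, which for a
  non-separable space may be smaller than the Borel sets of the product topology.
\<close>

definition generation :: "nat \<Rightarrow> nat set" where
  "generation q = {2 ^ q..<2 ^ (q + 1)}"

definition gen_index :: "nat \<Rightarrow> nat" where
  "gen_index n = nat \<lfloor>log 2 (real n)\<rfloor>"

abbreviation borel2 :: "('s::topological_space \<times> 's) measure" where
  "borel2 \<equiv> borel \<Otimes>\<^sub>M borel"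

abbreviation borel3 :: "('s::topological_space \<times> 's \<times> 's) measure" where
  "borel3 \<equiv> borel \<Otimes>\<^sub>M (borel \<Otimes>\<^sub>M borel)"

text \<open>Measurability into \<^const>\<open>prob_algebra\<close> means that every \<open>P x\<close> is a probability measure and that
  \<open>x \<mapsto> P x A\<close> is measurable for every measurable \<open>A\<close>.\<close>

definition T_transition :: "('s::topological_space \<Rightarrow> ('s \<times> 's) measure) \<Rightarrow> bool" where
  "T_transition P \<longleftrightarrow> P \<in> borel \<rightarrow>\<^sub>M prob_algebra borel2"

definition op2 :: "('s \<Rightarrow> ('s \<times> 's) measure) \<Rightarrow> ('s \<times> 's \<Rightarrow> real) \<Rightarrow> 's \<Rightarrow> real" where
  "op2 P f x = (\<integral>yz. f yz \<partial>P x)"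

definition op3_exists :: "('s \<Rightarrow> ('s \<times> 's) measure) \<Rightarrow> ('s \<times> 's \<times> 's \<Rightarrow> real) \<Rightarrow> bool" where
  "op3_exists P f \<longleftrightarrow> (\<forall>x. integrable (P x) (\<lambda>yz. f (x, yz)))"

definition op3 :: "('s \<Rightarrow> ('s \<times> 's) measure) \<Rightarrow> ('s \<times> 's \<times> 's \<Rightarrow> real) \<Rightarrow> 's \<Rightarrow> real" where
  "op3 P f x = (\<integral>yz. f (x, yz) \<partial>P x)"

definition marginal0 ::
  "('s::topological_space \<Rightarrow> ('s \<times> 's) measure) \<Rightarrow> 's \<Rightarrow> 's measure" where
  "marginal0 P x = distr (P x) borel fst"

definition marginal1 ::
  "('s::topological_space \<Rightarrow> ('s \<times> 's) measure) \<Rightarrow> 's \<Rightarrow> 's measure" where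
  "marginal1 P x = distr (P x) borel snd"

definition Q_kernel ::
  "('s::topological_space \<Rightarrow> ('s \<times> 's) measure) \<Rightarrow> 's \<Rightarrow> 's measure" where
  "Q_kernel P x = measure_of UNIV (sets borel)
     (\<lambda>B. (emeasure (marginal0 P x) B + emeasure (marginal1 P x) B) / 2)"

primrec Q_iter ::
  "('s::topological_space \<Rightarrow> ('s \<times> 's) measure) \<Rightarrow> nat \<Rightarrow> 's \<Rightarrow> 's measure" where
  "Q_iter P 0 x = return borel x"
| "Q_iter P (Suc r) x = Q_iter P r x \<bind> Q_kernel P"

definition Q_op ::
  "('s::topological_space \<Rightarrow> ('s \<times> 's) measure) \<Rightarrow> nat \<Rightarrow> ('s \<Rightarrow> real) \<Rightarrow> 's \<Rightarrow> real" where
  "Q_op P r f x = (\<integral>y. f y \<partial>Q_iter P r x)"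

lemma space_Q_kernel [simp]: "space (Q_kernel P x) = UNIV"
  by (simp add: Q_kernel_def space_measure_of_conv)

lemma sets_Q_kernel [simp, measurable_cong]: "sets (Q_kernel P x) = sets borel"
  unfolding Q_kernel_def using sets.sigma_sets_eq[of borel] by (simp add: sets_measure_of_conv)

lemma emeasure_Q_kernel:
  assumes "B \<in> sets borel"
  shows "emeasure (Q_kernel P x) B =
    (emeasure (marginal0 P x) B + emeasure (marginal1 P x) B) / 2"
  unfolding Q_kernel_def
proof (rule emeasure_measure_of_sigma)
  show "sigma_algebra UNIV (sets borel)"
    using sets.sigma_algebra_axioms[of borel] by simp
  show "positive (sets borel)
      (\<lambda>B. (emeasure (marginal0 P x) B + emeasure (marginal1 P x) B) / 2)"
    by (simp add: positive_def)
  show "countably_additive (sets borel)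
      (\<lambda>B. (emeasure (marginal0 P x) B + emeasure (marginal1 P x) B) / 2)"
  proof (rule countably_additiveI)
    fix A :: "nat \<Rightarrow> 'a set"
    assume A: "range A \<subseteq> sets borel" "disjoint_family A" "(\<Union>i. A i) \<in> sets borel"
    have "(\<Sum>i. emeasure (N P x) (A i)) = emeasure (N P x) (\<Union>i. A i)"
      if "N = marginal0 \<or> N = marginal1" for N
      using A that by (intro suminf_emeasure) (auto simp: marginal0_def marginal1_def)
    then show "(\<Sum>i. (emeasure (marginal0 P x) (A i) + emeasure (marginal1 P x) (A i)) / 2) =
        (emeasure (marginal0 P x) (\<Union>i. A i) + emeasure (marginal1 P x) (\<Union>i. A i)) / 2"
      by (simp add: suminf_add[symmetric] divide_ennreal_def)
  qed
qed (fact assms)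

locale bifurcating_markov_chain =
  prob_space M + filtration "space M" Fil
  for M :: "'w measure" and Fil :: "nat \<Rightarrow> 'w measure" +
  fixes X :: "nat \<Rightarrow> 'w \<Rightarrow> 's::topological_space"
    and \<nu> :: "'s measure"
    and P :: "'s \<Rightarrow> ('s \<times> 's) measure"
  assumes subalgebra_Fil: "\<And>r. subalgebra M (Fil r)"
    and transition: "T_transition P"
    and adapted: "\<And>n. n \<ge> 1 \<Longrightarrow> X n \<in> Fil (gen_index n) \<rightarrow>\<^sub>M borel"
    and initial: "distr M borel (X 1) = \<nu>"
    and branching: "\<And>q f. (\<And>n. n \<in> generation q \<Longrightarrow>
        f n \<in> borel_measurable borel2 \<and> bounded (range (f n))) \<Longrightarrow>
      AE \<omega> in M. real_cond_exp M (Fil q)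
          (\<lambda>\<omega>. \<Prod>n\<in>generation q. f n (X (2 * n) \<omega>, X (2 * n + 1) \<omega>)) \<omega> =
        (\<Prod>n\<in>generation q. op2 P (f n) (X n \<omega>))"

locale admissible_space =
  fixes P :: "'s::topological_space \<Rightarrow> ('s \<times> 's) measure"
    and \<nu> :: "'s measure"
    and F :: "('s \<Rightarrow> real) set"
    and \<mu> :: "'s measure"
  assumes measurable: "F \<subseteq> borel_measurable borel"
    and add: "\<And>f g. f \<in> F \<Longrightarrow> g \<in> F \<Longrightarrow> (\<lambda>x. f x + g x) \<in> F"
    and scale: "\<And>c f. f \<in> F \<Longrightarrow> (\<lambda>x. c * f x) \<in> F"
    and const: "\<And>c. (\<lambda>_. c) \<in> F"
    and square: "\<And>f. f \<in> F \<Longrightarrow> (\<lambda>x. (f x)\<^sup>2) \<in> F"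
    and tensor_integrable:
      "\<And>f g x. f \<in> F \<Longrightarrow> g \<in> F \<Longrightarrow> integrable (P x) (\<lambda>(y, z). f y * g z)"
    and tensor: "\<And>f g. f \<in> F \<Longrightarrow> g \<in> F \<Longrightarrow> op2 P (\<lambda>(y, z). f y * g z) \<in> F"
    and prob_limit: "prob_space \<mu>" "sets \<mu> = sets borel"
    and limit_integrable: "\<And>f. f \<in> F \<Longrightarrow> integrable \<mu> f"
    and limit: "\<And>f x. f \<in> F \<Longrightarrow> (\<lambda>r. Q_op P r f x) \<longlonglongrightarrow> (\<integral>y. f y \<partial>\<mu>)"
    and dominated: "\<And>f. f \<in> F \<Longrightarrow> \<exists>g\<in>F. \<forall>r x. \<bar>Q_op P r f x\<bar> \<le> g x"
    and initial_integrable: "\<And>f. f \<in> F \<Longrightarrow> integrable \<nu> f"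

locale uniform_generation_permutation = prob_space M
  for M :: "'w measure" +
  fixes \<pi> :: "'w \<Rightarrow> nat \<Rightarrow> nat"
  assumes permutation: "\<And>\<omega>. \<omega> \<in> space M \<Longrightarrow> bij_betw (\<pi> \<omega>) {1..} {1..}"
    and invariant: "\<And>\<omega> q. \<omega> \<in> space M \<Longrightarrow> \<pi> \<omega> ` generation q = generation q"
    and independent: "indep_vars (\<lambda>q. count_space {p. p permutes generation q})
      (\<lambda>q \<omega>. restrict_id (\<pi> \<omega>) (generation q)) UNIV"
    and uniform: "\<And>q. distr M (count_space {p. p permutes generation q})
        (\<lambda>\<omega>. restrict_id (\<pi> \<omega>) (generation q)) =
      uniform_count_measure {p. p permutes generation q}"

text \<open>The library's \<^const>\<open>prob_space.indep_var\<close> requires both variables to have the same value type.\<close>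

definition independent_rvs ::
  "'w measure \<Rightarrow> 'a measure \<Rightarrow> ('w \<Rightarrow> 'a) \<Rightarrow> 'b measure \<Rightarrow> ('w \<Rightarrow> 'b) \<Rightarrow> bool" where
  "independent_rvs M A Y B Z \<longleftrightarrow> Y \<in> M \<rightarrow>\<^sub>M A \<and> Z \<in> M \<rightarrow>\<^sub>M B \<and>
     prob_space.indep_set M {Y -` C \<inter> space M |C. C \<in> sets A} {Z -` C \<inter> space M |C. C \<in> sets B}"

definition permutation_independent ::
  "'w measure \<Rightarrow> ('w \<Rightarrow> nat \<Rightarrow> nat) \<Rightarrow> (nat \<Rightarrow> 'w \<Rightarrow> 's::topological_space) \<Rightarrow> bool" where
  "permutation_independent M \<pi> X \<longleftrightarrow> independent_rvs M
     (PiM {1..} (\<lambda>_. count_space UNIV)) (\<lambda>\<omega>. restrict (\<pi> \<omega>) {1..})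
     (PiM {1..} (\<lambda>_. borel)) (\<lambda>\<omega>. restrict (\<lambda>n. X n \<omega>) {1..})"

definition triangle :: "(nat \<Rightarrow> 'w \<Rightarrow> 's) \<Rightarrow> nat \<Rightarrow> 'w \<Rightarrow> 's \<times> 's \<times> 's" where
  "triangle X i \<omega> = (X i \<omega>, X (2 * i) \<omega>, X (2 * i + 1) \<omega>)"

definition perm_sum3 ::
  "(nat \<Rightarrow> 'w \<Rightarrow> 's) \<Rightarrow> ('w \<Rightarrow> nat \<Rightarrow> nat) \<Rightarrow> nat \<Rightarrow> ('s \<times> 's \<times> 's \<Rightarrow> real) \<Rightarrow> 'w \<Rightarrow> real" where
  "perm_sum3 X \<pi> n f \<omega> = (\<Sum>i=1..n. f (triangle X (\<pi> \<omega> i) \<omega>))"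

definition perm_sum1 ::
  "(nat \<Rightarrow> 'w \<Rightarrow> 's) \<Rightarrow> ('w \<Rightarrow> nat \<Rightarrow> nat) \<Rightarrow> nat \<Rightarrow> ('s \<Rightarrow> real) \<Rightarrow> 'w \<Rightarrow> real" where
  "perm_sum1 X \<pi> n g \<omega> = (\<Sum>i=1..n. g (X (\<pi> \<omega> i) \<omega>))"

text \<open>The Gaussian law is characterised by its Fourier transform, because the covariance matrix \<open>C\<close>
  may be singular. There is at most one such \<open>N\<close>, and there is none unless the symmetric part of
  \<open>C\<close> is positive semidefinite.\<close>

definition gaussian_law :: "real ^ 'd \<Rightarrow> real ^ 'd ^ 'd \<Rightarrow> (real ^ 'd) measure \<Rightarrow> bool" where
  "gaussian_law m C N \<longleftrightarrow> prob_space N \<and> sets N = sets borel \<and>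
     (\<forall>t. (CLINT x|N. iexp (t \<bullet> x)) =
       exp (\<i> * complex_of_real (t \<bullet> m) - complex_of_real (t \<bullet> (C *v t)) / 2))"

text \<open>The library's \<^const>\<open>weak_conv_m\<close> covers laws on the real line only.\<close>

definition converges_in_distribution ::
  "'w measure \<Rightarrow> (nat \<Rightarrow> 'w \<Rightarrow> 'a::topological_space) \<Rightarrow> 'a measure \<Rightarrow> bool" where
  "converges_in_distribution M Z N \<longleftrightarrow> (\<forall>n. Z n \<in> borel_measurable M) \<and>
     (\<forall>\<phi> :: 'a \<Rightarrow> real. continuous_on UNIV \<phi> \<longrightarrow> bounded (range \<phi>) \<longrightarrow>
       (\<lambda>n. \<integral>x. \<phi> x \<partial>distr M borel (Z n)) \<longlonglongrightarrow> (\<integral>x. \<phi> x \<partial>N))"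

end

theory Submission
  imports Defs
begin

text \<open>
  By Levy's continuity theorem it suffices to treat one linear combination \<open>f\<close> of the functions. Since
  \<open>\<Pi>\<close> and \<open>X\<close> are independent, the permutation may be frozen, so that \<open>M\<^sub>n(f) - M\<^sub>n(Pf)\<close> becomes a
  sum \<open>S\<close> of centred increments over a fixed set of vertices. Given generation \<open>q\<close>, its increments are
  independent and their conditional variances are already known. Stop when the accumulated conditional
  variance exceeds \<open>\<sigma> + 1\<close>, where \<open>\<sigma>\<close> is the limit variance, and multiply \<open>exp (\<i> S)\<close> by the
  exponential of half the accumulated variance: the result is almost a martingale, the error being
  controlled by fourth moments. Hence the characteristic function of \<open>S\<close> is close to \<open>exp (- \<sigma> / 2)\<close> as
  soon as the accumulated variance is close to \<open>\<sigma>\<close> in \<open>L\<^sup>1\<close>.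

  The latter holds on average over the permutation: the second moment of a sum over a uniformly random
  part of a generation is at most that of the sum over the whole generation plus the sum of squares, and
  the second moments of the complete generations are controlled by iterating \<open>Q\<close>, which drives a
  function of vanishing \<open>\<mu>\<close>-mean to \<open>0\<close>.
\<close>

section \<open>Convergence of characteristic functions\<close>

text \<open>No rate of convergence is available: \<open>Q_op P r f\<close> tends to its limit
  pointwise, dominated by a member of \<open>F\<close>, so every bound must survive purely
  qualitative limits. The last, incomplete generation shapes the proof. Once the permutation is
  frozen, the vertices visited there may be any set of the right size, and the accumulated variance
  over them need not be near \<sigma>; only its mean distance over the permutations is small.
  Therefore the estimate for a fixed set assumes nothing about that set and is linear in the L1
  distance between accumulated variance and \<sigma>, so that it can be averaged. The level \<sigma>
  + 1 makes it linear: where the process has been stopped, that distance exceeds 1 and absorbs any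
  bounded error. A generation is treated in one step, as a product kernel given the past; no order
  inside it is chosen, and only the set of visited vertices matters. All moments must be dominated
  in \<open>F\<close>, which need not contain absolute values or third moments; hence majorants such
  as f^2 + 1 and y^2 + y^4.\<close>

inductive_set trig_poly :: "('a::real_inner \<Rightarrow> complex) set" where
  iexp: "(\<lambda>x. iexp (t \<bullet> x)) \<in> trig_poly"
| scale: "h \<in> trig_poly \<Longrightarrow> (\<lambda>x. c * h x) \<in> trig_poly"
| add: "h \<in> trig_poly \<Longrightarrow> k \<in> trig_poly \<Longrightarrow> (\<lambda>x. h x + k x) \<in> trig_poly"

lemma trig_poly_const: "(\<lambda>_. c) \<in> trig_poly"
  using trig_poly.scale[OF trig_poly.iexp[of 0], of c] by simp

lemma trig_poly_cnj:
  assumes "h \<in> trig_poly"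
  shows "(\<lambda>x. cnj (h x)) \<in> trig_poly"
  using assms
proof induction
  case (iexp t)
  show ?case
    using trig_poly.iexp[of "- t"] by (simp add: exp_cnj)
qed (auto intro: trig_poly.intros)

lemma trig_poly_mult:
  assumes "h \<in> trig_poly" "k \<in> trig_poly"
  shows "(\<lambda>x. h x * k x) \<in> trig_poly"
  using assms(1)
proof induction
  case (iexp t)
  show ?case
    using assms(2)
  proof induction
    case (iexp u)
    have "(\<lambda>x. iexp (t \<bullet> x) * iexp (u \<bullet> x)) = (\<lambda>x. iexp ((t + u) \<bullet> x))"
      by (simp add: inner_add_left exp_add[symmetric] distrib_left)
    then show ?case
      using trig_poly.iexp[of "t + u"] by simp
  next
    case (scale h c)
    then show ?case
      using trig_poly.scale[OF scale.IH, of c] by (simp add: mult.left_commute)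
  qed (auto simp: distrib_left intro: trig_poly.intros)
qed (auto simp: distrib_right mult.assoc intro: trig_poly.intros)

lemma trig_poly_continuous:
  assumes "h \<in> trig_poly"
  shows "continuous_on UNIV h"
  using assms by induction (auto intro!: continuous_intros)

lemma trig_poly_bounded:
  assumes "h \<in> trig_poly"
  shows "\<exists>B. \<forall>x. norm (h x) \<le> B"
  using assms
proof induction
  case (iexp t)
  show ?case by (auto intro: exI[of _ 1])
next
  case (scale h c)
  then obtain B where "norm (h x) \<le> B" for x by auto
  then have "\<forall>x. norm (c * h x) \<le> norm c * B"
    by (auto simp: norm_mult intro!: mult_left_mono)
  then show ?case by blast
next
  case (add h k)
  then obtain B C where "norm (h x) \<le> B" "norm (k x) \<le> C" for x by auto
  then have "\<forall>x. norm (h x + k x) \<le> B + C"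
    by (meson add_mono norm_triangle_le)
  then show ?case by blast
qed

lemma trig_poly_integrable:
  fixes h :: "'a::euclidean_space \<Rightarrow> complex"
  assumes "h \<in> trig_poly" "prob_space N" "sets N = sets borel"
  shows "integrable N h"
proof -
  interpret prob_space N by fact
  have "h \<in> borel_measurable N"
    using trig_poly_continuous[OF assms(1)] assms(3)
    by (simp add: borel_measurable_continuous_onI cong: measurable_cong_sets)
  then show ?thesis
    using trig_poly_bounded[OF assms(1)] by (auto intro: integrable_const_bound)
qed

lemma trig_poly_tendsto:
  fixes h :: "'a::euclidean_space \<Rightarrow> complex"
  assumes "h \<in> trig_poly"
    and N: "\<And>n. prob_space (N n)" "\<And>n. sets (N n) = sets borel" "prob_space N'" "sets N' = sets borel"
    and conv: "\<And>t. (\<lambda>n. CLINT x|N n. iexp (t \<bullet> x)) \<longlonglongrightarrow> (CLINT x|N'. iexp (t \<bullet> x))"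
  shows "(\<lambda>n. CLINT x|N n. h x) \<longlonglongrightarrow> (CLINT x|N'. h x)"
  using assms(1)
proof induction
  case (add h k)
  then show ?case
    using N by (simp add: trig_poly_integrable tendsto_add)
qed (auto intro!: conv tendsto_mult_left)

text \<open>The real part is not multiplicative, but Re h Re k is the real part of (h k + h cnj k) /
  2. Thus closure under conjugation makes the real parts of trigonometric polynomials an algebra, as
  Stone--Weierstrass demands.\<close>

lemma trig_poly_Re_mult:
  assumes "h \<in> trig_poly" "k \<in> trig_poly"
  shows "\<exists>l\<in>trig_poly. \<forall>x. Re (h x) * Re (k x) = Re (l x)"
proof (rule bexI)
  show "(\<lambda>x. 1/2 * (h x * k x + h x * cnj (k x))) \<in> trig_poly"
    using assms by (intro trig_poly.scale trig_poly.add trig_poly_mult trig_poly_cnj)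
qed (auto simp: field_simps)

lemma trig_poly_Re_polynomial:
  assumes "h \<in> trig_poly" "real_polynomial_function p"
  shows "\<exists>l\<in>trig_poly. \<forall>x. p (Re (h x)) = Re (l x)"
  using assms(2)
proof (induction p rule: real_polynomial_function.induct)
  case (linear p)
  then obtain a where "p = (\<lambda>x. x * a)"
    using real_bounded_linear by auto
  then show ?case
    using trig_poly.scale[OF assms(1), of "of_real a"] by (intro bexI) (auto simp: mult.commute)
next
  case (const c)
  show ?case by (intro bexI[of _ "\<lambda>_. of_real c"] trig_poly_const) auto
next
  case (add p q)
  then obtain k l where "k \<in> trig_poly" "l \<in> trig_poly" "\<forall>x. p (Re (h x)) = Re (k x)"
      "\<forall>x. q (Re (h x)) = Re (l x)" by blast
  then show ?case
    by (intro bexI[of _ "\<lambda>x. k x + l x"] trig_poly.add) auto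
next
  case (mult p q)
  then obtain k l where "k \<in> trig_poly" "l \<in> trig_poly" "\<forall>x. p (Re (h x)) = Re (k x)"
      "\<forall>x. q (Re (h x)) = Re (l x)" by blast
  then show ?case
    using trig_poly_Re_mult[of k l] by simp
qed

text \<open>The composition of \<open>u\<close> with Re h is not a trigonometric polynomial. As h is
  bounded, Weierstrass replaces \<open>u\<close> by a polynomial on an interval containing the range
  of Re h, and a polynomial in Re h is again the real part of a trigonometric polynomial.\<close>

lemma clamped_trig_poly_tendsto:
  fixes h :: "'a::euclidean_space \<Rightarrow> complex" and u :: "real \<Rightarrow> real"
  assumes h: "h \<in> trig_poly" and u: "continuous_on UNIV u"
    and N: "\<And>n. prob_space (N n)" "\<And>n. sets (N n) = sets borel" "prob_space N'" "sets N' = sets borel"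
    and conv: "\<And>t. (\<lambda>n. CLINT x|N n. iexp (t \<bullet> x)) \<longlonglongrightarrow> (CLINT x|N'. iexp (t \<bullet> x))"
  shows "(\<lambda>n. \<integral>x. u (Re (h x)) \<partial>N n) \<longlonglongrightarrow> (\<integral>x. u (Re (h x)) \<partial>N')"
proof (rule LIMSEQ_I)
  fix e :: real assume "e > 0"
  obtain B where B: "\<And>x. norm (h x) \<le> B"
    using trig_poly_bounded[OF h] by auto
  have ReB: "Re (h x) \<in> {-B..B}" for x
    using B[of x] abs_Re_le_cmod[of "h x"] by auto
  obtain p where p: "real_polynomial_function p" "\<And>y. y \<in> {-B..B} \<Longrightarrow> \<bar>u y - p y\<bar> < e/3"
    using Stone_Weierstrass_real_polynomial_function[of "{-B..B}" u "e/3"] \<open>e > 0\<close>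
      continuous_on_subset[OF u] by (auto simp: abs_minus_commute)
  obtain l where l: "l \<in> trig_poly" "\<And>x. p (Re (h x)) = Re (l x)"
    using trig_poly_Re_polynomial[OF h p(1)] by auto
  have close: "\<bar>(\<integral>x. u (Re (h x)) \<partial>L) - Re (CLINT x|L. l x)\<bar> \<le> e/3"
    if L: "prob_space L" "sets L = sets borel" for L
  proof -
    interpret prob_space L by fact
    have cont: "continuous_on UNIV (\<lambda>x. u (Re (h x)))"
      using trig_poly_continuous[OF h]
      by (intro continuous_on_compose2[OF u] continuous_intros) auto
    have lm: "(\<lambda>x. u (Re (h x))) \<in> borel_measurable L"
      using borel_measurable_continuous_onI[OF cont] L(2) by (simp cong: measurable_cong_sets)
    have int_l: "integrable L l"
      by (rule trig_poly_integrable) fact+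
    have diff: "\<bar>u (Re (h x)) - Re (l x)\<bar> \<le> e/3" for x
      using p(2)[OF ReB[of x]] l(2)[of x] by simp
    have int_d: "integrable L (\<lambda>x. u (Re (h x)) - Re (l x))"
      using lm int_l diff by (intro integrable_const_bound[where B="e/3"]) auto
    have int_u: "integrable L (\<lambda>x. u (Re (h x)))"
      using Bochner_Integration.integrable_add[OF int_d integrable_Re[OF int_l]] by simp
    have "\<bar>\<integral>x. u (Re (h x)) - Re (l x) \<partial>L\<bar> \<le> (\<integral>x. \<bar>u (Re (h x)) - Re (l x)\<bar> \<partial>L)"
      by (rule integral_abs_bound)
    also have "\<dots> \<le> (\<integral>x. e/3 \<partial>L)"
      using int_d diff by (intro integral_mono) auto
    finally show ?thesis
      using int_u int_l by (simp add: prob_space)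
  qed
  have "(\<lambda>n. Re (CLINT x|N n. l x)) \<longlonglongrightarrow> Re (CLINT x|N'. l x)"
    using trig_poly_tendsto[OF l(1) N conv] by (rule tendsto_Re)
  then obtain n0 where n0: "\<And>n. n \<ge> n0 \<Longrightarrow> \<bar>Re (CLINT x|N n. l x) - Re (CLINT x|N'. l x)\<bar> < e/3"
    using LIMSEQ_D[of _ _ "e/3"] \<open>e > 0\<close> by (metis divide_pos_pos real_norm_def zero_less_numeral)
  show "\<exists>n0. \<forall>n\<ge>n0. norm ((\<integral>x. u (Re (h x)) \<partial>N n) - (\<integral>x. u (Re (h x)) \<partial>N')) < e"
  proof (intro exI allI impI)
    fix n assume n: "n \<ge> n0"
    show "norm ((\<integral>x. u (Re (h x)) \<partial>N n) - (\<integral>x. u (Re (h x)) \<partial>N')) < e"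
      using n0[OF n] close[OF N(1,2)[of n]] close[OF N(3,4)] unfolding real_norm_def by linarith
  qed
qed


text \<open>The characteristic function of a coordinate is the given one restricted to a line, so
  the one-dimensional continuity theorem applies. It serves only the cut-off functions that yield
  tightness.\<close>

lemma coordinate_bound_tendsto:
  fixes b :: "'a::euclidean_space"
  assumes b: "b \<in> Basis" and u: "continuous_on UNIV u" "\<And>y. \<bar>u y\<bar> \<le> B"
    and N: "\<And>n. prob_space (N n)" "\<And>n. sets (N n) = sets borel" "prob_space N'" "sets N' = sets borel"
    and conv: "\<And>t. (\<lambda>n. CLINT x|N n. iexp (t \<bullet> x)) \<longlonglongrightarrow> (CLINT x|N'. iexp (t \<bullet> x))"
  shows "(\<lambda>n. \<integral>x. u (x \<bullet> b) \<partial>N n) \<longlonglongrightarrow> (\<integral>x. u (x \<bullet> b) \<partial>N' :: real)"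
proof -
  have rd: "real_distribution (distr L borel (\<lambda>x. x \<bullet> b))" if "prob_space L" "sets L = sets borel" for L
    using that by (intro real_distribution.intro prob_space.prob_space_distr real_distribution_axioms.intro)
      (auto cong: measurable_cong_sets)
  have char: "char (distr L borel (\<lambda>x. x \<bullet> b)) t = (CLINT x|L. iexp ((t *\<^sub>R b) \<bullet> x))"
    if "prob_space L" "sets L = sets borel" for L t
    unfolding char_def using that
    by (subst integral_distr) (auto cong: measurable_cong_sets simp: inner_commute)
  have int: "(\<integral>y. u y \<partial>distr L borel (\<lambda>x. x \<bullet> b)) = (\<integral>x. u (x \<bullet> b) \<partial>L)"
    if "prob_space L" "sets L = sets borel" for L
    using that borel_measurable_continuous_onI[OF u(1)]
    by (subst integral_distr) (auto cong: measurable_cong_sets)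
  have "weak_conv_m (\<lambda>n. distr (N n) borel (\<lambda>x. x \<bullet> b)) (distr N' borel (\<lambda>x. x \<bullet> b))"
    using N by (intro levy_continuity rd) (auto simp only: char intro!: conv)
  then have "(\<lambda>n. \<integral>y. u y \<partial>distr (N n) borel (\<lambda>x. x \<bullet> b)) \<longlonglongrightarrow> (\<integral>y. u y \<partial>distr N' borel (\<lambda>x. x \<bullet> b))"
    using N u by (intro weak_conv_imp_integral_bdd_continuous_conv[where B=B] rd)
      (auto simp: continuous_on_eq_continuous_at)
  then show ?thesis
    using N by (simp only: int)
qed

text \<open>Stone--Weierstrass gives a trigonometric polynomial \<open>h\<close> close to \<open>\<phi>\<close> on a cube that carries
  almost all the mass; \<open>h\<close> may be large off the cube, so it is clamped.\<close>

theorem levy_continuity_euclidean: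
  fixes N :: "nat \<Rightarrow> 'a::euclidean_space measure" and \<phi> :: "'a \<Rightarrow> real"
  assumes N: "\<And>n. prob_space (N n)" "\<And>n. sets (N n) = sets borel" "prob_space N'" "sets N' = sets borel"
    and conv: "\<And>t. (\<lambda>n. CLINT x|N n. iexp (t \<bullet> x)) \<longlonglongrightarrow> (CLINT x|N'. iexp (t \<bullet> x))"
    and \<phi>: "continuous_on UNIV \<phi>" "bounded (range \<phi>)"
  shows "(\<lambda>n. \<integral>x. \<phi> x \<partial>N n) \<longlonglongrightarrow> (\<integral>x. \<phi> x \<partial>N')"
proof (rule LIMSEQ_I)
  fix e :: real assume e: "e > 0"
  obtain B where B: "\<And>x. \<bar>\<phi> x\<bar> \<le> B"
    using \<phi>(2) unfolding bounded_iff by auto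
  have B0: "B \<ge> 0" using B[of 0] by linarith
  \<comment> \<open>\<open>w L\<close> is a continuous cut-off, 0 on [-L, L] and 1 off [-L-1, L+1],
    and \<open>W L\<close> dominates the indicator of the complement of a cube. An L chosen for the
    limit law alone works for all large n, because the integrals of \<open>W L\<close> converge:
    this is tightness.\<close>
  define w :: "real \<Rightarrow> real \<Rightarrow> real" where "w L y = min 1 (max 0 (\<bar>y\<bar> - L))" for L y
  define W where "W L x = (\<Sum>b\<in>Basis. w L (x \<bullet> b))" for L and x :: 'a
  have w: "continuous_on UNIV (w L)" "0 \<le> w L y" "w L y \<le> 1" "\<bar>w L y\<bar> \<le> 1" for L y
    unfolding w_def by (auto intro!: continuous_intros)
  have W0: "0 \<le> W L x" for L x
    unfolding W_def by (intro sum_nonneg w)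
  have contW: "continuous_on UNIV (W L)" for L
    unfolding W_def by (intro continuous_on_sum continuous_on_compose2[OF w(1)] continuous_intros) auto
  have WB: "W L x \<le> DIM('a)" for L x
    unfolding W_def using sum_mono[of Basis "\<lambda>b. w L (x \<bullet> b)" "\<lambda>_. 1"] w(3) by simp
  have intW: "integrable L' (W L)" if "prob_space L'" "sets L' = sets borel" for L' L
  proof -
    interpret prob_space L' by fact
    show ?thesis
      using borel_measurable_continuous_onI[OF contW] that(2) W0 WB
      by (intro integrable_const_bound[where B="DIM('a)"]) (auto cong: measurable_cong_sets)
  qed
  have w_meas [measurable]: "w L \<in> borel_measurable borel" for L
    by (rule borel_measurable_continuous_onI[OF w(1)])
  have W_conv: "(\<lambda>n. \<integral>x. W L x \<partial>N n) \<longlonglongrightarrow> (\<integral>x. W L x \<partial>N')" for L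
  proof -
    have int_w: "integrable L' (\<lambda>x. w L (x \<bullet> b))" if "prob_space L'" "sets L' = sets borel"
      for L' :: "'a measure" and b
    proof -
      interpret prob_space L' by fact
      have "(\<lambda>x. w L (x \<bullet> b)) \<in> borel_measurable borel" by measurable
      then have "(\<lambda>x. w L (x \<bullet> b)) \<in> borel_measurable L'"
        by (simp add: measurable_cong_sets[OF that(2) refl])
      then show ?thesis
        by (rule integrable_const_bound[where B=1, rotated]) (simp add: w)
    qed
    show ?thesis
      unfolding W_def using N
      by (simp add: int_w) (intro tendsto_sum coordinate_bound_tendsto[where B=1] w N conv, auto)
  qed
  \<comment> \<open>Off the cube the error is at most 2 B + 1 times \<open>W\<close>, so this
    \<open>d\<close> bounds it by e/4 under either law. The remaining e/2 is split into twice e/8 on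
    the cube and e/4 for the clamped polynomial.\<close>
  define d where "d = e / (4 * (2 * B + 2))"
  have d: "d > 0" unfolding d_def using e B0 by simp
  interpret N': prob_space N' by (rule N)
  have "(\<lambda>L. \<integral>x. W (real L) x \<partial>N') \<longlonglongrightarrow> (\<integral>x. 0 \<partial>N')"
  proof (rule integral_dominated_convergence[where w="\<lambda>_. DIM('a)"])
    have "(\<lambda>L. W (real L) x) \<longlonglongrightarrow> 0" for x
    proof (rule tendsto_eventually)
      obtain L0 :: nat where L0: "norm x \<le> real L0" using real_arch_simple by blast
      have "W (real L) x = 0" if "L \<ge> L0" for L
      proof -
        have "\<bar>x \<bullet> b\<bar> \<le> real L" if "b \<in> Basis" for b
          using Basis_le_norm[OF that, of x] L0 \<open>L \<ge> L0\<close> by linarith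
        then show ?thesis unfolding W_def w_def by (intro sum.neutral) auto
      qed
      then show "\<forall>\<^sub>F L in sequentially. W (real L) x = 0"
        by (auto simp: eventually_sequentially)
    qed
    then show "AE x in N'. (\<lambda>L. W (real L) x) \<longlonglongrightarrow> 0" by simp
    show "W (real L) \<in> borel_measurable N'" for L
      using intW[OF N(3,4)] by auto
    show "AE x in N'. norm (W (real L) x) \<le> DIM('a)" for L
      using W0 WB by (intro always_eventually) auto
  qed auto
  then have "(\<lambda>L. \<integral>x. W (real L) x \<partial>N') \<longlonglongrightarrow> 0" by simp
  then have "\<forall>\<^sub>F L in sequentially. (\<integral>x. W (real L) x \<partial>N') < d"
    using d by (rule order_tendstoD)
  then obtain L :: nat where L: "(\<integral>x. W (real L) x \<partial>N') < d"
    by (auto simp: eventually_sequentially)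
  define K where "K = cbox ((- real L - 1) *\<^sub>R (One::'a)) ((real L + 1) *\<^sub>R One)"
  have W1: "1 \<le> W (real L) x" if "x \<notin> K" for x
  proof -
    obtain b where b: "b \<in> Basis" "\<bar>x \<bullet> b\<bar> > real L + 1"
      using \<open>x \<notin> K\<close> by (auto simp: K_def mem_box abs_if not_le split: if_splits)
    then have "w (real L) (x \<bullet> b) = 1" by (simp add: w_def)
    then show ?thesis
      unfolding W_def using member_le_sum[of b Basis "\<lambda>b. w (real L) (x \<bullet> b)"] b w(2) by simp
  qed
  have "\<exists>g. (\<exists>h\<in>trig_poly. g = (\<lambda>x. Re (h x))) \<and> (\<forall>x\<in>K. \<bar>\<phi> x - g x\<bar> < min 1 (e / 8))"
  proof (rule Stone_Weierstrass_HOL)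
    show "compact K" unfolding K_def by (rule compact_cbox)
    show "\<exists>h\<in>trig_poly. (\<lambda>x. c) = (\<lambda>x. Re (h x))" for c
      by (intro bexI[of _ "\<lambda>_. of_real c"] trig_poly_const) auto
    show "continuous_on K g" if "\<exists>h\<in>trig_poly. g = (\<lambda>x. Re (h x))" for g
      using that trig_poly_continuous continuous_on_subset by (auto intro!: continuous_on_Re) blast
    show "\<exists>h\<in>trig_poly. (\<lambda>x. f x + g x) = (\<lambda>x. Re (h x))"
      if "(\<exists>h\<in>trig_poly. f = (\<lambda>x. Re (h x))) \<and> (\<exists>h\<in>trig_poly. g = (\<lambda>x. Re (h x)))" for f g
      using that by (auto intro!: bexI[OF _ trig_poly.add])
    show "\<exists>h\<in>trig_poly. (\<lambda>x. f x * g x) = (\<lambda>x. Re (h x))"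
      if "(\<exists>h\<in>trig_poly. f = (\<lambda>x. Re (h x))) \<and> (\<exists>h\<in>trig_poly. g = (\<lambda>x. Re (h x)))" for f g
      using that trig_poly_Re_mult by (auto simp: fun_eq_iff)
    show "\<exists>f. (\<exists>h\<in>trig_poly. f = (\<lambda>x. Re (h x))) \<and> f x \<noteq> f y" if "x \<in> K \<and> y \<in> K \<and> x \<noteq> y" for x y :: 'a
    proof -
      text \<open>The sine of \<open>t \<bullet> (z - y)\<close> separates \<open>x\<close> from \<open>y\<close> once \<open>t \<bullet> (x - y) = 1\<close>.\<close>
      define t where "t = (1 / ((x - y) \<bullet> (x - y))) *\<^sub>R (x - y)"
      have t: "t \<bullet> (x - y) = 1" using that by (simp add: t_def)
      define h where "h = (\<lambda>z. (- \<i> * iexp (- (t \<bullet> y))) * iexp (t \<bullet> z))"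
      have "h \<in> trig_poly" unfolding h_def by (intro trig_poly.intros)
      moreover have h: "h z = - \<i> * iexp (t \<bullet> (z - y))" for z
        unfolding h_def mult.assoc
        by (simp add: exp_add[symmetric] inner_diff_right algebra_simps)
      have "Re (h x) \<noteq> Re (h y)"
        unfolding h t using sin_gt_zero[of 1] pi_gt3 by (simp add: Re_exp Im_exp)
      ultimately show ?thesis by blast
    qed
    show "continuous_on K \<phi>" using continuous_on_subset[OF \<phi>(1)] by simp
    show "0 < min 1 (e / 8)" using e by simp
  qed
  then obtain h where h: "h \<in> trig_poly" "\<And>x. x \<in> K \<Longrightarrow> \<bar>\<phi> x - Re (h x)\<bar> < min 1 (e / 8)"
    by auto
  \<comment> \<open>The approximation on \<open>K\<close> is closer than 1, so Re h lies in
    [-B-1, B+1] there and the clamp changes nothing; elsewhere it keeps the error at most 2 B +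
    1.\<close>
  define u where "u y = max (- B - 1) (min (B + 1) y)" for y
  have u: "continuous_on UNIV u" "\<bar>u y\<bar> \<le> B + 1" for y
    unfolding u_def using B0 by (auto intro!: continuous_intros)
  have close: "\<bar>\<phi> x - u (Re (h x))\<bar> \<le> e / 8 + (2 * B + 1) * W (real L) x" for x
  proof (cases "x \<in> K")
    case True
    then have "u (Re (h x)) = Re (h x)"
      using h(2)[OF True] B[of x] unfolding u_def by auto
    moreover have "0 \<le> (2 * B + 1) * W (real L) x" using W0 B0 by simp
    ultimately show ?thesis using h(2)[OF True] by linarith
  next
    case False
    have "\<bar>\<phi> x - u (Re (h x))\<bar> \<le> 2 * B + 1" using B[of x] u(2)[of "Re (h x)"] by linarith
    also have "\<dots> \<le> (2 * B + 1) * W (real L) x" using W1[OF False] B0 by simp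
    finally show ?thesis using e by linarith
  qed
  have cont: "continuous_on UNIV (\<lambda>x. u (Re (h x)))"
    using trig_poly_continuous[OF h(1)]
    by (intro continuous_on_compose2[OF u(1)] continuous_intros) auto
  have close_int: "\<bar>(\<integral>x. \<phi> x \<partial>L') - (\<integral>x. u (Re (h x)) \<partial>L')\<bar> \<le> e / 8 + (2 * B + 1) * (\<integral>x. W (real L) x \<partial>L')"
    if "prob_space L'" "sets L' = sets borel" for L'
  proof -
    interpret prob_space L' by fact
    have i1: "integrable L' \<phi>"
      using borel_measurable_continuous_onI[OF \<phi>(1)] that(2) B
      by (intro integrable_const_bound[where B=B]) (auto cong: measurable_cong_sets)
    have i2: "integrable L' (\<lambda>x. u (Re (h x)))"
      using borel_measurable_continuous_onI[OF cont] that(2) u(2)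
      by (intro integrable_const_bound[where B="B+1"]) (auto cong: measurable_cong_sets)
    have "\<bar>(\<integral>x. \<phi> x \<partial>L') - (\<integral>x. u (Re (h x)) \<partial>L')\<bar> = \<bar>\<integral>x. \<phi> x - u (Re (h x)) \<partial>L'\<bar>"
      using i1 i2 by simp
    also have "\<dots> \<le> (\<integral>x. \<bar>\<phi> x - u (Re (h x))\<bar> \<partial>L')" by (rule integral_abs_bound)
    also have "\<dots> \<le> (\<integral>x. e / 8 + (2 * B + 1) * W (real L) x \<partial>L')"
      using i1 i2 intW[OF that] close by (intro integral_mono) auto
    finally show ?thesis using intW[OF that] by (simp add: prob_space)
  qed
  have "\<forall>\<^sub>F n in sequentially. (\<integral>x. W (real L) x \<partial>N n) < d"
    using W_conv L by (rule order_tendstoD)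
  moreover have "\<forall>\<^sub>F n in sequentially. dist (\<integral>x. u (Re (h x)) \<partial>N n) (\<integral>x. u (Re (h x)) \<partial>N') < e / 4"
    using clamped_trig_poly_tendsto[OF h(1) u(1) N conv] e by (intro tendstoD) auto
  ultimately have "\<forall>\<^sub>F n in sequentially. norm ((\<integral>x. \<phi> x \<partial>N n) - (\<integral>x. \<phi> x \<partial>N')) < e"
  proof eventually_elim
    case (elim n)
    have D: "(2 * B + 1) * d \<le> e / 4"
      unfolding d_def using B0 e by (simp add: field_simps)
    have "(2 * B + 1) * (\<integral>x. W (real L) x \<partial>N n) \<le> (2 * B + 1) * d"
      using elim(1) B0 by (intro mult_left_mono) auto
    moreover have "(2 * B + 1) * (\<integral>x. W (real L) x \<partial>N') < (2 * B + 1) * d"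
      using L B0 by (intro mult_strict_left_mono) auto
    ultimately show ?case
      using close_int[OF N(1,2), of n] close_int[OF N(3,4)] elim(2) D
      unfolding dist_real_def real_norm_def by linarith
  qed
  then show "\<exists>no. \<forall>n\<ge>no. norm ((\<integral>x. \<phi> x \<partial>N n) - (\<integral>x. \<phi> x \<partial>N')) < e"
    by (simp add: eventually_sequentially)
qed

section \<open>Existence of centred Gaussian laws with a possibly singular covariance\<close>

lemma inner_matrix_axis2:
  fixes C :: "real ^ 'd ^ 'd"
  assumes sym: "\<And>i j. C $ i $ j = C $ j $ i"
  shows "(t + c *\<^sub>R axis i 1) \<bullet> (C *v (t + c *\<^sub>R axis i 1)) =
    t \<bullet> (C *v t) + 2 * c * (t \<bullet> C $ i) + c\<^sup>2 * C $ i $ i"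
proof -
  have ax: "C *v axis i 1 = C $ i"
    using sym by (simp add: vec_eq_iff matrix_vector_mult_basis column_def)
  have ax2: "axis i 1 \<bullet> (C *v t) = t \<bullet> C $ i"
    by (simp add: inner_axis' matrix_vector_mul_component inner_commute)
  have ax3: "axis i 1 \<bullet> C $ i = C $ i $ i" by (simp add: inner_axis')
  show ?thesis
    by (simp add: matrix_vector_right_distrib scaleR_matrix_vector_assoc[symmetric]
        matrix_vector_mult_scaleR ax ax2 ax3 inner_add_left inner_add_right power2_eq_square algebra_simps)
qed

lemma prob_space_std_normal: "prob_space std_normal_distribution"
  using real_dist_normal_dist by (simp add: real_distribution_def)

text \<open>This is the law of x + z b with z standard normal and independent of x: the
  characteristic function picks up the factor exp (- (t \<bullet> b)^2 / 2). No density or inverse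
  covariance is involved, so degenerate directions are harmless.\<close>

lemma gaussian_law_add_rank_one:
  fixes C C' :: "real ^ 'd ^ 'd"
  assumes N: "gaussian_law 0 C' N"
    and C: "\<And>t. t \<bullet> (C *v t) = t \<bullet> (C' *v t) + (t \<bullet> b)\<^sup>2"
  shows "gaussian_law 0 C (distr (N \<Otimes>\<^sub>M std_normal_distribution) borel (\<lambda>(x, z). x + z *\<^sub>R b))"
proof -
  have pN: "prob_space N" and sN [measurable_cong]: "sets N = sets borel"
    and chN: "\<And>t. (CLINT x|N. iexp (t \<bullet> x)) = exp (\<i> * complex_of_real (t \<bullet> 0) - complex_of_real (t \<bullet> (C' *v t)) / 2)"
    using N by (auto simp: gaussian_law_def)
  interpret N: prob_space N by (rule pN)
  interpret G: prob_space std_normal_distribution by (rule prob_space_std_normal)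
  interpret pair_prob_space N std_normal_distribution ..
  have sG [measurable_cong]: "sets std_normal_distribution = sets borel" by simp
  have meas [measurable]: "(\<lambda>(x, z). x + z *\<^sub>R b) \<in> borel_measurable (N \<Otimes>\<^sub>M std_normal_distribution)"
    by measurable
  have "(CLINT x|distr (N \<Otimes>\<^sub>M std_normal_distribution) borel (\<lambda>(x, z). x + z *\<^sub>R b). iexp (t \<bullet> x)) =
      exp (\<i> * complex_of_real (t \<bullet> 0) - complex_of_real (t \<bullet> (C *v t)) / 2)" for t
  proof -
    have int: "integrable (N \<Otimes>\<^sub>M std_normal_distribution) (\<lambda>(x, z). iexp (t \<bullet> (x + z *\<^sub>R b)))"
      by (intro P.integrable_const_bound[where B=1]) (auto simp: split_beta')
    have "(CLINT x|distr (N \<Otimes>\<^sub>M std_normal_distribution) borel (\<lambda>(x, z). x + z *\<^sub>R b). iexp (t \<bullet> x)) =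
        (CLINT (x, z)|N \<Otimes>\<^sub>M std_normal_distribution. iexp (t \<bullet> (x + z *\<^sub>R b)))"
      by (subst integral_distr) (auto simp: split_beta')
    also have "\<dots> = (CLINT x|N. CLINT z|std_normal_distribution. iexp (t \<bullet> (x + z *\<^sub>R b)))"
      using integral_fst'[OF int] by simp
    also have "\<dots> = (CLINT x|N. iexp (t \<bullet> x) * (CLINT z|std_normal_distribution. iexp ((t \<bullet> b) * z)))"
      by (simp add: inner_add_right exp_add distrib_left mult.commute mult.left_commute)
    also have "\<dots> = (CLINT x|N. iexp (t \<bullet> x)) * char std_normal_distribution (t \<bullet> b)"
      by (simp add: char_def)
    also have "\<dots> = exp (\<i> * complex_of_real (t \<bullet> 0) - complex_of_real (t \<bullet> (C *v t)) / 2)"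
      unfolding chN char_std_normal_distribution C
      by (simp add: exp_of_real[symmetric] exp_add[symmetric] add_divide_distrib)
    finally show ?thesis .
  qed
  then show ?thesis
    unfolding gaussian_law_def by (auto intro!: P.prob_space_distr meas)
qed

text \<open>If the diagonal entry vanishes, the form is affine in c along t + c e_i; being bounded
  below, it has slope 0. The \<open>c\<close> of the proof would make its value -1.\<close>

lemma psd_zero_row:
  fixes C :: "real ^ 'd ^ 'd"
  assumes sym: "\<And>i j. C $ i $ j = C $ j $ i" and psd: "\<And>t. 0 \<le> t \<bullet> (C *v t)"
    and "C $ i $ i = 0"
  shows "C $ i = 0"
proof -
  have "t \<bullet> C $ i = 0" for t
  proof (rule ccontr)
    assume ne: "t \<bullet> C $ i \<noteq> 0"
    define c where "c = - (t \<bullet> (C *v t) + 1) / (2 * (t \<bullet> C $ i))"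
    have "0 \<le> t \<bullet> (C *v t) + 2 * c * (t \<bullet> C $ i)"
      using psd[of "t + c *\<^sub>R axis i 1"] inner_matrix_axis2[OF sym, of t c i] assms(3) by simp
    moreover have "2 * c * (t \<bullet> C $ i) = - (t \<bullet> (C *v t) + 1)" using ne by (simp add: c_def)
    ultimately show False by linarith
  qed
  then show ?thesis
    using inner_eq_zero_iff[of "C $ i"] by blast
qed

text \<open>One Cholesky step at \<open>i\<close> with \<open>C $ i $ i > 0\<close> splits off a rank-one matrix and leaves a positive
  semidefinite matrix with one more vanishing diagonal entry.\<close>

theorem gaussian_law_exists:
  fixes C :: "real ^ 'd ^ 'd"
  assumes "\<And>i j. C $ i $ j = C $ j $ i" and "\<And>t. 0 \<le> t \<bullet> (C *v t)"
  shows "\<exists>N. gaussian_law 0 C N"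
  using assms
proof (induction "card {i. C $ i $ i \<noteq> 0}" arbitrary: C rule: less_induct)
  case less
  note sym = less.prems(1) and psd = less.prems(2)
  show ?case
  proof (cases "\<forall>i. C $ i $ i = 0")
    case True
    then have "C = 0" using psd_zero_row[OF sym psd] by (simp add: vec_eq_iff)
    then have "gaussian_law 0 C (return borel 0)"
      by (auto simp: gaussian_law_def prob_space_return integral_return)
    then show ?thesis ..
  next
    case False
    then obtain i where i: "C $ i $ i \<noteq> 0" by auto
    define a where "a = C $ i $ i"
    have diag: "C $ j $ j = axis j 1 \<bullet> (C *v axis j 1)" for j
      using inner_matrix_axis2[OF sym, of 0 1 j] by simp
    have a: "a > 0" using psd[of "axis i 1"] diag[of i] i by (simp add: a_def)
    \<comment> \<open>Row i of \<open>C\<close> divided by the root of the pivot: \<open>C'\<close>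
      is the Schur complement of that pivot, so its row i vanishes.\<close>
    define b where "b = (1 / sqrt a) *\<^sub>R C $ i"
    define C' :: "real ^ 'd ^ 'd" where "C' = (\<chi> j k. C $ j $ k - b $ j * b $ k)"
    have quad: "t \<bullet> (C *v t) = t \<bullet> (C' *v t) + (t \<bullet> b)\<^sup>2" for t
    proof -
      have "C' *v t = C *v t - (t \<bullet> b) *\<^sub>R b"
        by (simp add: vec_eq_iff C'_def matrix_vector_mult_def inner_vec_def sum_subtractf
            sum_distrib_left algebra_simps)
      then show ?thesis by (simp add: inner_diff_right power2_eq_square)
    qed
    have psd': "0 \<le> t \<bullet> (C' *v t)" for t
    proof -
      \<comment> \<open>The minimiser of the form along t - l e_i. The minimum is t \<bullet> (C'
        t), which is therefore nonnegative.\<close>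
      define l where "l = (t \<bullet> C $ i) / a"
      have "0 \<le> t \<bullet> (C *v t) + 2 * (-l) * (t \<bullet> C $ i) + l\<^sup>2 * a"
        using psd[of "t + (-l) *\<^sub>R axis i 1"] inner_matrix_axis2[OF sym, of t "-l" i] by (simp add: a_def)
      also have "\<dots> = t \<bullet> (C *v t) - (t \<bullet> C $ i)\<^sup>2 / a"
        using a by (simp add: l_def power2_eq_square field_simps)
      also have "(t \<bullet> C $ i)\<^sup>2 / a = (t \<bullet> b)\<^sup>2"
        using a by (simp add: b_def power_divide)
      finally show ?thesis using quad[of t] by simp
    qed
    have sym': "C' $ j $ k = C' $ k $ j" for j k
      using sym by (simp add: C'_def)
    have diag': "C' $ j $ j = axis j 1 \<bullet> (C' *v axis j 1)" for j
      using inner_matrix_axis2[OF sym', of 0 1 j] by simp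
    have "C' $ i $ i = 0" using a by (simp add: C'_def b_def a_def[symmetric] field_simps)
    moreover have "C' $ j $ j = 0" if "C $ j $ j = 0" for j
      using psd'[of "axis j 1", folded diag'[of j]] that zero_le_square[of "b $ j"]
      by (simp add: C'_def)
    ultimately have "{j. C' $ j $ j \<noteq> 0} \<subset> {j. C $ j $ j \<noteq> 0}"
      using i by auto
    then have "card {j. C' $ j $ j \<noteq> 0} < card {j. C $ j $ j \<noteq> 0}"
      by (intro psubset_card_mono) auto
    then obtain N where "gaussian_law 0 C' N"
      using less.hyps[OF _ sym' psd'] by auto
    then show ?thesis
      using gaussian_law_add_rank_one[OF _ quad] by blast
  qed
qed

section \<open>Integrals against kernels\<close>

text \<open>\<open>f\<close> may be unbounded, and integrability under the mixture gives
  integrability under \<open>K x\<close> for almost every x only. The positive and negative parts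
  are handled as nonnegative integrals, finite almost everywhere; the inner integral is their
  difference off a null set, where its default value does no harm.\<close>

lemma
  fixes f :: "'b \<Rightarrow> real"
  assumes K [measurable]: "K \<in> M \<rightarrow>\<^sub>M subprob_algebra L" and f: "integrable (M \<bind> K) f"
    and ne: "space M \<noteq> {}"
  shows integrable_integral_bind: "integrable M (\<lambda>x. \<integral>y. f y \<partial>K x)"
    and integral_bind_integrable: "(\<integral>y. f y \<partial>(M \<bind> K)) = (\<integral>x. (\<integral>y. f y \<partial>K x) \<partial>M)"
proof -
  have sK: "sets (K x) = sets L" if "x \<in> space M" for x
    using subprob_measurableD(2)[OF K that] .
  have f_meas [measurable]: "f \<in> borel_measurable L"
    using borel_measurable_integrable[OF f] sets_bind[OF sK ne] by (simp cong: measurable_cong_sets)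
  define a b where "a x = (\<integral>\<^sup>+y. ennreal (f y) \<partial>K x)" and "b x = (\<integral>\<^sup>+y. ennreal (- f y) \<partial>K x)" for x
  have [measurable]: "a \<in> borel_measurable M" "b \<in> borel_measurable M"
    unfolding a_def b_def by measurable
  have A: "(\<integral>\<^sup>+y. ennreal (f y) \<partial>(M \<bind> K)) = (\<integral>\<^sup>+x. a x \<partial>M)"
    and B: "(\<integral>\<^sup>+y. ennreal (- f y) \<partial>(M \<bind> K)) = (\<integral>\<^sup>+x. b x \<partial>M)"
    unfolding a_def b_def by (subst nn_integral_bind[where B=L]; simp)+
  have fin: "(\<integral>\<^sup>+x. a x \<partial>M) \<noteq> \<infinity>" "(\<integral>\<^sup>+x. b x \<partial>M) \<noteq> \<infinity>"
    using f unfolding real_integrable_def A B by auto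
  have AEa: "AE x in M. a x \<noteq> \<infinity>" and AEb: "AE x in M. b x \<noteq> \<infinity>"
    by (rule nn_integral_noteq_infinite[OF _ fin(1)], measurable,
        rule nn_integral_noteq_infinite[OF _ fin(2)], measurable)
  have int: "integrable (K x) f" if "x \<in> space M" "a x \<noteq> \<infinity>" "b x \<noteq> \<infinity>" for x
    using that sK[OF that(1)] unfolding real_integrable_def a_def b_def
    by (auto cong: measurable_cong_sets)
  have eq: "AE x in M. (\<integral>y. f y \<partial>K x) = enn2real (a x) - enn2real (b x)"
    using AEa AEb AE_space
    by eventually_elim (simp add: real_lebesgue_integral_def[OF int] a_def[symmetric] b_def[symmetric])
  have enn: "integrable M (\<lambda>x. enn2real (c x)) \<and> (\<integral>x. enn2real (c x) \<partial>M) = enn2real (\<integral>\<^sup>+x. c x \<partial>M)"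
    if [measurable]: "c \<in> borel_measurable M" and "(\<integral>\<^sup>+x. c x \<partial>M) \<noteq> \<infinity>" "AE x in M. c x \<noteq> \<infinity>" for c
  proof -
    have e: "(\<integral>\<^sup>+x. ennreal (enn2real (c x)) \<partial>M) = (\<integral>\<^sup>+x. c x \<partial>M)"
      using that(3) by (intro nn_integral_cong_AE) (auto simp: less_top)
    then have "integrable M (\<lambda>x. enn2real (c x))"
      using that(2) by (intro integrableI_nonneg) (auto simp: less_top)
    then show ?thesis
      using e by (simp add: integral_eq_nn_integral)
  qed
  note ea = enn[of a, OF _ fin(1) AEa] and eb = enn[of b, OF _ fin(2) AEb]
  have m: "(\<lambda>x. \<integral>y. f y \<partial>K x) \<in> borel_measurable M"
    by (rule measurable_compose[OF K integral_measurable_subprob_algebra]) measurable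
  show "integrable M (\<lambda>x. \<integral>y. f y \<partial>K x)"
    using ea eb m eq by (subst integrable_cong_AE[OF _ _ eq]) auto
  have "(\<integral>y. f y \<partial>(M \<bind> K)) = enn2real (\<integral>\<^sup>+x. a x \<partial>M) - enn2real (\<integral>\<^sup>+x. b x \<partial>M)"
    by (simp add: real_lebesgue_integral_def[OF f] A B)
  also have "\<dots> = (\<integral>x. enn2real (a x) - enn2real (b x) \<partial>M)"
    using ea eb by simp
  also have "\<dots> = (\<integral>x. (\<integral>y. f y \<partial>K x) \<partial>M)"
    using eq m by (intro integral_cong_AE) auto
  finally show "(\<integral>y. f y \<partial>(M \<bind> K)) = (\<integral>x. (\<integral>y. f y \<partial>K x) \<partial>M)" .
qed

text \<open>Boundedness makes the inner integral exist for every x, so the real case applies to the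
  real and the imaginary part. This is the version for characteristic functions.\<close>

lemma (in finite_measure)
  fixes f :: "'b \<Rightarrow> complex"
  assumes K [measurable]: "K \<in> M \<rightarrow>\<^sub>M prob_algebra L" and f [measurable]: "f \<in> borel_measurable L"
    and bound: "\<And>y. norm (f y) \<le> B" and ne: "space M \<noteq> {}"
  shows complex_integrable_integral_bind: "complex_integrable M (\<lambda>x. CLINT y|K x. f y)"
    and complex_integral_bind: "(CLINT y|M \<bind> K. f y) = (CLINT x|M. CLINT y|K x. f y)"
proof -
  have K' [measurable]: "K \<in> M \<rightarrow>\<^sub>M subprob_algebra L" by (rule measurable_prob_algebraD) fact
  have pK: "prob_space (K x)" and sK: "sets (K x) = sets L" if "x \<in> space M" for x
    using subprob_measurableD(2)[OF K' that] measurable_space[OF K that] by (auto simp: space_prob_algebra)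
  have sb: "sets (M \<bind> K) = sets L" by (rule sets_bind[OF sK ne])
  have int_K: "integrable (K x) f" if "x \<in> space M" for x
  proof -
    interpret prob_space "K x" using pK[OF that] .
    show ?thesis using bound sK[OF that]
      by (intro integrable_const_bound[where B=B]) (auto cong: measurable_cong_sets)
  qed
  have fin: "emeasure (M \<bind> K) (space (M \<bind> K)) \<noteq> \<infinity>"
  proof -
    have "emeasure (M \<bind> K) (space (M \<bind> K)) = emeasure (M \<bind> K) (space L)"
      by (simp only: sets_eq_imp_space_eq[OF sb])
    also have "\<dots> = (\<integral>\<^sup>+x. emeasure (K x) (space L) \<partial>M)"
      by (rule emeasure_bind[OF ne K' sets.top])
    also have "\<dots> = (\<integral>\<^sup>+x. 1 \<partial>M)"
    proof (rule nn_integral_cong)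
      fix x assume "x \<in> space M"
      then show "emeasure (K x) (space L) = 1"
        using prob_space.emeasure_space_1[OF pK] sets_eq_imp_space_eq[OF sK] by metis
    qed
    finally show ?thesis using finite_emeasure_space by simp
  qed
  interpret b: finite_measure "M \<bind> K" by standard (use fin in auto)
  have int: "integrable (M \<bind> K) f"
    using bound by (intro b.integrable_const_bound[where B=B]) (auto simp: measurable_cong_sets[OF sb refl])
  show intb: "integrable M (\<lambda>x. CLINT y|K x. f y)"
  proof -
    have "(\<lambda>x. \<integral>y. Re (f y) \<partial>K x) \<in> borel_measurable M" "(\<lambda>x. \<integral>y. Im (f y) \<partial>K x) \<in> borel_measurable M"
      by (rule measurable_compose[OF K' integral_measurable_subprob_algebra], measurable)+
    then have "(\<lambda>x. Complex (\<integral>y. Re (f y) \<partial>K x) (\<integral>y. Im (f y) \<partial>K x)) \<in> borel_measurable M"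
      unfolding Complex_eq by measurable
    moreover have "Complex (\<integral>y. Re (f y) \<partial>K x) (\<integral>y. Im (f y) \<partial>K x) = (CLINT y|K x. f y)" if "x \<in> space M" for x
      using int_K[OF that] by (simp add: complex_eq_iff)
    ultimately have m: "(\<lambda>x. CLINT y|K x. f y) \<in> borel_measurable M"
      by (simp cong: measurable_cong)
    have "norm (CLINT y|K x. f y) \<le> B" if "x \<in> space M" for x
    proof -
      interpret prob_space "K x" using pK[OF that] .
      have "norm (CLINT y|K x. f y) \<le> (\<integral>y. norm (f y) \<partial>K x)" by (rule integral_norm_bound)
      also have "\<dots> \<le> (\<integral>y. B \<partial>K x)" using int_K[OF that] bound by (intro integral_mono) auto
      finally show ?thesis by (simp add: prob_space)
    qed
    then show ?thesis using m by (intro integrable_const_bound[where B=B]) auto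
  qed
  show "(CLINT y|M \<bind> K. f y) = (CLINT x|M. CLINT y|K x. f y)"
  proof (rule complex_eqI)
    show "Re (CLINT y|M \<bind> K. f y) = Re (CLINT x|M. CLINT y|K x. f y)"
      using integral_bind_integrable[OF K' _ ne, of "\<lambda>y. Re (f y)"] int intb int_K
      by (simp add: cong: Bochner_Integration.integral_cong)
    show "Im (CLINT y|M \<bind> K. f y) = Im (CLINT x|M. CLINT y|K x. f y)"
      using integral_bind_integrable[OF K' _ ne, of "\<lambda>y. Im (f y)"] int intb int_K
      by (simp add: cong: Bochner_Integration.integral_cong)
  qed
qed

section \<open>The branching property as a product kernel\<close>

lemma finite_generation [simp]: "finite (generation q)"
  by (simp add: generation_def)

lemma card_generation: "card (generation q) = 2 ^ q"
  by (simp add: generation_def)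

lemma generation_pos: "n \<in> generation q \<Longrightarrow> 1 \<le> n"
  using one_le_power[of "2::nat" q] by (auto simp: generation_def)

lemma gen_index_generation: "n \<in> generation q \<Longrightarrow> gen_index n = q"
  using floor_log_nat_eq_if[of 2 q n] by (simp add: generation_def gen_index_def)

lemma children_generation:
  assumes "n \<in> generation q"
  shows "2 * n \<in> generation (Suc q)" "2 * n + 1 \<in> generation (Suc q)"
  using assms by (auto simp: generation_def)

lemma generation_0: "generation 0 = {1}"
  by (auto simp: generation_def)

lemma ex_generation:
  assumes "1 \<le> n"
  shows "\<exists>q. n \<in> generation q"
  using ex_power_ivl1[of 2 n] assms by (auto simp: generation_def)

lemma sum_generation_Suc:
  fixes g :: "nat \<Rightarrow> 'a::comm_monoid_add"
  shows "(\<Sum>i\<in>generation (Suc q). g i) = (\<Sum>i\<in>generation q. g (2 * i) + g (2 * i + 1))"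
proof -
  have "generation (Suc q) = (\<lambda>i. 2 * i) ` generation q \<union> (\<lambda>i. 2 * i + 1) ` generation q" (is "_ = ?A \<union> ?B")
  proof (intro equalityI subsetI)
    fix m assume m: "m \<in> generation (Suc q)"
    then have "m div 2 \<in> generation q" by (auto simp: generation_def)
    moreover have "m = 2 * (m div 2) \<or> m = 2 * (m div 2) + 1" by presburger
    ultimately show "m \<in> ?A \<union> ?B" by blast
  qed (auto simp: generation_def)
  moreover have "?A \<inter> ?B = {}"
    by auto presburger
  ultimately have "sum g (generation (Suc q)) = sum g ?A + sum g ?B"
    by (simp add: sum.union_disjoint)
  also have "\<dots> = (\<Sum>i\<in>generation q. g (2 * i) + g (2 * i + 1))"
    by (simp add: sum.reindex inj_on_def sum.distrib)
  finally show ?thesis .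
qed

context bifurcating_markov_chain
begin

definition children :: "nat \<Rightarrow> 'w \<Rightarrow> nat \<Rightarrow> 's \<times> 's" where
  "children q \<omega> = (\<lambda>n\<in>generation q. (X (2 * n) \<omega>, X (2 * n + 1) \<omega>))"

definition children_kernel :: "nat \<Rightarrow> 'w \<Rightarrow> (nat \<Rightarrow> 's \<times> 's) measure" where
  "children_kernel q \<omega> = PiM (generation q) (\<lambda>n. P (X n \<omega>))"

abbreviation children_space :: "nat \<Rightarrow> (nat \<Rightarrow> 's \<times> 's) measure" where
  "children_space q \<equiv> PiM (generation q) (\<lambda>_. borel2)"

lemma P_measurable [measurable]: "P \<in> borel \<rightarrow>\<^sub>M prob_algebra borel2"
  using transition by (simp add: T_transition_def)

lemma prob_space_P: "prob_space (P x)"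
  and sets_P [measurable_cong, simp]: "sets (P x) = sets borel2"
  using measurable_space[OF P_measurable, of x] by (auto simp: space_prob_algebra)

lemma space_P [simp]: "space (P x) = UNIV"
  using sets_eq_imp_space_eq[OF sets_P, of x] by (simp add: space_pair_measure)

lemma product_prob_space_P: "product_prob_space (\<lambda>n. P (y n))"
  using prob_space_P by (intro product_prob_spaceI)

lemma space_Fil: "space (Fil q) = space M"
  using subalgebra_Fil by (simp add: subalgebra_def)

lemma measurable_Fil: "f \<in> Fil q \<rightarrow>\<^sub>M N \<Longrightarrow> f \<in> M \<rightarrow>\<^sub>M N"
  using subalgebra_Fil measurable_from_subalg by blast

lemma measurable_Fil_mono: "f \<in> Fil q \<rightarrow>\<^sub>M N \<Longrightarrow> q \<le> r \<Longrightarrow> f \<in> Fil r \<rightarrow>\<^sub>M N"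
  using sets_F_mono space_Fil unfolding measurable_def by fastforce

lemma X_measurable_Fil: "n \<in> generation q \<Longrightarrow> X n \<in> Fil q \<rightarrow>\<^sub>M borel"
  using adapted[of n] gen_index_generation[of n q] generation_pos[of n q] by simp

lemma X_measurable [measurable]: "1 \<le> n \<Longrightarrow> X n \<in> M \<rightarrow>\<^sub>M borel"
  using adapted measurable_Fil by blast

lemma children_measurable [measurable]: "children q \<in> M \<rightarrow>\<^sub>M children_space q"
  unfolding children_def
proof (rule measurable_restrict)
  fix n assume "n \<in> generation q"
  then have [measurable]: "X (2 * n) \<in> M \<rightarrow>\<^sub>M borel" "X (2 * n + 1) \<in> M \<rightarrow>\<^sub>M borel"
    using generation_pos[of n q] by (auto intro!: X_measurable)
  show "(\<lambda>\<omega>. (X (2 * n) \<omega>, X (2 * n + 1) \<omega>)) \<in> M \<rightarrow>\<^sub>M borel2" by measurable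
qed

lemma prob_space_children_kernel: "prob_space (children_kernel q \<omega>)"
  unfolding children_kernel_def by (rule prob_space_PiM) (rule prob_space_P)

lemma sets_children_kernel [measurable_cong, simp]: "sets (children_kernel q \<omega>) = sets (children_space q)"
  unfolding children_kernel_def by (rule sets_PiM_cong) auto

lemma children_kernel_PiE:
  assumes "\<And>n. n \<in> generation q \<Longrightarrow> A n \<in> sets borel2"
  shows "emeasure (children_kernel q \<omega>) (PiE (generation q) A) = (\<Prod>n\<in>generation q. emeasure (P (X n \<omega>)) (A n))"
proof -
  interpret P: product_prob_space "\<lambda>n. P (X n \<omega>)" by (rule product_prob_space_P)
  show ?thesis
    unfolding children_kernel_def using assms by (intro P.emeasure_PiM) auto
qed

lemma children_kernel_measurable [measurable]:
  "children_kernel q \<in> Fil q \<rightarrow>\<^sub>M prob_algebra (children_space q)"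
proof (rule measurable_prob_algebra_generated[OF sets_PiM Int_stable_prod_algebra prod_algebra_sets_into_space])
  fix B assume "B \<in> prod_algebra (generation q) (\<lambda>_. borel2 :: ('s \<times> 's) measure)"
  then obtain A where B: "B = PiE (generation q) A" "A \<in> (\<Pi> i\<in>generation q. sets borel2)"
    by (rule prod_algebraE_all)
  have "(\<lambda>\<omega>. emeasure (P (X n \<omega>)) (A n)) \<in> borel_measurable (Fil q)" if "n \<in> generation q" for n
  proof -
    have [measurable]: "A n \<in> sets borel2" using B that by auto
    have "(\<lambda>\<omega>. P (X n \<omega>)) \<in> Fil q \<rightarrow>\<^sub>M subprob_algebra borel2"
      using X_measurable_Fil[OF that] measurable_prob_algebraD[OF P_measurable] by (rule measurable_compose)
    then show ?thesis
      by (rule measurable_compose) (rule measurable_emeasure_subprob_algebra, measurable)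
  qed
  then show "(\<lambda>\<omega>. emeasure (children_kernel q \<omega>) B) \<in> borel_measurable (Fil q)"
    using B by (subst measurable_cong[OF children_kernel_PiE[of q A, folded B(1)]]) (auto intro!: borel_measurable_prod_ennreal)
qed (auto intro: prob_space_children_kernel)

text \<open>The branching axiom enters here and nowhere else, with indicators as test functions:
  their product is the indicator that the daughters lie in the rectangle. Integrating over an event
  of \<open>Fil q\<close> removes the conditional expectation.\<close>

lemma branching_rectangle:
  assumes A: "\<And>n. n \<in> generation q \<Longrightarrow> A n \<in> sets borel2" and E: "E \<in> sets (Fil q)"
  shows "emeasure M {\<omega>\<in>E. children q \<omega> \<in> PiE (generation q) A} =
    (\<integral>\<^sup>+\<omega>. indicator E \<omega> * emeasure (children_kernel q \<omega>) (PiE (generation q) A) \<partial>M)"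
proof -
  interpret sub: finite_measure_subalgebra M "Fil q"
    by standard (rule subalgebra_Fil)
  interpret sub: sigma_finite_subalgebra M "Fil q"
    by (rule finite_measure_subalgebra_is_sigma_finite) (rule sub.finite_measure_subalgebra_axioms)
  have EM [measurable]: "E \<in> sets M" using E subalgebra_Fil by (auto simp: subalgebra_def)
  have EM' [measurable]: "E \<in> sets (Fil q)" by fact
  have A' [measurable]: "A n \<in> sets borel2" if "n \<in> generation q" for n using A[OF that] .
  have X2 [measurable]: "X (2 * n) \<in> M \<rightarrow>\<^sub>M borel" "X (Suc (2 * n)) \<in> M \<rightarrow>\<^sub>M borel" "X n \<in> M \<rightarrow>\<^sub>M borel"
    if "n \<in> generation q" for n
    using generation_pos[OF that] by (auto intro!: X_measurable)
  define g where "g = (\<lambda>\<omega>. \<Prod>n\<in>generation q. indicator (A n) (X (2 * n) \<omega>, X (2 * n + 1) \<omega>) :: real)"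
  define h where "h = (\<lambda>\<omega>. \<Prod>n\<in>generation q. measure (P (X n \<omega>)) (A n))"
  have g_meas [measurable]: "g \<in> borel_measurable M"
    unfolding g_def
    by (intro borel_measurable_prod) (use A' X2 in measurable)
  have h_meas [measurable]: "h \<in> borel_measurable M"
    unfolding h_def
    by (intro borel_measurable_prod) (use A' X2 in measurable)
  have g1: "0 \<le> g \<omega>" "g \<omega> \<le> 1" for \<omega>
    unfolding g_def by (auto intro!: prod_nonneg prod_le_1)
  have h1: "0 \<le> h \<omega>" for \<omega> unfolding h_def by (auto intro!: prod_nonneg)
  have "AE \<omega> in M. real_cond_exp M (Fil q) g \<omega> = (\<Prod>n\<in>generation q. op2 P (indicator (A n)) (X n \<omega>))"
    unfolding g_def using A
    by (intro branching conjI) (auto simp: bounded_iff intro!: exI[of _ 1])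
  then have ce: "AE \<omega> in M. real_cond_exp M (Fil q) g \<omega> = h \<omega>"
    unfolding h_def op2_def by simp
  have int: "integrable M (\<lambda>\<omega>. indicator E \<omega> * g \<omega>)"
    using g1 by (intro integrable_const_bound[where B=1]) (auto simp: indicator_def)
  have "ennreal (\<integral>\<omega>. indicator E \<omega> * g \<omega> \<partial>M) = (\<integral>\<^sup>+\<omega>. ennreal (indicator E \<omega> * g \<omega>) \<partial>M)"
    using int g1 by (intro nn_integral_eq_integral[symmetric]) auto
  also have "\<dots> = (\<integral>\<^sup>+\<omega>. indicator {\<omega>\<in>E. children q \<omega> \<in> PiE (generation q) A} \<omega> \<partial>M)"
  proof (rule nn_integral_cong)
    fix \<omega>
    have "g \<omega> = (if children q \<omega> \<in> PiE (generation q) A then 1 else 0)"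
      unfolding g_def children_def
      by (auto simp: prod.neutral PiE_iff indicator_def)
    then show "ennreal (indicator E \<omega> * g \<omega>) = indicator {\<omega>\<in>E. children q \<omega> \<in> PiE (generation q) A} \<omega>"
      by (auto simp: indicator_def)
  qed
  also have "\<dots> = emeasure M {\<omega>\<in>E. children q \<omega> \<in> PiE (generation q) A}"
  proof -
    have "{\<omega>\<in>E. children q \<omega> \<in> PiE (generation q) A} = E \<inter> (children q -` PiE (generation q) A \<inter> space M)"
      using sets.sets_into_space[OF EM] by auto
    moreover have "PiE (generation q) A \<in> sets (children_space q)"
      using A by (intro sets_PiM_I_finite) auto
    ultimately show ?thesis by simp
  qed
  finally have 1: "emeasure M {\<omega>\<in>E. children q \<omega> \<in> PiE (generation q) A} = ennreal (\<integral>\<omega>. indicator E \<omega> * g \<omega> \<partial>M)" ..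
  note ci = sub.real_cond_exp_intg[OF int _ g_meas]
  have "(\<integral>\<omega>. indicator E \<omega> * g \<omega> \<partial>M) = (\<integral>\<omega>. indicator E \<omega> * real_cond_exp M (Fil q) g \<omega> \<partial>M)"
    by (rule ci(2)[symmetric]) measurable
  also have "\<dots> = (\<integral>\<omega>. indicator E \<omega> * h \<omega> \<partial>M)"
    using ce by (intro integral_cong_AE) auto
  finally have 2: "(\<integral>\<omega>. indicator E \<omega> * g \<omega> \<partial>M) = (\<integral>\<omega>. indicator E \<omega> * h \<omega> \<partial>M)" .
  have hint: "integrable M (\<lambda>\<omega>. indicator E \<omega> * h \<omega>)"
  proof -
    have i: "integrable M (\<lambda>\<omega>. indicator E \<omega> * real_cond_exp M (Fil q) g \<omega>)"
      by (rule ci(1)) measurable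
    have ae: "AE \<omega> in M. indicator E \<omega> * real_cond_exp M (Fil q) g \<omega> = indicator E \<omega> * h \<omega>"
      using ce by eventually_elim simp
    show ?thesis
      by (rule integrable_cong_AE_imp[OF i _ ae]) measurable
  qed
  have "ennreal (\<integral>\<omega>. indicator E \<omega> * h \<omega> \<partial>M) = (\<integral>\<^sup>+\<omega>. ennreal (indicator E \<omega> * h \<omega>) \<partial>M)"
    using hint h1 by (intro nn_integral_eq_integral[symmetric]) auto
  also have "\<dots> = (\<integral>\<^sup>+\<omega>. indicator E \<omega> * emeasure (children_kernel q \<omega>) (PiE (generation q) A) \<partial>M)"
  proof (rule nn_integral_cong)
    fix \<omega>
    have "emeasure (children_kernel q \<omega>) (PiE (generation q) A) = (\<Prod>n\<in>generation q. emeasure (P (X n \<omega>)) (A n))"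
      by (rule children_kernel_PiE) (rule A)
    also have "\<dots> = (\<Prod>n\<in>generation q. ennreal (measure (P (X n \<omega>)) (A n)))"
      by (intro prod.cong refl finite_measure.emeasure_eq_measure prob_space.finite_measure prob_space_P)
    also have "\<dots> = ennreal (h \<omega>)"
      unfolding h_def by (intro prod_ennreal) simp
    finally have "ennreal (h \<omega>) = emeasure (children_kernel q \<omega>) (PiE (generation q) A)" ..
    then show "ennreal (indicator E \<omega> * h \<omega>) = indicator E \<omega> * emeasure (children_kernel q \<omega>) (PiE (generation q) A)"
      by (simp add: indicator_def)
  qed
  finally show ?thesis unfolding 1 2 .
qed

text \<open>For fixed \<open>E\<close> both sides are finite measures in \<open>B\<close> that agree
  on rectangles, a generator stable under intersection. Writing the right side as a
  \<open>bind\<close> provides its countable additivity.\<close>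

lemma branching_box:
  assumes B: "B \<in> sets (children_space q)" and E: "E \<in> sets (Fil q)"
  shows "emeasure M {\<omega>\<in>E. children q \<omega> \<in> B} = (\<integral>\<^sup>+\<omega>. indicator E \<omega> * emeasure (children_kernel q \<omega>) B \<partial>M)"
proof -
  let ?S = "children_space q" and ?R = "restr_to_subalg M (Fil q)"
  have EM [measurable]: "E \<in> sets M" using E subalgebra_Fil by (auto simp: subalgebra_def)
  have ER: "E \<in> sets ?R" using E subalgebra_Fil by (simp add: sets_restr_to_subalg)
  have Kf: "children_kernel q \<in> Fil q \<rightarrow>\<^sub>M subprob_algebra ?S"
    by (rule measurable_prob_algebraD) measurable
  then have K: "children_kernel q \<in> ?R \<rightarrow>\<^sub>M subprob_algebra ?S"
    unfolding measurable_cong_sets[OF sets_restr_to_subalg[OF subalgebra_Fil] refl] .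
  then have K': "children_kernel q \<in> density ?R (indicator E) \<rightarrow>\<^sub>M subprob_algebra ?S"
    by simp
  have ne: "space (density ?R (indicator E)) \<noteq> {}"
    using not_empty subalgebra_Fil by (simp add: space_restr_to_subalg)
  define m1 m2 where "m1 = distr (density M (indicator E)) ?S (children q)"
    and "m2 = density ?R (indicator E) \<bind> children_kernel q"
  have m1: "emeasure m1 C = emeasure M {\<omega>\<in>E. children q \<omega> \<in> C}" if [measurable]: "C \<in> sets ?S" for C
  proof -
    have "emeasure m1 C = (\<integral>\<^sup>+\<omega>. indicator E \<omega> * indicator (children q -` C \<inter> space M) \<omega> \<partial>M)"
      unfolding m1_def by (simp add: emeasure_distr emeasure_density)
    also have "\<dots> = (\<integral>\<^sup>+\<omega>. indicator (E \<inter> (children q -` C \<inter> space M)) \<omega> \<partial>M)"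
      by (intro nn_integral_cong) (auto simp: indicator_def)
    also have "\<dots> = emeasure M (E \<inter> (children q -` C \<inter> space M))"
      by simp
    also have "E \<inter> (children q -` C \<inter> space M) = {\<omega>\<in>E. children q \<omega> \<in> C}"
      using sets.sets_into_space[OF EM] by auto
    finally show ?thesis .
  qed
  have m2: "emeasure m2 C = (\<integral>\<^sup>+\<omega>. indicator E \<omega> * emeasure (children_kernel q \<omega>) C \<partial>M)"
    if C: "C \<in> sets ?S" for C
  proof -
    have mf: "(\<lambda>\<omega>. emeasure (children_kernel q \<omega>) C) \<in> borel_measurable (Fil q)"
      using measurable_emeasure_subprob_algebra[OF C] by (rule measurable_compose[OF Kf])
    have "emeasure m2 C = (\<integral>\<^sup>+\<omega>. emeasure (children_kernel q \<omega>) C \<partial>density ?R (indicator E))"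
      unfolding m2_def by (rule emeasure_bind[OF ne K' C])
    also have "\<dots> = (\<integral>\<^sup>+\<omega>. indicator E \<omega> * emeasure (children_kernel q \<omega>) C \<partial>?R)"
      using mf ER
      by (intro nn_integral_density)
        (simp_all only: measurable_cong_sets[OF sets_restr_to_subalg[OF subalgebra_Fil] refl] borel_measurable_indicator E)
    also have "\<dots> = (\<integral>\<^sup>+\<omega>. indicator E \<omega> * emeasure (children_kernel q \<omega>) C \<partial>M)"
      using mf E subalgebra_Fil by (intro nn_integral_subalgebra2) auto
    finally show ?thesis .
  qed
  have "m1 = m2"
  proof (rule measure_eqI_PiM_finite[OF finite_generation, of m1 q "\<lambda>_. borel2" m2])
    show "sets m1 = sets ?S" unfolding m1_def by simp
    show "sets m2 = sets ?S"
      unfolding m2_def using ne by (intro sets_bind) auto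
    fix A :: "nat \<Rightarrow> ('s \<times> 's) set" assume A: "\<And>i. i \<in> generation q \<Longrightarrow> A i \<in> sets borel2"
    then have "PiE (generation q) A \<in> sets ?S" by (intro sets_PiM_I_finite) auto
    then show "emeasure m1 (PiE (generation q) A) = emeasure m2 (PiE (generation q) A)"
      using branching_rectangle[OF A E] by (simp add: m1 m2)
  next
    show "range (\<lambda>_::nat. space ?S) \<subseteq> prod_algebra (generation q) (\<lambda>_. borel2)"
      by (auto simp: space_PiM intro!: prod_algebraI_finite)
    have "emeasure m1 (space ?S) \<le> emeasure M (space M)"
      unfolding m1[OF sets.top] by (rule emeasure_space)
    then show "emeasure m1 (space ?S) \<noteq> \<infinity>"
      unfolding emeasure_space_1 by (metis ennreal_one_neq_top infinity_ennreal_def top_unique)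
  qed simp
  then show ?thesis using m1[OF B] m2[OF B] by simp
qed

definition joint_kernel :: "nat \<Rightarrow> 'w \<Rightarrow> ('w \<times> (nat \<Rightarrow> 's \<times> 's)) measure" where
  "joint_kernel q \<omega> = distr (children_kernel q \<omega>) (Fil q \<Otimes>\<^sub>M children_space q) (Pair \<omega>)"

lemma joint_kernel_measurable:
  "joint_kernel q \<in> restr_to_subalg M (Fil q) \<rightarrow>\<^sub>M prob_algebra (Fil q \<Otimes>\<^sub>M children_space q)"
  unfolding joint_kernel_def measurable_cong_sets[OF sets_restr_to_subalg[OF subalgebra_Fil] refl]
  by (rule measurable_distr_prob_space2[of _ _ "children_space q"]) measurable

text \<open>A second extension from rectangles, now in both coordinates. The kernel keeps \<omega>
  itself as first coordinate, so everything known at time q can be carried along while the daughters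
  are integrated out. From here on this disintegration takes the place of conditional
  expectations.\<close>

lemma joint_law:
  "distr M (Fil q \<Otimes>\<^sub>M children_space q) (\<lambda>\<omega>. (\<omega>, children q \<omega>)) = restr_to_subalg M (Fil q) \<bind> joint_kernel q"
proof -
  let ?S = "children_space q" and ?R = "restr_to_subalg M (Fil q)"
  let ?L = "Fil q \<Otimes>\<^sub>M ?S"
  have meas: "(\<lambda>\<omega>. (\<omega>, children q \<omega>)) \<in> M \<rightarrow>\<^sub>M ?L"
    by (intro measurable_Pair measurable_Fil[of "\<lambda>x. x" q]) auto
  have K: "joint_kernel q \<in> ?R \<rightarrow>\<^sub>M subprob_algebra ?L"
    by (rule measurable_prob_algebraD[OF joint_kernel_measurable])
  have ne: "space ?R \<noteq> {}"
    using not_empty subalgebra_Fil by (simp add: space_restr_to_subalg)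
  show ?thesis
  proof (rule measure_eqI_generator_eq[OF Int_stable_pair_measure_generator[of "Fil q" ?S]])
    show "{a \<times> b |a b. a \<in> sets (Fil q) \<and> b \<in> sets ?S} \<subseteq> Pow (space (Fil q) \<times> space ?S)"
      by (rule pair_measure_closed)
    show "sets (distr M ?L (\<lambda>\<omega>. (\<omega>, children q \<omega>))) = sigma_sets (space (Fil q) \<times> space ?S) {a \<times> b |a b. a \<in> sets (Fil q) \<and> b \<in> sets ?S}"
      by (simp add: sets_pair_measure)
    show "sets (?R \<bind> joint_kernel q) = sigma_sets (space (Fil q) \<times> space ?S) {a \<times> b |a b. a \<in> sets (Fil q) \<and> b \<in> sets ?S}"
      using sets_bind[OF subprob_measurableD(2)[OF K] ne] by (simp add: sets_pair_measure)
    show "range (\<lambda>_::nat. space (Fil q) \<times> space ?S) \<subseteq> {a \<times> b |a b. a \<in> sets (Fil q) \<and> b \<in> sets ?S}"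
      by auto
    have "prob_space (distr M ?L (\<lambda>\<omega>. (\<omega>, children q \<omega>)))" by (rule prob_space_distr) fact
    then show "emeasure (distr M ?L (\<lambda>\<omega>. (\<omega>, children q \<omega>))) (space (Fil q) \<times> space ?S) \<noteq> \<infinity>"
      using finite_measure.emeasure_finite prob_space.finite_measure by auto
    fix Z assume "Z \<in> {a \<times> b |a b. a \<in> sets (Fil q) \<and> b \<in> sets ?S}"
    then obtain E B where Z: "Z = E \<times> B" and E: "E \<in> sets (Fil q)" and B: "B \<in> sets ?S" by auto
    have ZL: "Z \<in> sets ?L" using Z E B by simp
    have "emeasure (distr M ?L (\<lambda>\<omega>. (\<omega>, children q \<omega>))) Z = emeasure M {\<omega>\<in>E. children q \<omega> \<in> B}"
      using meas ZL sets.sets_into_space[OF E] space_Fil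
      by (subst emeasure_distr) (auto simp: Z intro!: arg_cong[where f="emeasure M"])
    also have "\<dots> = (\<integral>\<^sup>+\<omega>. indicator E \<omega> * emeasure (children_kernel q \<omega>) B \<partial>M)"
      by (rule branching_box[OF B E])
    also have "\<dots> = (\<integral>\<^sup>+\<omega>. indicator E \<omega> * emeasure (children_kernel q \<omega>) B \<partial>?R)"
    proof (rule nn_integral_subalgebra2[OF subalgebra_Fil, symmetric])
      have "(\<lambda>\<omega>. emeasure (children_kernel q \<omega>) B) \<in> borel_measurable (Fil q)"
        using measurable_emeasure_subprob_algebra[OF B]
        by (rule measurable_compose[OF measurable_prob_algebraD[OF children_kernel_measurable]])
      then show "(\<lambda>\<omega>. indicator E \<omega> * emeasure (children_kernel q \<omega>) B) \<in> borel_measurable (Fil q)"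
        using E by auto
    qed
    also have "\<dots> = (\<integral>\<^sup>+\<omega>. emeasure (joint_kernel q \<omega>) Z \<partial>?R)"
    proof (rule nn_integral_cong)
      fix \<omega> assume "\<omega> \<in> space ?R"
      then have \<omega>: "\<omega> \<in> space (Fil q)" using subalgebra_Fil space_Fil by (simp add: space_restr_to_subalg)
      have "emeasure (joint_kernel q \<omega>) Z = emeasure (children_kernel q \<omega>) (Pair \<omega> -` Z \<inter> space (children_kernel q \<omega>))"
        unfolding joint_kernel_def using \<omega> ZL by (intro emeasure_distr) auto
      also have "Pair \<omega> -` Z \<inter> space (children_kernel q \<omega>) = (if \<omega> \<in> E then B else {})"
        using sets.sets_into_space[OF B] sets_eq_imp_space_eq[OF sets_children_kernel] by (auto simp: Z)
      finally show "indicator E \<omega> * emeasure (children_kernel q \<omega>) B = emeasure (joint_kernel q \<omega>) Z"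
        by (simp add: indicator_def)
    qed
    also have "\<dots> = emeasure (?R \<bind> joint_kernel q) Z"
      by (rule emeasure_bind[OF ne K ZL, symmetric])
    finally show "emeasure (distr M ?L (\<lambda>\<omega>. (\<omega>, children q \<omega>))) Z = emeasure (?R \<bind> joint_kernel q) Z" .
  qed auto
qed

lemma joint_measurable: "(\<lambda>\<omega>. (\<omega>, children q \<omega>)) \<in> M \<rightarrow>\<^sub>M Fil q \<Otimes>\<^sub>M children_space q"
  by (intro measurable_Pair measurable_Fil[of "\<lambda>x. x" q]) auto

lemma Pair_measurable: "\<omega> \<in> space M \<Longrightarrow> Pair \<omega> \<in> children_kernel q \<omega> \<rightarrow>\<^sub>M Fil q \<Otimes>\<^sub>M children_space q"
  using space_Fil by (simp add: measurable_cong_sets[OF sets_children_kernel refl])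

lemma space_restr_Fil: "space (restr_to_subalg M (Fil q)) = space M"
  using subalgebra_Fil by (simp add: space_restr_to_subalg)

text \<open>The nonnegative version supplies integrability before any is known; the real and complex
  versions below serve moments and characteristic functions.\<close>

lemma nn_integral_children:
  assumes [measurable]: "\<Phi> \<in> borel_measurable (Fil q \<Otimes>\<^sub>M children_space q)"
  shows "(\<integral>\<^sup>+\<omega>. \<Phi> (\<omega>, children q \<omega>) \<partial>M) = (\<integral>\<^sup>+\<omega>. \<integral>\<^sup>+y. \<Phi> (\<omega>, y) \<partial>children_kernel q \<omega> \<partial>M)"
proof -
  have K: "joint_kernel q \<in> restr_to_subalg M (Fil q) \<rightarrow>\<^sub>M subprob_algebra (Fil q \<Otimes>\<^sub>M children_space q)"
    by (rule measurable_prob_algebraD[OF joint_kernel_measurable])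
  have "(\<integral>\<^sup>+\<omega>. \<Phi> (\<omega>, children q \<omega>) \<partial>M) = (\<integral>\<^sup>+z. \<Phi> z \<partial>(restr_to_subalg M (Fil q) \<bind> joint_kernel q))"
    unfolding joint_law[symmetric] by (rule nn_integral_distr[OF joint_measurable, symmetric]) measurable
  also have "\<dots> = (\<integral>\<^sup>+\<omega>. \<integral>\<^sup>+z. \<Phi> z \<partial>joint_kernel q \<omega> \<partial>restr_to_subalg M (Fil q))"
    by (rule nn_integral_bind[OF _ K]) measurable
  also have "\<dots> = (\<integral>\<^sup>+\<omega>. \<integral>\<^sup>+y. \<Phi> (\<omega>, y) \<partial>children_kernel q \<omega> \<partial>restr_to_subalg M (Fil q))"
    unfolding joint_kernel_def
    by (intro nn_integral_cong nn_integral_distr Pair_measurable) (simp_all add: space_restr_Fil)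
  also have "\<dots> = (\<integral>\<^sup>+\<omega>. \<integral>\<^sup>+y. \<Phi> (\<omega>, y) \<partial>children_kernel q \<omega> \<partial>M)"
    by (rule nn_integral_subalgebra2[OF subalgebra_Fil])
      (rule nn_integral_measurable_subprob_algebra2[of "\<lambda>\<omega> y. \<Phi> (\<omega>, y)" _ "children_space q"],
        use assms in simp, rule measurable_prob_algebraD[OF children_kernel_measurable])
  finally show ?thesis .
qed

lemma
  fixes \<Phi> :: "_ \<Rightarrow> real"
  assumes \<Phi>: "\<Phi> \<in> borel_measurable (Fil q \<Otimes>\<^sub>M children_space q)"
    and int: "integrable M (\<lambda>\<omega>. \<Phi> (\<omega>, children q \<omega>))"
  shows integrable_integral_children: "integrable M (\<lambda>\<omega>. \<integral>y. \<Phi> (\<omega>, y) \<partial>children_kernel q \<omega>)"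
    and integral_children: "(\<integral>\<omega>. \<Phi> (\<omega>, children q \<omega>) \<partial>M) = (\<integral>\<omega>. (\<integral>y. \<Phi> (\<omega>, y) \<partial>children_kernel q \<omega>) \<partial>M)"
proof -
  let ?R = "restr_to_subalg M (Fil q)"
  have K: "joint_kernel q \<in> ?R \<rightarrow>\<^sub>M subprob_algebra (Fil q \<Otimes>\<^sub>M children_space q)"
    by (rule measurable_prob_algebraD[OF joint_kernel_measurable])
  have ne: "space ?R \<noteq> {}" using not_empty by (simp add: space_restr_Fil)
  have i: "integrable (?R \<bind> joint_kernel q) \<Phi>"
    unfolding joint_law[symmetric] using int by (simp add: integrable_distr_eq[OF joint_measurable \<Phi>])
  have eq: "(\<integral>z. \<Phi> z \<partial>joint_kernel q \<omega>) = (\<integral>y. \<Phi> (\<omega>, y) \<partial>children_kernel q \<omega>)" if "\<omega> \<in> space ?R" for \<omega>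
    unfolding joint_kernel_def using that \<Phi>
    by (intro integral_distr Pair_measurable) (auto simp: space_restr_Fil)
  have iR: "integrable ?R (\<lambda>\<omega>. \<integral>y. \<Phi> (\<omega>, y) \<partial>children_kernel q \<omega>)"
    using integrable_integral_bind[OF K i ne] eq by (simp cong: Bochner_Integration.integrable_cong)
  then show "integrable M (\<lambda>\<omega>. \<integral>y. \<Phi> (\<omega>, y) \<partial>children_kernel q \<omega>)"
    by (rule integrable_from_subalg[OF subalgebra_Fil])
  have "(\<integral>\<omega>. \<Phi> (\<omega>, children q \<omega>) \<partial>M) = (\<integral>z. \<Phi> z \<partial>(?R \<bind> joint_kernel q))"
    unfolding joint_law[symmetric] by (rule integral_distr[OF joint_measurable \<Phi>, symmetric])
  also have "\<dots> = (\<integral>\<omega>. (\<integral>y. \<Phi> (\<omega>, y) \<partial>children_kernel q \<omega>) \<partial>?R)"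
    using integral_bind_integrable[OF K i ne] eq by (simp cong: Bochner_Integration.integral_cong)
  also have "\<dots> = (\<integral>\<omega>. (\<integral>y. \<Phi> (\<omega>, y) \<partial>children_kernel q \<omega>) \<partial>M)"
    by (rule integral_subalgebra2[OF subalgebra_Fil])
      (rule borel_measurable_integrable[OF iR,
        unfolded measurable_cong_sets[OF sets_restr_to_subalg[OF subalgebra_Fil] refl]])
  finally show "(\<integral>\<omega>. \<Phi> (\<omega>, children q \<omega>) \<partial>M) = (\<integral>\<omega>. (\<integral>y. \<Phi> (\<omega>, y) \<partial>children_kernel q \<omega>) \<partial>M)" .
qed

lemma
  fixes \<Phi> :: "_ \<Rightarrow> complex"
  assumes \<Phi>: "\<Phi> \<in> borel_measurable (Fil q \<Otimes>\<^sub>M children_space q)" and bound: "\<And>z. norm (\<Phi> z) \<le> B"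
  shows complex_integrable_integral_children: "complex_integrable M (\<lambda>\<omega>. CLINT y|children_kernel q \<omega>. \<Phi> (\<omega>, y))"
    and complex_integral_children:
      "(CLINT \<omega>|M. \<Phi> (\<omega>, children q \<omega>)) = (CLINT \<omega>|M. CLINT y|children_kernel q \<omega>. \<Phi> (\<omega>, y))"
proof -
  let ?R = "restr_to_subalg M (Fil q)"
  interpret R: finite_measure ?R
    by (rule finite_measure_restr_to_subalg[OF subalgebra_Fil]) (rule finite_measure_axioms)
  have ne: "space ?R \<noteq> {}" using not_empty by (simp add: space_restr_Fil)
  have eq: "(CLINT z|joint_kernel q \<omega>. \<Phi> z) = (CLINT y|children_kernel q \<omega>. \<Phi> (\<omega>, y))" if "\<omega> \<in> space ?R" for \<omega>
    unfolding joint_kernel_def using that \<Phi>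
    by (intro integral_distr Pair_measurable) (auto simp: space_restr_Fil)
  have iR: "complex_integrable ?R (\<lambda>\<omega>. CLINT y|children_kernel q \<omega>. \<Phi> (\<omega>, y))"
    using R.complex_integrable_integral_bind[OF joint_kernel_measurable \<Phi> bound ne] eq
    by (simp cong: Bochner_Integration.integrable_cong)
  then show "complex_integrable M (\<lambda>\<omega>. CLINT y|children_kernel q \<omega>. \<Phi> (\<omega>, y))"
    by (rule integrable_from_subalg[OF subalgebra_Fil])
  have "(CLINT \<omega>|M. \<Phi> (\<omega>, children q \<omega>)) = (CLINT z|?R \<bind> joint_kernel q. \<Phi> z)"
    unfolding joint_law[symmetric] by (rule integral_distr[OF joint_measurable \<Phi>, symmetric])
  also have "\<dots> = (CLINT \<omega>|?R. CLINT y|children_kernel q \<omega>. \<Phi> (\<omega>, y))"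
    using R.complex_integral_bind[OF joint_kernel_measurable \<Phi> bound ne] eq
    by (simp cong: Bochner_Integration.integral_cong)
  also have "\<dots> = (CLINT \<omega>|M. CLINT y|children_kernel q \<omega>. \<Phi> (\<omega>, y))"
    by (rule integral_subalgebra2[OF subalgebra_Fil])
      (rule borel_measurable_integrable[OF iR,
        unfolded measurable_cong_sets[OF sets_restr_to_subalg[OF subalgebra_Fil] refl]])
  finally show "(CLINT \<omega>|M. \<Phi> (\<omega>, children q \<omega>)) = (CLINT \<omega>|M. CLINT y|children_kernel q \<omega>. \<Phi> (\<omega>, y))" .
qed

end

section \<open>The mean kernel on an admissible space\<close>

text \<open>Independence turns the mixed terms into products of means, and the diagonal contributes
  the second moments. An equality would have variances in the last sum; the subtracted squares of
  the means are dropped.\<close>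

lemma (in product_prob_space) integral_sum_square_le:
  fixes f :: "'i \<Rightarrow> 'a \<Rightarrow> real"
  assumes I: "finite I" and f: "\<And>i. i \<in> I \<Longrightarrow> integrable (M i) (f i)"
    and f2: "\<And>i. i \<in> I \<Longrightarrow> integrable (M i) (\<lambda>x. (f i x)\<^sup>2)"
  shows "(\<integral>y. (\<Sum>i\<in>I. f i (y i))\<^sup>2 \<partial>PiM I M) \<le> (\<Sum>i\<in>I. \<integral>x. f i x \<partial>M i)\<^sup>2 + (\<Sum>i\<in>I. \<integral>x. (f i x)\<^sup>2 \<partial>M i)"
proof -
  define e where "e i = (\<integral>x. f i x \<partial>M i)" for i
  have diag: "integrable (PiM I M) (\<lambda>y. f i (y i) * f i (y i)) \<and>
      (\<integral>y. f i (y i) * f i (y i) \<partial>PiM I M) = (\<integral>x. (f i x)\<^sup>2 \<partial>M i)" if i: "i \<in> I" for i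
  proof -
    have *: "(\<Prod>k\<in>I. (if k = i then (\<lambda>x. (f i x)\<^sup>2) else (\<lambda>_. 1)) (y k)) = f i (y i) * f i (y i)" for y
      using I i by (subst prod.remove[of I i]) (auto simp: power2_eq_square intro!: prod.neutral)
    have **: "(\<Prod>k\<in>I. \<integral>x. (if k = i then (\<lambda>x. (f i x)\<^sup>2) else (\<lambda>_. 1)) x \<partial>M k) = (\<integral>x. (f i x)\<^sup>2 \<partial>M i)"
      using I i M.prob_space by (subst prod.remove[of I i]) (auto intro!: prod.neutral)
    show ?thesis
      using product_integrable_prod[OF I, of "\<lambda>k. if k = i then (\<lambda>x. (f i x)\<^sup>2) else (\<lambda>_. 1)"]
        product_integral_prod[OF I, of "\<lambda>k. if k = i then (\<lambda>x. (f i x)\<^sup>2) else (\<lambda>_. 1)"] f2[OF i]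
      unfolding * ** by auto
  qed
  have off: "integrable (PiM I M) (\<lambda>y. f i (y i) * f j (y j)) \<and>
      (\<integral>y. f i (y i) * f j (y j) \<partial>PiM I M) = e i * e j" if ij: "i \<in> I" "j \<in> I" "i \<noteq> j" for i j
  proof -
    let ?h = "\<lambda>k. if k = i then f i else if k = j then f j else (\<lambda>_. 1)"
    have *: "(\<Prod>k\<in>I. ?h k (y k)) = f i (y i) * f j (y j)" for y
    proof -
      have "(\<Prod>k\<in>I. ?h k (y k)) = (\<Prod>k\<in>{i, j}. ?h k (y k))"
        using I ij by (intro prod.mono_neutral_right) auto
      then show ?thesis using ij by simp
    qed
    have **: "(\<Prod>k\<in>I. \<integral>x. ?h k x \<partial>M k) = e i * e j"
    proof -
      have "(\<Prod>k\<in>I. \<integral>x. ?h k x \<partial>M k) = (\<Prod>k\<in>{i, j}. \<integral>x. ?h k x \<partial>M k)"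
        using I ij M.prob_space by (intro prod.mono_neutral_right) auto
      then show ?thesis using ij by (simp add: e_def)
    qed
    show ?thesis
      using product_integrable_prod[OF I, of ?h] product_integral_prod[OF I, of ?h] f ij
      unfolding * ** by auto
  qed
  have ij: "integrable (PiM I M) (\<lambda>y. f i (y i) * f j (y j)) \<and>
      (\<integral>y. f i (y i) * f j (y j) \<partial>PiM I M) \<le> e i * e j + (if i = j then \<integral>x. (f i x)\<^sup>2 \<partial>M i else 0)"
    if "i \<in> I" "j \<in> I" for i j
    using that diag[of i] off[of i j] by auto
  have "(\<integral>y. (\<Sum>i\<in>I. f i (y i))\<^sup>2 \<partial>PiM I M) = (\<Sum>i\<in>I. \<Sum>j\<in>I. \<integral>y. f i (y i) * f j (y j) \<partial>PiM I M)"
    unfolding power2_eq_square sum_product using ij by simp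
  also have "\<dots> \<le> (\<Sum>i\<in>I. \<Sum>j\<in>I. e i * e j + (if i = j then \<integral>x. (f i x)\<^sup>2 \<partial>M i else 0))"
    using ij by (intro sum_mono) auto
  also have "\<dots> = (\<Sum>i\<in>I. e i)\<^sup>2 + (\<Sum>i\<in>I. \<integral>x. (f i x)\<^sup>2 \<partial>M i)"
    using I by (simp add: sum.distrib power2_eq_square sum_product)
  finally show ?thesis by (simp add: e_def)
qed

text \<open>An admissible space need not contain |f|, but it contains f^2 + 1. With this majorant,
  integrability is propagated down the tree and along the iterates of Q.\<close>

lemma abs_le_square_plus_1: "\<bar>a :: real\<bar> \<le> a\<^sup>2 + 1"
proof -
  have "0 \<le> (\<bar>a\<bar> - 1)\<^sup>2" by simp
  then show ?thesis unfolding power2_diff power2_abs by simp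
qed

locale admissible_chain =
  bifurcating_markov_chain M Fil X \<nu> P + adm: admissible_space P \<nu> F \<mu>
  for M :: "'w measure" and Fil :: "nat \<Rightarrow> 'w measure" and X :: "nat \<Rightarrow> 'w \<Rightarrow> 's::topological_space"
    and \<nu> :: "'s measure" and P :: "'s \<Rightarrow> ('s \<times> 's) measure" and F :: "('s \<Rightarrow> real) set"
    and \<mu> :: "'s measure"
begin

lemma F_measurable: "f \<in> F \<Longrightarrow> f \<in> borel_measurable borel"
  using adm.measurable by auto

lemma F_diff:
  assumes "f \<in> F" "g \<in> F"
  shows "(\<lambda>x. f x - g x) \<in> F"
  using adm.add[OF assms(1) adm.scale[OF assms(2), of "-1"]] by simp

lemma F_mult:
  assumes "f \<in> F" "g \<in> F"
  shows "(\<lambda>x. f x * g x) \<in> F"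
proof -
  have "(\<lambda>x. 1/4 * ((f x + g x)\<^sup>2 - (f x - g x)\<^sup>2)) \<in> F"
    by (intro adm.scale F_diff adm.square adm.add assms)
  then show ?thesis by (simp add: power2_eq_square algebra_simps)
qed

lemma F_sum:
  fixes f :: "'i \<Rightarrow> 's \<Rightarrow> real"
  assumes "\<And>i. i \<in> I \<Longrightarrow> f i \<in> F"
  shows "(\<lambda>x. \<Sum>i\<in>I. f i x) \<in> F"
  using assms by (induction I rule: infinite_finite_induct) (auto intro: adm.const adm.add)

text \<open>\<open>Q\<close> as an operator, written through \<open>P\<close> so that stability of
  \<open>F\<close> under it follows from the tensor axiom; \<open>Q_kernel_integral\<close>
  identifies it with integration against \<open>Q_kernel\<close>.\<close>

definition mean :: "('s \<Rightarrow> real) \<Rightarrow> 's \<Rightarrow> real" where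
  "mean f x = ((\<integral>yz. f (fst yz) \<partial>P x) + (\<integral>yz. f (snd yz) \<partial>P x)) / 2"

lemma integrable_fst: "f \<in> F \<Longrightarrow> integrable (P x) (\<lambda>yz. f (fst yz))"
  using adm.tensor_integrable[OF _ adm.const[of 1], of f x] by (simp add: split_beta')

lemma integrable_snd: "f \<in> F \<Longrightarrow> integrable (P x) (\<lambda>yz. f (snd yz))"
  using adm.tensor_integrable[OF adm.const[of 1], of f x] by (simp add: split_beta')

lemma integrable_fst_snd: "f \<in> F \<Longrightarrow> g \<in> F \<Longrightarrow> integrable (P x) (\<lambda>yz. f (fst yz) * g (snd yz))"
  using adm.tensor_integrable[of f g x] by (simp add: split_beta')

lemma mean_in_F:
  assumes "f \<in> F"
  shows "mean f \<in> F"
proof -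
  have "(\<lambda>x. 1/2 * (op2 P (\<lambda>(y, z). f y * 1) x + op2 P (\<lambda>(y, z). 1 * f z) x)) \<in> F"
    by (intro adm.scale adm.add adm.tensor assms adm.const)
  then show ?thesis
    unfolding op2_def mean_def[abs_def] by (simp add: split_beta')
qed

lemma mean_iter_in_F: "f \<in> F \<Longrightarrow> (mean ^^ r) f \<in> F"
  by (induction r) (auto intro: mean_in_F)

lemma mean_mono:
  assumes "f \<in> F" "g \<in> F" "\<And>x. f x \<le> g x"
  shows "mean f x \<le> mean g x"
  unfolding mean_def using assms
  by (intro divide_right_mono add_mono integral_mono integrable_fst integrable_snd) auto

lemma mean_iter_mono:
  assumes "f \<in> F" "g \<in> F" "\<And>x. f x \<le> g x"
  shows "(mean ^^ r) f x \<le> (mean ^^ r) g x"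
  using assms by (induction r arbitrary: x) (auto intro!: mean_mono mean_iter_in_F)

section \<open>The measure \<open>Q_kernel\<close>, its iterates and their action on
  \<open>F\<close>\<close>

definition coin_child :: "'s \<Rightarrow> bool \<Rightarrow> 's measure" where
  "coin_child x b = (if b then marginal0 P x else marginal1 P x)"

lemma marginal_measurable [measurable]:
  "marginal0 P \<in> borel \<rightarrow>\<^sub>M prob_algebra borel" "marginal1 P \<in> borel \<rightarrow>\<^sub>M prob_algebra borel"
  unfolding marginal0_def[abs_def] marginal1_def[abs_def]
  by (intro measurable_distr_prob_space[THEN measurable_compose[OF P_measurable]]; measurable)+

lemma coin_child_measurable: "coin_child x \<in> measure_pmf p \<rightarrow>\<^sub>M subprob_algebra borel"
  using measurable_space[OF marginal_measurable(1), of x] measurable_space[OF marginal_measurable(2), of x]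
  by (auto simp: coin_child_def space_prob_algebra space_subprob_algebra prob_space_imp_subprob_space
      measurable_def sets_measure_pmf)

text \<open>A fair coin selects the daughter to follow. As a \<open>bind\<close>, the mixture of the
  two marginals inherits the integration rules for kernels.\<close>

lemma Q_kernel_eq: "Q_kernel P x = measure_pmf (bernoulli_pmf (1/2)) \<bind> coin_child x"
proof (rule measure_eqI)
  show "sets (Q_kernel P x) = sets (measure_pmf (bernoulli_pmf (1/2)) \<bind> coin_child x)"
    by (subst sets_bind[where N=borel]) (auto simp: coin_child_def marginal0_def marginal1_def)
  fix B assume "B \<in> sets (Q_kernel P x)"
  then have B: "B \<in> sets borel" by simp
  have half: "ennreal (1/2) = 1/2"
    using divide_ennreal[of 1 2] by simp
  show "emeasure (Q_kernel P x) B = emeasure (measure_pmf (bernoulli_pmf (1/2)) \<bind> coin_child x) B"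
    unfolding emeasure_Q_kernel[OF B]
    by (subst emeasure_bind[OF _ coin_child_measurable B])
      (auto simp: coin_child_def half ennreal_divide_times distrib_right[symmetric] divide_ennreal_def)
qed

lemma Q_kernel_measurable [measurable]: "Q_kernel P \<in> borel \<rightarrow>\<^sub>M prob_algebra borel"
proof (rule measurable_prob_algebra_generated[of borel UNIV "sets borel"])
  have "UNIV = space (borel :: 's measure)" by simp
  then show "sets (borel :: 's measure) = sigma_sets UNIV (sets borel)"
    by (metis sets.sigma_sets_eq)
  show "Int_stable (sets (borel :: 's measure))" by (rule sets.Int_stable)
  have p: "prob_space (marginal0 P a)" "prob_space (marginal1 P a)" for a
    unfolding marginal0_def marginal1_def
    by (auto intro!: prob_space.prob_space_distr prob_space_P)
  show "prob_space (Q_kernel P a)" for a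
  proof (rule prob_spaceI)
    have "emeasure (Q_kernel P a) UNIV = (1 + 1) / 2"
      using p[THEN prob_space.emeasure_space_1, of a]
      by (subst emeasure_Q_kernel) (auto simp: marginal0_def marginal1_def)
    then show "emeasure (Q_kernel P a) (space (Q_kernel P a)) = 1"
      by simp
  qed
  fix A assume A: "A \<in> sets (borel :: 's measure)"
  have "(\<lambda>a. emeasure (m a) A) \<in> borel_measurable borel" if "m \<in> borel \<rightarrow>\<^sub>M prob_algebra borel" for m
    using measurable_emeasure_subprob_algebra[OF A]
    by (rule measurable_compose[OF measurable_prob_algebraD[OF that]])
  note [measurable] = this[OF marginal_measurable(1)] this[OF marginal_measurable(2)]
  show "(\<lambda>a. emeasure (Q_kernel P a) A) \<in> borel_measurable borel"
    unfolding emeasure_Q_kernel[OF A] divide_ennreal_def by measurable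
qed auto

lemma nn_integral_Q_kernel:
  assumes [measurable]: "u \<in> borel_measurable borel"
  shows "(\<integral>\<^sup>+y. u y \<partial>Q_kernel P x) = ((\<integral>\<^sup>+yz. u (fst yz) \<partial>P x) + (\<integral>\<^sup>+yz. u (snd yz) \<partial>P x)) / 2"
proof -
  have half: "ennreal (1/2) = 1/2"
    using divide_ennreal[of 1 2] by simp
  show ?thesis
    unfolding Q_kernel_eq
    by (subst nn_integral_bind[OF _ coin_child_measurable])
      (auto simp: coin_child_def half marginal0_def marginal1_def nn_integral_distr
        distrib_right[symmetric] divide_ennreal_def)
qed

lemma Q_kernel_integral:
  assumes f: "f \<in> F"
  shows "integrable (Q_kernel P x) f" "(\<integral>y. f y \<partial>Q_kernel P x) = mean f x"
proof -
  have [measurable]: "f \<in> borel_measurable borel" by (rule F_measurable[OF f])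
  have "(\<integral>\<^sup>+yz. norm (f (fst yz)) \<partial>P x) < \<infinity>" "(\<integral>\<^sup>+yz. norm (f (snd yz)) \<partial>P x) < \<infinity>"
    using integrable_fst[OF f, of x] integrable_snd[OF f, of x] by (auto simp: integrable_iff_bounded)
  then have "(\<integral>\<^sup>+y. norm (f y) \<partial>Q_kernel P x) < \<infinity>"
    by (subst nn_integral_Q_kernel) (auto simp: ennreal_divide_eq_top_iff less_top[symmetric])
  then show int: "integrable (Q_kernel P x) f"
    by (intro integrableI_bounded) (auto cong: measurable_cong_sets)
  have "(\<integral>y. f y \<partial>Q_kernel P x) = (\<integral>b. (\<integral>y. f y \<partial>coin_child x b) \<partial>measure_pmf (bernoulli_pmf (1/2)))"
    using int unfolding Q_kernel_eq by (intro integral_bind_integrable[OF coin_child_measurable]) auto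
  also have "\<dots> = mean f x"
    by (simp add: coin_child_def marginal0_def marginal1_def integral_distr mean_def add_divide_distrib)
  finally show "(\<integral>y. f y \<partial>Q_kernel P x) = mean f x" .
qed

lemma Q_iter_measurable [measurable]: "Q_iter P r \<in> borel \<rightarrow>\<^sub>M prob_algebra borel"
proof (induction r)
  case 0
  have "Q_iter P 0 = return borel" by (simp add: fun_eq_iff)
  then show ?case by (simp only: measurable_return_prob_space)
next
  case (Suc r)
  then show ?case using measurable_bind_prob_space[OF Suc Q_kernel_measurable] by simp
qed

text \<open>Integrability under the iterated kernel is carried by the induction itself: |f| is
  bounded by g = f^2 + 1, whose one-step mean is again in \<open>F\<close> and hence integrable
  under the first r steps by the induction hypothesis.\<close>

lemma Q_iter_integral:
  assumes "f \<in> F"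
  shows "integrable (Q_iter P r x) f \<and> Q_op P r f x = (mean ^^ r) f x"
  using assms
proof (induction r arbitrary: f)
  case 0
  have "integrable (return borel x) f"
    using F_measurable[OF 0] by (intro integrableI_bounded) (simp_all add: nn_integral_return)
  then show ?case
    using F_measurable[OF 0] by (simp add: Q_op_def integral_return)
next
  case (Suc r)
  have [measurable]: "f \<in> borel_measurable borel" by (rule F_measurable[OF Suc.prems])
  have Qi: "prob_space (Q_iter P r x)" "sets (Q_iter P r x) = sets borel"
    using measurable_space[OF Q_iter_measurable, of x r] by (auto simp: space_prob_algebra)
  have K: "Q_kernel P \<in> Q_iter P r x \<rightarrow>\<^sub>M subprob_algebra borel"
    using measurable_prob_algebraD[OF Q_kernel_measurable] by (simp add: measurable_cong_sets[OF Qi(2) refl])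
  have ne: "space (Q_iter P r x) \<noteq> {}"
    using prob_space.not_empty[OF Qi(1)] .
  define g where "g = (\<lambda>y. (f y)\<^sup>2 + 1)"
  have g: "g \<in> F" unfolding g_def by (intro adm.add adm.square adm.const Suc.prems)
  have g0: "\<bar>f y\<bar> \<le> g y" for y
    unfolding g_def by (rule abs_le_square_plus_1)
  have "(\<integral>\<^sup>+y. norm (f y) \<partial>(Q_iter P r x \<bind> Q_kernel P)) = (\<integral>\<^sup>+y. \<integral>\<^sup>+z. norm (f z) \<partial>Q_kernel P y \<partial>Q_iter P r x)"
    by (rule nn_integral_bind[OF _ K]) measurable
  also have "\<dots> \<le> (\<integral>\<^sup>+y. ennreal (mean g y) \<partial>Q_iter P r x)"
  proof (rule nn_integral_mono)
    fix y
    have "(\<integral>\<^sup>+z. norm (f z) \<partial>Q_kernel P y) \<le> (\<integral>\<^sup>+z. ennreal (g z) \<partial>Q_kernel P y)"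
      using g0 by (intro nn_integral_mono ennreal_leI) simp
    also have "\<dots> = ennreal (mean g y)"
      using Q_kernel_integral[OF g, of y]
      by (subst nn_integral_eq_integral) (auto intro!: always_eventually order_trans[OF abs_ge_zero g0])
    finally show "(\<integral>\<^sup>+z. norm (f z) \<partial>Q_kernel P y) \<le> ennreal (mean g y)" .
  qed
  also have "\<dots> \<le> (\<integral>\<^sup>+y. ennreal (norm (mean g y)) \<partial>Q_iter P r x)"
    by (intro nn_integral_mono ennreal_leI) simp
  also have "\<dots> < \<infinity>"
    using Suc.IH[OF mean_in_F[OF g]] by (simp add: integrable_iff_bounded)
  finally have fin: "(\<integral>\<^sup>+y. norm (f y) \<partial>(Q_iter P r x \<bind> Q_kernel P)) < \<infinity>" .
  have sb: "sets (Q_iter P r x \<bind> Q_kernel P) = sets borel"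
    using ne by (intro sets_bind) auto
  have int: "integrable (Q_iter P r x \<bind> Q_kernel P) f"
    using fin by (intro integrableI_bounded) (auto simp: measurable_cong_sets[OF sb refl])
  have "Q_op P (Suc r) f x = (\<integral>y. (\<integral>z. f z \<partial>Q_kernel P y) \<partial>Q_iter P r x)"
    unfolding Q_op_def Q_iter.simps by (rule integral_bind_integrable[OF K int ne])
  also have "\<dots> = Q_op P r (mean f) x"
    unfolding Q_op_def by (simp add: Q_kernel_integral[OF Suc.prems])
  also have "\<dots> = (mean ^^ Suc r) f x"
    using Suc.IH[OF mean_in_F[OF Suc.prems]] by (simp add: funpow_swap1)
  finally show ?case using int by simp
qed

lemma mean_iter_tendsto: "f \<in> F \<Longrightarrow> (\<lambda>r. (mean ^^ r) f x) \<longlonglongrightarrow> (\<integral>y. f y \<partial>\<mu>)"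
  using adm.limit[of f x] Q_iter_integral[of f] by simp

lemma mean_iter_dominated: "f \<in> F \<Longrightarrow> \<exists>g\<in>F. \<forall>r x. \<bar>(mean ^^ r) f x\<bar> \<le> g x"
  using adm.dominated[of f] Q_iter_integral[of f] by simp

end

section \<open>Moments along the generations\<close>

context bifurcating_markov_chain
begin

lemma children_kernel_component:
  assumes "k \<in> generation q"
  shows "distr (children_kernel q \<omega>) borel2 (\<lambda>y. y k) = P (X k \<omega>)"
proof -
  have "distr (children_kernel q \<omega>) borel2 (\<lambda>y. y k) = distr (children_kernel q \<omega>) (P (X k \<omega>)) (\<lambda>y. y k)"
    by (rule distr_cong) auto
  also have "\<dots> = P (X k \<omega>)"
    unfolding children_kernel_def using assms by (intro distr_PiM_component prob_space_P) auto
  finally show ?thesis .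
qed

lemma component_measurable:
  "k \<in> generation q \<Longrightarrow> (\<lambda>y. y k) \<in> children_kernel q \<omega> \<rightarrow>\<^sub>M borel2"
  by (simp add: measurable_cong_sets[OF sets_children_kernel refl])

lemma nn_integral_triangle:
  assumes k: "1 \<le> k" and u [measurable]: "u \<in> borel_measurable borel3"
  shows "(\<integral>\<^sup>+\<omega>. u (triangle X k \<omega>) \<partial>M) = (\<integral>\<^sup>+\<omega>. (\<integral>\<^sup>+yz. u (X k \<omega>, yz) \<partial>P (X k \<omega>)) \<partial>M)"
proof -
  obtain q where q: "k \<in> generation q"
    using ex_generation[OF k] by blast
  have [measurable]: "X k \<in> Fil q \<rightarrow>\<^sub>M borel" by (rule X_measurable_Fil[OF q])
  have [measurable]: "(\<lambda>z. u (X k (fst z), snd z k)) \<in> borel_measurable (Fil q \<Otimes>\<^sub>M children_space q)"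
    using q by measurable
  have "(\<integral>\<^sup>+\<omega>. u (triangle X k \<omega>) \<partial>M) = (\<integral>\<^sup>+\<omega>. (\<lambda>z. u (X k (fst z), snd z k)) (\<omega>, children q \<omega>) \<partial>M)"
    using q by (simp add: triangle_def children_def)
  also have "\<dots> = (\<integral>\<^sup>+\<omega>. \<integral>\<^sup>+y. (\<lambda>z. u (X k (fst z), snd z k)) (\<omega>, y) \<partial>children_kernel q \<omega> \<partial>M)"
    by (rule nn_integral_children) measurable
  also have "\<dots> = (\<integral>\<^sup>+\<omega>. (\<integral>\<^sup>+yz. u (X k \<omega>, yz) \<partial>P (X k \<omega>)) \<partial>M)"
  proof (rule nn_integral_cong)
    fix \<omega>
    show "(\<integral>\<^sup>+y. (\<lambda>z. u (X k (fst z), snd z k)) (\<omega>, y) \<partial>children_kernel q \<omega>) = (\<integral>\<^sup>+yz. u (X k \<omega>, yz) \<partial>P (X k \<omega>))"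
      unfolding children_kernel_component[OF q, of \<omega>, symmetric]
      by (subst nn_integral_distr[OF component_measurable[OF q]]) (auto simp: children_kernel_component[OF q])
  qed
  finally show ?thesis .
qed

lemma integral_triangle:
  fixes u :: "_ \<Rightarrow> real"
  assumes k: "1 \<le> k" and u [measurable]: "u \<in> borel_measurable borel3"
    and int: "integrable M (\<lambda>\<omega>. u (triangle X k \<omega>))"
  shows "(\<integral>\<omega>. u (triangle X k \<omega>) \<partial>M) = (\<integral>\<omega>. op3 P u (X k \<omega>) \<partial>M)"
    and "integrable M (\<lambda>\<omega>. op3 P u (X k \<omega>))"
proof -
  obtain q where q: "k \<in> generation q"
    using ex_generation[OF k] by blast
  have [measurable]: "X k \<in> Fil q \<rightarrow>\<^sub>M borel" by (rule X_measurable_Fil[OF q])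
  define \<Phi> where "\<Phi> = (\<lambda>z. u (X k (fst z), snd z k))"
  have \<Phi>: "\<Phi> \<in> borel_measurable (Fil q \<Otimes>\<^sub>M children_space q)"
    unfolding \<Phi>_def using q by measurable
  have eq: "u (triangle X k \<omega>) = \<Phi> (\<omega>, children q \<omega>)" for \<omega>
    using q by (simp add: triangle_def children_def \<Phi>_def)
  have inner: "(\<integral>y. \<Phi> (\<omega>, y) \<partial>children_kernel q \<omega>) = op3 P u (X k \<omega>)" for \<omega>
    unfolding op3_def children_kernel_component[OF q, of \<omega>, symmetric]
    by (subst integral_distr[OF component_measurable[OF q]]) (auto simp: children_kernel_component[OF q] \<Phi>_def)
  show "(\<integral>\<omega>. u (triangle X k \<omega>) \<partial>M) = (\<integral>\<omega>. op3 P u (X k \<omega>) \<partial>M)"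
    using integral_children[OF \<Phi>] int unfolding eq inner by simp
  show "integrable M (\<lambda>\<omega>. op3 P u (X k \<omega>))"
    using integrable_integral_children[OF \<Phi>] int unfolding eq inner by simp
qed

end

context admissible_chain
begin

text \<open>Only the law of the root is known to integrate \<open>F\<close>. The induction goes from
  mother to daughter: |f| at either daughter is bounded by the sum of g = f^2 + 1 over both sisters,
  which has conditional mean 2 \<open>mean g\<close>, a member of \<open>F\<close> at the
  mother.\<close>

lemma integrable_F:
  assumes "1 \<le> n" "f \<in> F"
  shows "integrable M (\<lambda>\<omega>. f (X n \<omega>))"
  using assms
proof (induction n arbitrary: f rule: less_induct)
  case (less n)
  have fm [measurable]: "f \<in> borel_measurable borel" by (rule F_measurable[OF less.prems(2)])
  have Xm [measurable]: "X n \<in> M \<rightarrow>\<^sub>M borel" using less.prems by simp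
  show ?case
  proof (cases "n = 1")
    case True
    then have "integrable (distr M borel (X n)) f"
      using adm.initial_integrable[OF less.prems(2)] initial by simp
    then show ?thesis by (simp add: integrable_distr_eq)
  next
    case False
    define k where "k = n div 2"
    have k: "1 \<le> k" "k < n" "n = 2 * k \<or> n = 2 * k + 1"
      using less.prems False unfolding k_def by auto
    define g where "g = (\<lambda>y. (f y)\<^sup>2 + 1)"
    have g: "g \<in> F" unfolding g_def by (intro adm.add adm.square adm.const less.prems)
    have gm [measurable]: "g \<in> borel_measurable borel" by (rule F_measurable[OF g])
    have g0: "0 \<le> g y" for y unfolding g_def by simp
    define pr :: "'s \<times> 's \<Rightarrow> 's" where "pr = (if n = 2 * k then fst else snd)"
    have prm [measurable]: "pr \<in> borel2 \<rightarrow>\<^sub>M borel" unfolding pr_def by auto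
    have prX: "X n \<omega> = pr (snd (triangle X k \<omega>))" for \<omega>
      using k(3) by (auto simp: pr_def triangle_def)
    have "(\<integral>\<^sup>+\<omega>. ennreal (norm (f (X n \<omega>))) \<partial>M) = (\<integral>\<^sup>+\<omega>. (\<lambda>u. ennreal (norm (f (pr (snd u))))) (triangle X k \<omega>) \<partial>M)"
      unfolding prX ..
    also have "\<dots> = (\<integral>\<^sup>+\<omega>. (\<integral>\<^sup>+yz. ennreal (norm (f (pr yz))) \<partial>P (X k \<omega>)) \<partial>M)"
      by (subst nn_integral_triangle[OF k(1)]) auto
    also have "\<dots> \<le> (\<integral>\<^sup>+\<omega>. ennreal (2 * mean g (X k \<omega>)) \<partial>M)"
    proof (rule nn_integral_mono)
      fix \<omega>
      have i: "integrable (P (X k \<omega>)) (\<lambda>yz. g (fst yz) + g (snd yz))"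
        using integrable_fst[OF g] integrable_snd[OF g] by auto
      have b: "norm (f (pr yz)) \<le> g (fst yz) + g (snd yz)" for yz
        using abs_le_square_plus_1[of "f (fst yz)"] abs_le_square_plus_1[of "f (snd yz)"]
          zero_le_power2[of "f (fst yz)"] zero_le_power2[of "f (snd yz)"]
        unfolding pr_def g_def real_norm_def by (auto simp del: zero_le_power2)
      have "(\<integral>\<^sup>+yz. ennreal (norm (f (pr yz))) \<partial>P (X k \<omega>)) \<le> (\<integral>\<^sup>+yz. ennreal (g (fst yz) + g (snd yz)) \<partial>P (X k \<omega>))"
        using b by (intro nn_integral_mono ennreal_leI)
      also have "\<dots> = ennreal (\<integral>yz. g (fst yz) + g (snd yz) \<partial>P (X k \<omega>))"
        using i g0 by (intro nn_integral_eq_integral) auto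
      also have "(\<integral>yz. g (fst yz) + g (snd yz) \<partial>P (X k \<omega>)) = 2 * mean g (X k \<omega>)"
        using integrable_fst[OF g] integrable_snd[OF g] by (simp add: mean_def)
      finally show "(\<integral>\<^sup>+yz. ennreal (norm (f (pr yz))) \<partial>P (X k \<omega>)) \<le> ennreal (2 * mean g (X k \<omega>))" .
    qed
    also have "\<dots> \<le> (\<integral>\<^sup>+\<omega>. ennreal (norm (2 * mean g (X k \<omega>))) \<partial>M)"
      by (intro nn_integral_mono ennreal_leI) simp
    also have "\<dots> < \<infinity>"
      using less.IH[OF k(2,1) adm.scale[OF mean_in_F[OF g], of 2]] unfolding integrable_iff_bounded by blast
    finally show ?thesis by (intro integrableI_bounded) auto
  qed
qed

lemma integrable_F_mult:
  assumes "1 \<le> m" "1 \<le> n" "f \<in> F" "g \<in> F"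
  shows "integrable M (\<lambda>\<omega>. f (X m \<omega>) * g (X n \<omega>))"
proof (rule Bochner_Integration.integrable_bound)
  show "integrable M (\<lambda>\<omega>. (f (X m \<omega>))\<^sup>2 + (g (X n \<omega>))\<^sup>2)"
    using integrable_F[OF assms(1) adm.square[OF assms(3)]] integrable_F[OF assms(2) adm.square[OF assms(4)]] by simp
  show "(\<lambda>\<omega>. f (X m \<omega>) * g (X n \<omega>)) \<in> borel_measurable M"
    using assms F_measurable by measurable
  have "\<bar>a * b\<bar> \<le> a\<^sup>2 + b\<^sup>2" for a b :: real
  proof -
    have "0 \<le> (\<bar>a\<bar> - \<bar>b\<bar>)\<^sup>2" by simp
    moreover have "0 \<le> \<bar>a\<bar> * \<bar>b\<bar>" by simp
    ultimately show ?thesis unfolding power2_diff abs_mult power2_abs by linarith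
  qed
  then show "AE \<omega> in M. norm (f (X m \<omega>) * g (X n \<omega>)) \<le> norm ((f (X m \<omega>))\<^sup>2 + (g (X n \<omega>))\<^sup>2)"
    by simp
qed

lemma integrable_sum_square:
  assumes "f \<in> F" "A \<subseteq> {1..}"
  shows "integrable M (\<lambda>\<omega>. (\<Sum>i\<in>A. f (X i \<omega>))\<^sup>2)"
  unfolding power2_eq_square sum_product using assms
  by (intro Bochner_Integration.integrable_sum integrable_F_mult) auto

lemma generation_subset: "generation q \<subseteq> {1..}"
  using generation_pos by auto

lemma integral_mean_pair:
  assumes f: "f \<in> F" and "1 \<le> k"
  shows "(\<integral>\<omega>. f (X (2 * k) \<omega>) + f (X (2 * k + 1) \<omega>) \<partial>M) = (\<integral>\<omega>. 2 * mean f (X k \<omega>) \<partial>M)"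
proof -
  have [measurable]: "f \<in> borel_measurable borel" by (rule F_measurable[OF f])
  let ?u = "\<lambda>(x, y, z). f y + f z"
  have "(\<integral>\<omega>. f (X (2 * k) \<omega>) + f (X (2 * k + 1) \<omega>) \<partial>M) = (\<integral>\<omega>. ?u (triangle X k \<omega>) \<partial>M)"
    by (simp add: triangle_def)
  also have "\<dots> = (\<integral>\<omega>. op3 P ?u (X k \<omega>) \<partial>M)"
    using integrable_F[of "2 * k" f] integrable_F[of "2 * k + 1" f] assms
    by (intro integral_triangle) (auto simp: triangle_def)
  also have "op3 P ?u = (\<lambda>x. 2 * mean f x)"
    using integrable_fst[OF f] integrable_snd[OF f] by (auto simp: op3_def mean_def split_beta')
  finally show ?thesis .
qed

lemma integral_generation_sum:
  assumes "f \<in> F"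
  shows "(\<integral>\<omega>. (\<Sum>i\<in>generation q. f (X i \<omega>)) \<partial>M) = 2 ^ q * (\<integral>x. (mean ^^ q) f x \<partial>\<nu>)"
  using assms
proof (induction q arbitrary: f)
  case 0
  have "(\<integral>x. f x \<partial>\<nu>) = (\<integral>\<omega>. f (X 1 \<omega>) \<partial>M)"
    unfolding initial[symmetric] using F_measurable[OF 0] by (intro integral_distr) auto
  then show ?case by (simp add: generation_0)
next
  case (Suc q)
  have i: "integrable M (\<lambda>\<omega>. g (X n \<omega>))" if "1 \<le> n" "g \<in> F" for n g
    using integrable_F that .
  have "(\<integral>\<omega>. (\<Sum>i\<in>generation (Suc q). f (X i \<omega>)) \<partial>M) =
      (\<integral>\<omega>. (\<Sum>i\<in>generation q. f (X (2 * i) \<omega>) + f (X (2 * i + 1) \<omega>)) \<partial>M)"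
    by (simp add: sum_generation_Suc)
  also have "\<dots> = (\<Sum>i\<in>generation q. \<integral>\<omega>. f (X (2 * i) \<omega>) + f (X (2 * i + 1) \<omega>) \<partial>M)"
    using generation_pos Suc.prems
    by (intro Bochner_Integration.integral_sum Bochner_Integration.integrable_add i) fastforce+
  also have "\<dots> = (\<Sum>i\<in>generation q. \<integral>\<omega>. 2 * mean f (X i \<omega>) \<partial>M)"
    using Suc.prems by (intro sum.cong refl integral_mean_pair generation_pos)
  also have "\<dots> = 2 * (\<integral>\<omega>. (\<Sum>i\<in>generation q. mean f (X i \<omega>)) \<partial>M)"
    using i[OF generation_pos mean_in_F[OF Suc.prems]] by (simp add: sum_distrib_left)
  also have "\<dots> = 2 ^ Suc q * (\<integral>x. (mean ^^ Suc q) f x \<partial>\<nu>)"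
    using Suc.IH[OF mean_in_F[OF Suc.prems]] by (simp add: funpow_swap1)
  finally show ?case .
qed

text \<open>Mean square of the average over generation q, since 4 ^ q is its squared
  cardinality.\<close>

definition second_moment :: "nat \<Rightarrow> ('s \<Rightarrow> real) \<Rightarrow> real" where
  "second_moment q f = (\<integral>\<omega>. (\<Sum>i\<in>generation q. f (X i \<omega>))\<^sup>2 \<partial>M) / 4 ^ q"

text \<open>Given generation q, sister pairs below different mothers are independent, so the cross
  terms only see the conditional means 2 \<open>mean g\<close>. What is left is one second moment
  per mother: 2 ^ q terms of size at most 4 \<open>mean\<close> (g^2), against the normalisation 4 ^
  Suc q.\<close>

lemma second_moment_Suc:
  assumes g: "g \<in> F"
  shows "second_moment (Suc q) g \<le> second_moment q (mean g) + (\<integral>x. (mean ^^ Suc q) (\<lambda>x. (g x)\<^sup>2) x \<partial>\<nu>) / 2 ^ q"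
proof -
  let ?G = "generation q"
  have [measurable]: "g \<in> borel_measurable borel" by (rule F_measurable[OF g])
  have g2: "(\<lambda>x. (g x)\<^sup>2) \<in> F" by (rule adm.square[OF g])
  define G where "G = (\<lambda>yz. g (fst yz) + g (snd yz))"
  have Gm [measurable]: "G \<in> borel_measurable borel2" unfolding G_def by measurable
  define \<Phi> where "\<Phi> = (\<lambda>z :: 'w \<times> (nat \<Rightarrow> 's \<times> 's). (\<Sum>n\<in>?G. G (snd z n))\<^sup>2)"
  have \<Phi>: "\<Phi> \<in> borel_measurable (Fil q \<Otimes>\<^sub>M children_space q)"
    unfolding \<Phi>_def by measurable
  have eq: "(\<Sum>i\<in>generation (Suc q). g (X i \<omega>))\<^sup>2 = \<Phi> (\<omega>, children q \<omega>)" for \<omega>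
    by (simp add: sum_generation_Suc \<Phi>_def G_def children_def)
  have int: "integrable M (\<lambda>\<omega>. \<Phi> (\<omega>, children q \<omega>))"
    unfolding eq[symmetric] by (rule integrable_sum_square[OF g generation_subset])
  have iG: "integrable (P x) G" for x
    unfolding G_def using integrable_fst[OF g] integrable_snd[OF g] by simp
  have G2: "(G yz)\<^sup>2 = (g (fst yz))\<^sup>2 + (g (snd yz))\<^sup>2 + 2 * (g (fst yz) * g (snd yz))" for yz
    by (simp add: G_def power2_sum)
  have iG2: "integrable (P x) (\<lambda>yz. (G yz)\<^sup>2)" for x
    unfolding G2 using integrable_fst[OF g2] integrable_snd[OF g2] integrable_fst_snd[OF g g] by simp
  have PG: "(\<integral>yz. G yz \<partial>P x) = 2 * mean g x" for x
    unfolding G_def using integrable_fst[OF g] integrable_snd[OF g] by (simp add: mean_def)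
  have PG2: "(\<integral>yz. (G yz)\<^sup>2 \<partial>P x) \<le> 4 * mean (\<lambda>x. (g x)\<^sup>2) x" for x
  proof -
    have "(G yz)\<^sup>2 \<le> 2 * (g (fst yz))\<^sup>2 + 2 * (g (snd yz))\<^sup>2" for yz
    proof -
      have "0 \<le> (g (fst yz) - g (snd yz))\<^sup>2" by simp
      then show ?thesis unfolding G2 power2_diff by simp
    qed
    then have "(\<integral>yz. (G yz)\<^sup>2 \<partial>P x) \<le> (\<integral>yz. 2 * (g (fst yz))\<^sup>2 + 2 * (g (snd yz))\<^sup>2 \<partial>P x)"
      using integrable_fst[OF g2] integrable_snd[OF g2] iG2 by (intro integral_mono) auto
    also have "\<dots> = 4 * mean (\<lambda>x. (g x)\<^sup>2) x"
      using integrable_fst[OF g2] integrable_snd[OF g2] by (simp add: mean_def)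
    finally show ?thesis .
  qed
  have inner: "(\<integral>y. \<Phi> (\<omega>, y) \<partial>children_kernel q \<omega>) \<le> 4 * (\<Sum>n\<in>?G. mean g (X n \<omega>))\<^sup>2 + 4 * (\<Sum>n\<in>?G. mean (\<lambda>x. (g x)\<^sup>2) (X n \<omega>))" for \<omega>
  proof -
    interpret PP: product_prob_space "\<lambda>n. P (X n \<omega>)" ?G by (rule product_prob_space_P)
    have "(\<integral>y. \<Phi> (\<omega>, y) \<partial>children_kernel q \<omega>) \<le>
        (\<Sum>n\<in>?G. \<integral>yz. G yz \<partial>P (X n \<omega>))\<^sup>2 + (\<Sum>n\<in>?G. \<integral>yz. (G yz)\<^sup>2 \<partial>P (X n \<omega>))"
      unfolding children_kernel_def \<Phi>_def snd_conv
      by (rule PP.integral_sum_square_le[where f="\<lambda>_. G"]) (rule finite_generation iG iG2)+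
    also have "\<dots> \<le> (\<Sum>n\<in>?G. 2 * mean g (X n \<omega>))\<^sup>2 + (\<Sum>n\<in>?G. 4 * mean (\<lambda>x. (g x)\<^sup>2) (X n \<omega>))"
      unfolding PG by (intro add_left_mono sum_mono PG2)
    also have "\<dots> = 4 * (\<Sum>n\<in>?G. mean g (X n \<omega>))\<^sup>2 + 4 * (\<Sum>n\<in>?G. mean (\<lambda>x. (g x)\<^sup>2) (X n \<omega>))"
      by (simp add: sum_distrib_left[symmetric] power_mult_distrib)
    finally show ?thesis .
  qed
  have i1: "integrable M (\<lambda>\<omega>. (\<Sum>n\<in>?G. mean g (X n \<omega>))\<^sup>2)"
    by (rule integrable_sum_square[OF mean_in_F[OF g] generation_subset])
  have i2: "integrable M (\<lambda>\<omega>. \<Sum>n\<in>?G. mean (\<lambda>x. (g x)\<^sup>2) (X n \<omega>))"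
    by (intro Bochner_Integration.integrable_sum integrable_F mean_in_F g2 generation_pos)
  have "(\<integral>\<omega>. (\<Sum>i\<in>generation (Suc q). g (X i \<omega>))\<^sup>2 \<partial>M) = (\<integral>\<omega>. (\<integral>y. \<Phi> (\<omega>, y) \<partial>children_kernel q \<omega>) \<partial>M)"
    unfolding eq by (rule integral_children[OF \<Phi> int])
  also have "\<dots> \<le> (\<integral>\<omega>. 4 * (\<Sum>n\<in>?G. mean g (X n \<omega>))\<^sup>2 + 4 * (\<Sum>n\<in>?G. mean (\<lambda>x. (g x)\<^sup>2) (X n \<omega>)) \<partial>M)"
    using integrable_integral_children[OF \<Phi> int] i1 i2 inner by (intro integral_mono) auto
  also have "\<dots> = 4 * (\<integral>\<omega>. (\<Sum>n\<in>?G. mean g (X n \<omega>))\<^sup>2 \<partial>M) + 4 * (2 ^ q * (\<integral>x. (mean ^^ q) (mean (\<lambda>x. (g x)\<^sup>2)) x \<partial>\<nu>))"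
    using i1 i2 integral_generation_sum[OF mean_in_F[OF g2], of q] by simp
  finally have "(\<integral>\<omega>. (\<Sum>i\<in>generation (Suc q). g (X i \<omega>))\<^sup>2 \<partial>M) / 4 ^ Suc q \<le>
      (4 * (\<integral>\<omega>. (\<Sum>n\<in>?G. mean g (X n \<omega>))\<^sup>2 \<partial>M) + 4 * (2 ^ q * (\<integral>x. (mean ^^ q) (mean (\<lambda>x. (g x)\<^sup>2)) x \<partial>\<nu>))) / 4 ^ Suc q"
    by (rule divide_right_mono) simp
  also have "\<dots> = second_moment q (mean g) + (\<integral>x. (mean ^^ Suc q) (\<lambda>x. (g x)\<^sup>2) x \<partial>\<nu>) / 2 ^ q"
  proof -
    have *: "(4 * a + 4 * (2 ^ q * b)) / 4 ^ Suc q = a / 4 ^ q + b / 2 ^ q" for a b :: real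
    proof -
      have "(4::real) ^ q = 2 ^ q * 2 ^ q" by (simp add: power_mult_distrib[symmetric])
      then have "2 ^ q * b / 4 ^ q = b / 2 ^ q" by simp
      then show ?thesis by (simp add: add_divide_distrib)
    qed
    show ?thesis
      unfolding second_moment_def * by (simp only: funpow_Suc_right o_apply)
  qed
  finally show ?thesis unfolding second_moment_def .
qed

text \<open>Cauchy--Schwarz, without any independence. It is crude, but it is applied at a fixed
  generation to iterates of \<open>mean\<close> that already tend to 0.\<close>

lemma second_moment_le:
  assumes g: "g \<in> F"
  shows "second_moment q g \<le> (\<integral>x. (mean ^^ q) (\<lambda>x. (g x)\<^sup>2) x \<partial>\<nu>)"
proof -
  have g2: "(\<lambda>x. (g x)\<^sup>2) \<in> F" by (rule adm.square[OF g])
  have i2: "integrable M (\<lambda>\<omega>. \<Sum>n\<in>generation q. (g (X n \<omega>))\<^sup>2)"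
    by (intro Bochner_Integration.integrable_sum integrable_F[OF _ g2] generation_pos)
  have "(\<integral>\<omega>. (\<Sum>i\<in>generation q. g (X i \<omega>))\<^sup>2 \<partial>M) \<le> (\<integral>\<omega>. 2 ^ q * (\<Sum>i\<in>generation q. (g (X i \<omega>))\<^sup>2) \<partial>M)"
  proof (intro integral_mono integrable_sum_square[OF g generation_subset])
    show "(\<Sum>i\<in>generation q. g (X i \<omega>))\<^sup>2 \<le> 2 ^ q * (\<Sum>i\<in>generation q. (g (X i \<omega>))\<^sup>2)" for \<omega>
      using sum_squared_le_sum_of_squares[of "\<lambda>i. g (X i \<omega>)" "generation q"]
      by (simp add: card_generation mult.commute)
  qed (use i2 in simp)
  also have "\<dots> = 2 ^ q * (2 ^ q * (\<integral>x. (mean ^^ q) (\<lambda>x. (g x)\<^sup>2) x \<partial>\<nu>))"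
    using integral_generation_sum[OF g2, of q] i2 by simp
  also have "\<dots> = (\<integral>x. (mean ^^ q) (\<lambda>x. (g x)\<^sup>2) x \<partial>\<nu>) * 4 ^ q"
  proof -
    have "(4::real) ^ q = 2 ^ q * 2 ^ q" by (simp add: power_mult_distrib[symmetric])
    then show ?thesis by simp
  qed
  finally show ?thesis by (simp add: second_moment_def divide_le_eq)
qed

lemma second_moment_nonneg: "0 \<le> second_moment q g"
  unfolding second_moment_def by simp

lemma mean_tendsto_0:
  assumes h: "\<And>k. h k \<in> F" and H: "H \<in> F" "\<And>k x. \<bar>h k x\<bar> \<le> H x"
    and lim: "\<And>x. (\<lambda>k. h k x) \<longlonglongrightarrow> 0"
  shows "(\<lambda>k. mean (h k) x) \<longlonglongrightarrow> 0"
proof -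
  have 1: "(\<lambda>k. \<integral>yz. h k (fst yz) \<partial>P x) \<longlonglongrightarrow> (\<integral>yz. 0 \<partial>P x)"
    using h H lim integrable_fst
    by (intro integral_dominated_convergence[where w="\<lambda>yz. H (fst yz)"]) auto
  have 2: "(\<lambda>k. \<integral>yz. h k (snd yz) \<partial>P x) \<longlonglongrightarrow> (\<integral>yz. 0 \<partial>P x)"
    using h H lim integrable_snd
    by (intro integral_dominated_convergence[where w="\<lambda>yz. H (snd yz)"]) auto
  show ?thesis
    using tendsto_divide[OF tendsto_add[OF 1 2] tendsto_const[of 2]] by (simp add: mean_def)
qed

text \<open>Each application of \<open>mean\<close> preserves pointwise convergence to 0 and
  replaces the majorant H by \<open>mean H\<close>, again in \<open>F\<close>; the final integral
  over \<nu> is dominated convergence once more.\<close>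

lemma integral_mean_iter_tendsto_0:
  assumes h: "\<And>k. h k \<in> F" and H: "H \<in> F" "\<And>k x. \<bar>h k x\<bar> \<le> H x"
    and lim: "\<And>x. (\<lambda>k. h k x) \<longlonglongrightarrow> 0"
  shows "(\<lambda>k. \<integral>x. (mean ^^ p) (h k) x \<partial>\<nu>) \<longlonglongrightarrow> 0"
  using assms
proof (induction p arbitrary: h H)
  case 0
  have "(\<lambda>k. \<integral>x. h k x \<partial>\<nu>) \<longlonglongrightarrow> (\<integral>x. 0 \<partial>\<nu>)"
    using 0 adm.initial_integrable
    by (intro integral_dominated_convergence[where w=H]) auto
  then show ?case by simp
next
  case (Suc p)
  have neg: "(\<lambda>x. - H x) \<in> F" using adm.scale[OF Suc.prems(2), of "-1"] by simp
  have "\<bar>mean (h k) x\<bar> \<le> mean H x" for k x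
  proof -
    have "h k x \<le> H x" "- H x \<le> h k x" for x
      using Suc.prems(3)[of k x] by auto
    then have "mean (h k) x \<le> mean H x" "mean (\<lambda>x. - H x) x \<le> mean (h k) x"
      by (auto intro!: mean_mono Suc.prems neg)
    moreover have "mean (\<lambda>x. - H x) x = - mean H x"
      unfolding mean_def Bochner_Integration.integral_minus by (simp only: minus_divide_left minus_add_distrib)
    ultimately show ?thesis by (simp add: abs_le_iff)
  qed
  then have "(\<lambda>k. \<integral>x. (mean ^^ p) (mean (h k)) x \<partial>\<nu>) \<longlonglongrightarrow> 0"
    using Suc.prems by (intro Suc.IH[of "\<lambda>k. mean (h k)" "mean H"] mean_in_F mean_tendsto_0[where H=H])
  then show ?case by (simp add: funpow_swap1)
qed

text \<open>Descending \<open>k\<close> generations replaces \<open>g\<close> by \<open>(mean ^^ k) g\<close>, which tends to the vanishing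
  \<open>\<mu>\<close>-mean of \<open>g\<close>; the errors of the steps below generation \<open>p\<close> are geometric of size \<open>2 ^ - p\<close>.\<close>

theorem second_moment_tendsto_0:
  assumes g: "g \<in> F" and \<mu>: "(\<integral>x. g x \<partial>\<mu>) = 0"
  shows "(\<lambda>q. second_moment q g) \<longlonglongrightarrow> 0"
proof (rule LIMSEQ_I)
  fix e :: real assume e: "e > 0"
  let ?g = "\<lambda>k. (mean ^^ k) g"
  obtain G where G: "G \<in> F" "\<And>k x. \<bar>?g k x\<bar> \<le> G x"
    using mean_iter_dominated[OF g] by blast
  have gk: "?g k \<in> F" for k by (rule mean_iter_in_F[OF g])
  have gk2: "(\<lambda>x. (?g k x)\<^sup>2) \<in> F" for k by (rule adm.square[OF gk])
  have G2: "(\<lambda>x. (G x)\<^sup>2) \<in> F" by (rule adm.square[OF G(1)])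
  have sq: "(?g k x)\<^sup>2 \<le> (G x)\<^sup>2" for k x
    using G(2)[of k x] abs_le_square_iff[of "?g k x" "G x"] by auto
  \<comment> \<open>A second use of domination: G^2 is in \<open>F\<close>, but its iterated means
    need a common majorant of their own. It makes \<open>C\<close> independent of both m and
    k.\<close>
  obtain G' where G': "G' \<in> F" "\<And>k x. \<bar>(mean ^^ k) (\<lambda>x. (G x)\<^sup>2) x\<bar> \<le> G' x"
    using mean_iter_dominated[OF G2] by blast
  define C where "C = (\<integral>x. G' x \<partial>\<nu>)"
  have C: "(\<integral>x. (mean ^^ m) (\<lambda>x. (?g k x)\<^sup>2) x \<partial>\<nu>) \<le> C" for m k
    unfolding C_def
  proof (intro integral_mono adm.initial_integrable mean_iter_in_F gk2 G')
    show "(mean ^^ m) (\<lambda>x. (?g k x)\<^sup>2) x \<le> G' x" for x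
      using mean_iter_mono[OF gk2 G2 sq, of m k x] G'(2)[of m x] by auto
  qed
  have C0: "C \<ge> 0"
    unfolding C_def using G'(2)[of 0] by (intro integral_nonneg_AE always_eventually allI) (rule order_trans[OF abs_ge_zero])
  \<comment> \<open>The errors C / 2 ^ (p + j) form a geometric series; writing its partial sum as a
    difference lets the induction close exactly.\<close>
  have step: "second_moment (p + k) (?g l) \<le> second_moment p (?g (l + k)) + (2 * C / 2 ^ p - 2 * C / 2 ^ (p + k))" for p k l
  proof (induction k arbitrary: l)
    case (Suc k)
    have "second_moment (p + Suc k) (?g l) \<le> second_moment (p + k) (?g (Suc l)) + C / 2 ^ (p + k)"
      using second_moment_Suc[OF gk[of l], of "p + k"] divide_right_mono[OF C[of "Suc (p + k)" l], of "2 ^ (p + k)"]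
      by simp
    also have "\<dots> \<le> second_moment p (?g (Suc l + k)) + (2 * C / 2 ^ p - 2 * C / 2 ^ (p + k)) + C / 2 ^ (p + k)"
      using Suc.IH[of "Suc l"] by simp
    also have "\<dots> = second_moment p (?g (l + Suc k)) + (2 * C / 2 ^ p - 2 * C / 2 ^ (p + Suc k))"
      by (simp add: field_simps)
    finally show ?case .
  qed simp
  have "(\<lambda>p. 2 * C * (1/2) ^ p) \<longlonglongrightarrow> 2 * C * 0"
    by (intro tendsto_mult tendsto_const LIMSEQ_power_zero) auto
  then have "\<forall>\<^sub>F p in sequentially. 2 * C * (1/2) ^ p < e / 2"
    using e by (intro order_tendstoD) auto
  then obtain p where p: "2 * C / 2 ^ p < e / 2"
    by (auto simp: eventually_sequentially power_one_over field_simps)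
  have "(\<lambda>k. \<integral>x. (mean ^^ p) (\<lambda>x. (?g k x)\<^sup>2) x \<partial>\<nu>) \<longlonglongrightarrow> 0"
  proof (rule integral_mean_iter_tendsto_0[OF gk2 G2])
    show "\<bar>(?g k x)\<^sup>2\<bar> \<le> (G x)\<^sup>2" for k x using sq by simp
    show "(\<lambda>k. (?g k x)\<^sup>2) \<longlonglongrightarrow> 0" for x
      using tendsto_power[OF mean_iter_tendsto[OF g, of x], of 2] by (simp add: \<mu>)
  qed
  then have "\<forall>\<^sub>F k in sequentially. (\<integral>x. (mean ^^ p) (\<lambda>x. (?g k x)\<^sup>2) x \<partial>\<nu>) < e / 2"
    using e by (intro order_tendstoD) auto
  then obtain k0 where k0: "\<And>k. k \<ge> k0 \<Longrightarrow> (\<integral>x. (mean ^^ p) (\<lambda>x. (?g k x)\<^sup>2) x \<partial>\<nu>) < e / 2"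
    by (auto simp: eventually_sequentially)
  show "\<exists>q0. \<forall>q\<ge>q0. norm (second_moment q g - 0) < e"
  proof (intro exI allI impI)
    fix q assume q: "q \<ge> p + k0"
    define k where "k = q - p"
    have k: "q = p + k" "k \<ge> k0" using q by (auto simp: k_def)
    have "0 \<le> 2 * C / 2 ^ (p + k)" using C0 by simp
    then have "second_moment q g < e"
      using step[of p k 0] second_moment_le[OF gk, of p k] k0[OF k(2)] p unfolding k(1) funpow_0 add_0 by linarith
    then show "norm (second_moment q g - 0) < e"
      using second_moment_nonneg[of q g] by simp
  qed
qed

end

section \<open>The central limit estimate for a fixed set of vertices\<close>

lemma exp_minus_bounds:
  fixes y :: real
  assumes "0 \<le> y"
  shows "\<bar>exp (- y) - (1 - y)\<bar> \<le> y\<^sup>2"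
proof -
  have 1: "1 - y \<le> exp (- y)" using exp_ge_add_one_self[of "- y"] by simp
  have "exp (- y) \<le> 1 / (1 + y)"
    using exp_ge_add_one_self[of y] assms by (simp add: exp_minus inverse_eq_divide frac_le)
  also have "\<dots> \<le> 1 - y + y\<^sup>2"
  proof -
    have "0 \<le> y ^ 3" using assms by simp
    then have "1 \<le> (1 - y + y\<^sup>2) * (1 + y)"
      by (simp add: algebra_simps power2_eq_square power3_eq_cube)
    then show ?thesis using assms by (simp add: divide_le_eq)
  qed
  finally show ?thesis using 1 by simp
qed

lemma exp_diff_le:
  fixes a b :: real
  assumes "a \<le> m" "b \<le> m"
  shows "\<bar>exp a - exp b\<bar> \<le> exp m * \<bar>a - b\<bar>"
proof -
  have *: "exp x - exp y \<le> exp m * (x - y)" if "y \<le> x" "x \<le> m" for x y :: real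
  proof -
    have "exp x - exp y = exp x * (1 - exp (y - x))" by (simp add: right_diff_distrib exp_diff)
    also have "\<dots> \<le> exp x * (x - y)"
    proof (rule mult_left_mono)
      show "1 - exp (y - x) \<le> x - y" using exp_ge_add_one_self[of "y - x"] by linarith
    qed simp
    also have "\<dots> \<le> exp m * (x - y)" using that by (intro mult_right_mono) auto
    finally show ?thesis .
  qed
  show ?thesis
    using *[of a b] *[of b a] assms by (cases "a \<le> b") (auto simp: abs_if)
qed

text \<open>The Taylor remainder is a third moment, traded for the second and fourth ones by |y|^3
  \<le> y^2 + y^4. Replacing 1 - s^2 a / 2 by the exponential costs a term in a^2, which is at most
  the fourth moment because the variance of H^2 is nonnegative. The constants 1/6 and 1/4 add up to
  less than 1.\<close>

lemma (in prob_space) char_gaussian_bound: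
  fixes H :: "'a \<Rightarrow> real"
  assumes H [measurable]: "random_variable borel H" and int1: "integrable M H" and H0: "expectation H = 0"
    and int2: "integrable M (\<lambda>x. (H x)\<^sup>2)" and int4: "integrable M (\<lambda>x. (H x) ^ 4)"
    and s: "0 \<le> s" "s \<le> 1"
  shows "norm ((CLINT x|M. iexp (s * H x)) - exp (- (s\<^sup>2 * expectation (\<lambda>x. (H x)\<^sup>2) / 2)))
    \<le> s ^ 3 * (expectation (\<lambda>x. (H x)\<^sup>2) + expectation (\<lambda>x. (H x) ^ 4))"
proof -
  define a b where "a = expectation (\<lambda>x. (H x)\<^sup>2)" and "b = expectation (\<lambda>x. (H x) ^ 4)"
  have a0: "0 \<le> a" unfolding a_def by simp
  have ab: "a\<^sup>2 \<le> b"
  proof -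
    have 4: "(H x) ^ 4 = ((H x)\<^sup>2)\<^sup>2" for x by simp
    have "0 \<le> variance (\<lambda>x. (H x)\<^sup>2)" by (rule variance_positive)
    also have "\<dots> = b - a\<^sup>2"
      using int2 int4 unfolding a_def b_def 4 by (rule variance_eq)
    finally show ?thesis by simp
  qed
  have char: "char (distr M borel H) s = (CLINT x|M. iexp (s * H x))"
    unfolding char_def by (subst integral_distr) auto
  have "cmod (char (distr M borel H) s - (1 - s\<^sup>2 * a / 2)) \<le>
      (s\<^sup>2 / 6) * expectation (\<lambda>x. min (6 * (H x)\<^sup>2) (\<bar>s\<bar> * \<bar>H x\<bar> ^ 3))"
    using int1 int2 H0 by (intro char_approx3') (auto simp: a_def)
  also have "\<dots> \<le> (s\<^sup>2 / 6) * expectation (\<lambda>x. s * ((H x)\<^sup>2 + (H x) ^ 4))"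
  proof (intro mult_left_mono integral_mono)
    have m: "min (6 * y\<^sup>2) (\<bar>s\<bar> * \<bar>y\<bar> ^ 3) \<le> s * (y\<^sup>2 + y ^ 4)" for y :: real
    proof -
      have "\<bar>y\<bar> * 1 * 2 \<le> 1 + \<bar>y\<bar>\<^sup>2"
        using zero_le_power2[of "\<bar>y\<bar> - 1"] unfolding power2_diff by simp
      then have "\<bar>y\<bar>\<^sup>2 * \<bar>y\<bar> \<le> \<bar>y\<bar>\<^sup>2 * (1 + \<bar>y\<bar>\<^sup>2)" by (intro mult_left_mono) auto
      then have "\<bar>y\<bar> ^ 3 \<le> y\<^sup>2 + y ^ 4"
        by (simp add: distrib_left power_add[symmetric] power3_eq_cube power2_eq_square power4_eq_xxxx)
      then have "s * \<bar>y\<bar> ^ 3 \<le> s * (y\<^sup>2 + y ^ 4)" using s by (intro mult_left_mono) auto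
      then show ?thesis using s by (simp add: min.coboundedI2)
    qed
    show "min (6 * (H x)\<^sup>2) (\<bar>s\<bar> * \<bar>H x\<bar> ^ 3) \<le> s * ((H x)\<^sup>2 + (H x) ^ 4)" for x
      by (rule m)
    show i: "integrable M (\<lambda>x. s * ((H x)\<^sup>2 + (H x) ^ 4))"
      using int2 int4 by simp
    have "0 \<le> min (6 * y\<^sup>2) (\<bar>s\<bar> * \<bar>y\<bar> ^ 3)" for y :: real by simp
    then show "integrable M (\<lambda>x. min (6 * (H x)\<^sup>2) (\<bar>s\<bar> * \<bar>H x\<bar> ^ 3))"
      using m by (intro Bochner_Integration.integrable_bound[OF i])
        (auto intro!: always_eventually simp: abs_of_nonneg intro: order_trans[OF _ abs_ge_self])
  qed auto
  also have "\<dots> = s ^ 3 / 6 * (a + b)"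
    using int2 int4 by (simp add: a_def b_def power2_eq_square power3_eq_cube)
  finally have 1: "norm ((CLINT x|M. iexp (s * H x)) - complex_of_real (1 - s\<^sup>2 * a / 2)) \<le> s ^ 3 / 6 * (a + b)"
    unfolding char by simp
  have "\<bar>exp (- (s\<^sup>2 * a / 2)) - (1 - s\<^sup>2 * a / 2)\<bar> \<le> (s\<^sup>2 * a / 2)\<^sup>2"
    using a0 by (intro exp_minus_bounds) simp
  also have "\<dots> = s ^ 4 / 4 * a\<^sup>2" by (simp add: power_mult_distrib power_divide)
  also have "\<dots> \<le> s ^ 3 / 4 * (a + b)"
    using s a0 ab by (intro mult_mono divide_right_mono power_decreasing) auto
  finally have 2: "norm (complex_of_real (exp (- (s\<^sup>2 * a / 2))) - complex_of_real (1 - s\<^sup>2 * a / 2)) \<le> s ^ 3 / 4 * (a + b)"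
    unfolding of_real_diff[symmetric] norm_of_real .
  have "norm ((CLINT x|M. iexp (s * H x)) - exp (- (s\<^sup>2 * a / 2))) \<le> s ^ 3 / 6 * (a + b) + s ^ 3 / 4 * (a + b)"
    using 1 2 dist_triangle2[of "CLINT x|M. iexp (s * H x)" "complex_of_real (exp (- (s\<^sup>2 * a / 2)))"
        "complex_of_real (1 - s\<^sup>2 * a / 2)"]
    unfolding dist_norm by linarith
  also have "\<dots> \<le> s ^ 3 * (a + b)"
  proof -
    have "0 \<le> b" by (rule order_trans[OF zero_le_power2 ab])
    then have "0 \<le> s ^ 3 * (a + b)" using s a0 by (intro mult_nonneg_nonneg add_nonneg_nonneg zero_le_power)
    moreover have "s ^ 3 / 6 * (a + b) + s ^ 3 / 4 * (a + b) = 5 / 12 * (s ^ 3 * (a + b))"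
      by (simp add: field_simps)
    ultimately show ?thesis by linarith
  qed
  finally show ?thesis by (simp add: a_def b_def)
qed

lemma generation_disjoint: "q \<noteq> r \<Longrightarrow> generation q \<inter> generation r = {}"
  using gen_index_generation by blast

lemma sum_split_generations:
  fixes g :: "nat \<Rightarrow> 'a::comm_monoid_add"
  assumes "A \<subseteq> (\<Union>q<R. generation q)"
  shows "(\<Sum>i\<in>A. g i) = (\<Sum>q<R. \<Sum>i\<in>A \<inter> generation q. g i)"
proof -
  have "A = (\<Union>q<R. A \<inter> generation q)" using assms by auto
  then have "(\<Sum>i\<in>A. g i) = sum g (\<Union>q<R. A \<inter> generation q)"
    by (rule arg_cong[where f="sum g"])
  also have "\<dots> = (\<Sum>q<R. \<Sum>i\<in>A \<inter> generation q. g i)"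
    by (rule sum.UNION_disjoint) (use generation_disjoint in auto)
  finally show ?thesis .
qed

text \<open>\<open>h\<close> stands for a functional of the triangle from which its conditional mean
  has been subtracted. The fourth moment is only majorised in \<open>F\<close>, by \<open>u\<close>:
  expanding the fourth power of a centred functional produces third moments of the original one,
  which are not assumed to lie in \<open>F\<close>.\<close>

locale centered_functional = admissible_chain M Fil X \<nu> P F \<mu>
  for M :: "'w measure" and Fil :: "nat \<Rightarrow> 'w measure" and X :: "nat \<Rightarrow> 'w \<Rightarrow> 's::topological_space"
    and \<nu> :: "'s measure" and P :: "'s \<Rightarrow> ('s \<times> 's) measure" and F :: "('s \<Rightarrow> real) set"
    and \<mu> :: "'s measure" +
  fixes h :: "'s \<times> 's \<times> 's \<Rightarrow> real" and u :: "'s \<Rightarrow> real"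
  assumes h_measurable: "h \<in> borel_measurable borel3"
    and h_integrable: "\<And>x. integrable (P x) (\<lambda>yz. h (x, yz))"
    and h_centered: "\<And>x. (\<integral>yz. h (x, yz) \<partial>P x) = 0"
    and h2_integrable: "\<And>x. integrable (P x) (\<lambda>yz. (h (x, yz))\<^sup>2)"
    and h4_integrable: "\<And>x. integrable (P x) (\<lambda>yz. (h (x, yz)) ^ 4)"
    and h2_in_F: "op3 P (\<lambda>u. (h u)\<^sup>2) \<in> F"
    and u_in_F: "u \<in> F"
    and moment_bound: "\<And>x. op3 P (\<lambda>u. (h u)\<^sup>2) x + op3 P (\<lambda>u. (h u) ^ 4) x \<le> u x"
begin

declare h_measurable [measurable]

definition cond_var :: "'s \<Rightarrow> real" where
  "cond_var = op3 P (\<lambda>u. (h u)\<^sup>2)"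

lemma cond_var_in_F: "cond_var \<in> F"
  unfolding cond_var_def by (rule h2_in_F)

lemma cond_var_measurable [measurable]: "cond_var \<in> borel_measurable borel"
  using cond_var_in_F by (rule F_measurable)

lemma cond_var_nonneg: "0 \<le> cond_var x"
  unfolding cond_var_def op3_def by (rule Bochner_Integration.integral_nonneg) simp

lemma u_nonneg: "0 \<le> u x"
proof -
  have "0 \<le> op3 P (\<lambda>u. (h u)\<^sup>2) x + op3 P (\<lambda>u. (h u) ^ 4) x"
    unfolding op3_def by (intro add_nonneg_nonneg Bochner_Integration.integral_nonneg) simp_all
  then show ?thesis using moment_bound[of x] by (rule order_trans)
qed

lemma char_increment_bound:
  assumes "0 \<le> s" "s \<le> 1"
  shows "norm ((CLINT yz|P x. iexp (s * h (x, yz))) - exp (- (s\<^sup>2 * cond_var x / 2))) \<le> s ^ 3 * u x"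
proof -
  interpret Px: prob_space "P x" by (rule prob_space_P)
  have "norm ((CLINT yz|P x. iexp (s * h (x, yz))) - exp (- (s\<^sup>2 * cond_var x / 2)))
      \<le> s ^ 3 * (op3 P (\<lambda>u. (h u)\<^sup>2) x + op3 P (\<lambda>u. (h u) ^ 4) x)"
    unfolding cond_var_def op3_def
    by (rule Px.char_gaussian_bound[OF _ h_integrable h_centered h2_integrable h4_integrable assms]) measurable
  also have "\<dots> \<le> s ^ 3 * u x"
    using moment_bound assms by (intro mult_left_mono) auto
  finally show ?thesis .
qed

lemma char_increment_le_1: "norm (CLINT yz|P x. iexp (s * h (x, yz))) \<le> 1"
proof -
  interpret Px: prob_space "P x" by (rule prob_space_P)
  have "norm (CLINT yz|P x. iexp (s * h (x, yz))) \<le> (\<integral>yz. norm (iexp (s * h (x, yz))) \<partial>P x)"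
    by (rule integral_norm_bound)
  then show ?thesis using Px.prob_space by simp
qed

text \<open>Given generation q the characteristic function factorises over the vertices, those
  outside \<open>A\<close> contributing 1. All factors have modulus at most 1, so the difference of
  the two products is at most the sum of the differences of their factors.\<close>

lemma children_char_bound:
  assumes s: "0 \<le> s" "s \<le> 1" and A: "A \<subseteq> generation q"
  shows "norm ((CLINT y|children_kernel q \<omega>. iexp (s * (\<Sum>n\<in>A. h (X n \<omega>, y n)))) -
    exp (- (s\<^sup>2 * (\<Sum>n\<in>A. cond_var (X n \<omega>)) / 2))) \<le> s ^ 3 * (\<Sum>n\<in>A. u (X n \<omega>))"
proof -
  interpret PP: product_prob_space "\<lambda>n. P (X n \<omega>)" "generation q" by (rule product_prob_space_P)
  have finA: "finite A" using A finite_generation finite_subset by blast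
  define f where "f n = (if n \<in> A then (\<lambda>yz. iexp (s * h (X n \<omega>, yz))) else (\<lambda>_. 1))" for n
  have int: "complex_integrable (P (X n \<omega>)) (f n)" for n
    unfolding f_def by (auto intro!: PP.M.integrable_const_bound[where B=1])
  have prod: "(\<Prod>n\<in>generation q. f n (y n)) = iexp (s * (\<Sum>n\<in>A. h (X n \<omega>, y n)))" for y
  proof -
    have "(\<Prod>n\<in>generation q. f n (y n)) = (\<Prod>n\<in>A. iexp (s * h (X n \<omega>, y n)))"
      using A by (intro prod.mono_neutral_cong_right) (auto simp: f_def)
    also have "\<dots> = exp (\<Sum>n\<in>A. \<i> * complex_of_real (s * h (X n \<omega>, y n)))"
      by (rule exp_sum[OF finA, symmetric])
    finally show ?thesis by (simp add: sum_distrib_left)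
  qed
  have "(CLINT y|children_kernel q \<omega>. iexp (s * (\<Sum>n\<in>A. h (X n \<omega>, y n)))) =
      (\<Prod>n\<in>generation q. CLINT yz|P (X n \<omega>). f n yz)"
    unfolding children_kernel_def prod[symmetric] by (rule PP.product_integral_prod) (auto intro: int)
  also have "\<dots> = (\<Prod>n\<in>A. CLINT yz|P (X n \<omega>). iexp (s * h (X n \<omega>, yz)))"
    using A PP.M.prob_space by (intro prod.mono_neutral_cong_right) (auto simp: f_def)
  finally have 1: "(CLINT y|children_kernel q \<omega>. iexp (s * (\<Sum>n\<in>A. h (X n \<omega>, y n)))) =
      (\<Prod>n\<in>A. CLINT yz|P (X n \<omega>). iexp (s * h (X n \<omega>, yz)))" .
  have 2: "complex_of_real (exp (- (s\<^sup>2 * (\<Sum>n\<in>A. cond_var (X n \<omega>)) / 2))) =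
      (\<Prod>n\<in>A. complex_of_real (exp (- (s\<^sup>2 * cond_var (X n \<omega>) / 2))))"
  proof -
    have "- (s\<^sup>2 * (\<Sum>n\<in>A. cond_var (X n \<omega>)) / 2) = (\<Sum>n\<in>A. - (s\<^sup>2 * cond_var (X n \<omega>) / 2))"
      by (simp only: sum_negf sum_divide_distrib sum_distrib_left)
    then show ?thesis by (simp only: exp_sum[OF finA] of_real_prod)
  qed
  have "norm ((CLINT y|children_kernel q \<omega>. iexp (s * (\<Sum>n\<in>A. h (X n \<omega>, y n)))) -
    complex_of_real (exp (- (s\<^sup>2 * (\<Sum>n\<in>A. cond_var (X n \<omega>)) / 2)))) \<le>
    (\<Sum>n\<in>A. norm ((CLINT yz|P (X n \<omega>). iexp (s * h (X n \<omega>, yz))) - complex_of_real (exp (- (s\<^sup>2 * cond_var (X n \<omega>) / 2)))))"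
    unfolding 1 2 using char_increment_le_1 cond_var_nonneg
    by (intro norm_prod_diff) (auto simp: norm_of_real)
  also have "\<dots> \<le> (\<Sum>n\<in>A. s ^ 3 * u (X n \<omega>))"
    using char_increment_bound[OF s] by (intro sum_mono) (simp add: exp_of_real)
  finally show ?thesis by (simp add: sum_distrib_left exp_of_real)
qed

end

section \<open>The stopped exponential martingale\<close>

context centered_functional
begin

definition gen_var :: "nat set \<Rightarrow> real \<Rightarrow> nat \<Rightarrow> 'w \<Rightarrow> real" where
  "gen_var A s q \<omega> = s\<^sup>2 * (\<Sum>i\<in>A \<inter> generation q. cond_var (X i \<omega>))"

definition gen_sum :: "nat set \<Rightarrow> real \<Rightarrow> nat \<Rightarrow> 'w \<Rightarrow> real" where
  "gen_sum A s q \<omega> = s * (\<Sum>i\<in>A \<inter> generation q. h (triangle X i \<omega>))"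

text \<open>Without the stopping rule this is the exponential martingale, whose compensator is unbounded.
  The rule may look at generation \<open>q\<close> itself, because the conditional variances of its increments
  are known at time \<open>q\<close>.\<close>

definition stopped :: "nat set \<Rightarrow> real \<Rightarrow> real \<Rightarrow> nat \<Rightarrow> 'w \<Rightarrow> complex" where
  "stopped A s c r \<omega> = (\<Prod>q<r. if (\<Sum>k\<le>q. gen_var A s k \<omega>) \<le> c
     then iexp (gen_sum A s q \<omega>) * exp (gen_var A s q \<omega> / 2) else 1)"

lemma gen_var_nonneg: "0 \<le> gen_var A s q \<omega>"
  unfolding gen_var_def by (intro mult_nonneg_nonneg sum_nonneg cond_var_nonneg) simp

lemma gen_var_measurable: "gen_var A s q \<in> borel_measurable (Fil q)"
  unfolding gen_var_def
  by (intro borel_measurable_times borel_measurable_const borel_measurable_sum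
      measurable_compose[OF X_measurable_Fil cond_var_measurable]) auto

lemma triangle_measurable_Fil:
  assumes "i \<in> generation q"
  shows "triangle X i \<in> Fil (Suc q) \<rightarrow>\<^sub>M borel3"
  unfolding triangle_def[abs_def]
  using measurable_Fil_mono[OF X_measurable_Fil[OF assms], of "Suc q"]
    X_measurable_Fil[OF children_generation(1)[OF assms]] X_measurable_Fil[OF children_generation(2)[OF assms]]
  by (intro measurable_Pair) auto

lemma gen_sum_measurable: "gen_sum A s q \<in> borel_measurable (Fil (Suc q))"
  unfolding gen_sum_def
  by (intro borel_measurable_times borel_measurable_const borel_measurable_sum
      measurable_compose[OF triangle_measurable_Fil h_measurable]) auto

lemma stopped_measurable: "stopped A s c r \<in> borel_measurable (Fil r)"
proof -
  have "(\<lambda>\<omega>. if (\<Sum>k\<le>q. gen_var A s k \<omega>) \<le> c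
     then iexp (gen_sum A s q \<omega>) * complex_of_real (exp (gen_var A s q \<omega> / 2)) else 1) \<in> borel_measurable (Fil r)"
    if "q < r" for q
  proof -
    have v [measurable]: "gen_var A s k \<in> borel_measurable (Fil r)" if "k \<le> q" for k
      using measurable_Fil_mono[OF gen_var_measurable] \<open>q < r\<close> that by auto
    have [measurable]: "gen_sum A s q \<in> borel_measurable (Fil r)"
      using measurable_Fil_mono[OF gen_sum_measurable] \<open>q < r\<close> by auto
    have [measurable]: "(\<lambda>\<omega>. \<Sum>k\<le>q. gen_var A s k \<omega>) \<in> borel_measurable (Fil r)"
      using v by (intro borel_measurable_sum) auto
    have [measurable]: "gen_var A s q \<in> borel_measurable (Fil r)" using v by simp
    show ?thesis by measurable
  qed
  then show ?thesis
    unfolding stopped_def[abs_def] by (intro borel_measurable_prod) auto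
qed

lemma norm_stopped_le_exp: "norm (stopped A s c r \<omega>) \<le> exp ((\<Sum>q<r. gen_var A s q \<omega>) / 2)"
proof -
  have "norm (stopped A s c r \<omega>) \<le> (\<Prod>q<r. exp (gen_var A s q \<omega> / 2))"
    unfolding stopped_def prod_norm[symmetric]
    using gen_var_nonneg by (intro prod_mono) (auto simp: norm_mult)
  also have "\<dots> = exp ((\<Sum>q<r. gen_var A s q \<omega>) / 2)"
    by (simp add: exp_sum sum_divide_distrib)
  finally show ?thesis .
qed

text \<open>The test includes generation q itself, so the factor exp (gen_var / 2) about to be
  multiplied is already paid for by \<open>c\<close>. This keeps the stopped product below exp (c /
  2) without a bound on any single generation.\<close>

lemma norm_stopped_times_exp:
  assumes "(\<Sum>k\<le>q. gen_var A s k \<omega>) \<le> c"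
  shows "norm (stopped A s c q \<omega>) * exp (gen_var A s q \<omega> / 2) \<le> exp (c / 2)"
proof -
  have "norm (stopped A s c q \<omega>) * exp (gen_var A s q \<omega> / 2) \<le>
      exp ((\<Sum>k<q. gen_var A s k \<omega>) / 2) * exp (gen_var A s q \<omega> / 2)"
    by (intro mult_right_mono norm_stopped_le_exp) simp
  also have "\<dots> = exp ((\<Sum>k\<le>q. gen_var A s k \<omega>) / 2)"
    unfolding exp_add[symmetric] add_divide_distrib[symmetric] by (simp add: lessThan_Suc_atMost[symmetric])
  also have "\<dots> \<le> exp (c / 2)" using assms by simp
  finally show ?thesis .
qed

lemma stopped_Suc:
  "stopped A s c (Suc q) \<omega> = stopped A s c q \<omega> * (if (\<Sum>k\<le>q. gen_var A s k \<omega>) \<le> c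
     then iexp (gen_sum A s q \<omega>) * exp (gen_var A s q \<omega> / 2) else 1)"
  unfolding stopped_def by simp

lemma norm_stopped_le:
  assumes "0 \<le> c"
  shows "norm (stopped A s c r \<omega>) \<le> exp (c / 2)"
proof (induction r)
  case 0
  show ?case using assms by (simp add: stopped_def)
next
  case (Suc q)
  then show ?case
    using norm_stopped_times_exp[where A=A and s=s and q=q and \<omega>=\<omega> and c=c] by (auto simp: stopped_Suc norm_mult)
qed

lemma integrable_stopped:
  assumes "0 \<le> c"
  shows "complex_integrable M (stopped A s c r)"
  using norm_stopped_le[OF assms] measurable_Fil[OF stopped_measurable]
  by (intro integrable_const_bound[where B="exp (c / 2)"]) auto

lemma integrable_sum_u: "A \<subseteq> {1..} \<Longrightarrow> integrable M (\<lambda>\<omega>. \<Sum>i\<in>A. u (X i \<omega>))"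
  using u_in_F by (intro Bochner_Integration.integrable_sum integrable_F) auto

text \<open>While the process runs, the conditional increment is a product: the stopped process
  times exp (gen_var / 2), of modulus at most exp (c / 2), and the distance between the conditional
  characteristic function and the Gaussian one. After stopping the increment is 0.\<close>

lemma stopped_step:
  assumes s: "0 \<le> s" "s \<le> 1" and c: "0 \<le> c"
  shows "norm ((CLINT \<omega>|M. stopped A s c (Suc q) \<omega>) - (CLINT \<omega>|M. stopped A s c q \<omega>)) \<le>
    exp (c / 2) * s ^ 3 * (\<integral>\<omega>. (\<Sum>i\<in>A \<inter> generation q. u (X i \<omega>)) \<partial>M)"
proof -
  let ?A = "A \<inter> generation q"
  let ?keep = "\<lambda>\<omega>. (\<Sum>k\<le>q. gen_var A s k \<omega>) \<le> c"
  define \<Phi> where "\<Phi> = (\<lambda>z. stopped A s c q (fst z) * (if ?keep (fst z)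
     then iexp (s * (\<Sum>n\<in>?A. h (X n (fst z), snd z n))) * exp (gen_var A s q (fst z) / 2) else 1))"
  have \<Phi>_children: "\<Phi> (\<omega>, children q \<omega>) = stopped A s c (Suc q) \<omega>" for \<omega>
    unfolding \<Phi>_def stopped_Suc gen_sum_def by (simp add: triangle_def children_def)
  have v: "gen_var A s k \<in> borel_measurable (Fil q)" if "k \<le> q" for k
    using measurable_Fil_mono[OF gen_var_measurable that] .
  have [measurable]: "(\<lambda>\<omega>. \<Sum>k\<le>q. gen_var A s k \<omega>) \<in> borel_measurable (Fil q)"
    using v by (intro borel_measurable_sum) auto
  have [measurable]: "gen_var A s q \<in> borel_measurable (Fil q)" using v by simp
  have [measurable]: "stopped A s c q \<in> borel_measurable (Fil q)" by (rule stopped_measurable)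
  have [measurable]: "(\<lambda>z. \<Sum>n\<in>?A. h (X n (fst z), snd z n)) \<in> borel_measurable (Fil q \<Otimes>\<^sub>M children_space q)"
  proof (rule borel_measurable_sum)
    fix n assume "n \<in> ?A"
    then have n: "n \<in> generation q" by simp
    have [measurable]: "X n \<in> Fil q \<rightarrow>\<^sub>M borel" by (rule X_measurable_Fil[OF n])
    show "(\<lambda>z. h (X n (fst z), snd z n)) \<in> borel_measurable (Fil q \<Otimes>\<^sub>M children_space q)"
      using n by measurable
  qed
  have \<Phi>: "\<Phi> \<in> borel_measurable (Fil q \<Otimes>\<^sub>M children_space q)"
    unfolding \<Phi>_def by measurable
  have bound: "norm (\<Phi> z) \<le> exp (c / 2)" for z
    unfolding \<Phi>_def using norm_stopped_times_exp[where A=A and s=s and q=q and \<omega>="fst z" and c=c] norm_stopped_le[OF c]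
    by (auto simp: norm_mult)
  note I = complex_integrable_integral_children[OF \<Phi> bound]
  have step: "norm ((CLINT y|children_kernel q \<omega>. \<Phi> (\<omega>, y)) - stopped A s c q \<omega>)
      \<le> exp (c / 2) * s ^ 3 * (\<Sum>i\<in>?A. u (X i \<omega>))" for \<omega>
  proof (cases "?keep \<omega>")
    case True
    let ?e = "complex_of_real (exp (gen_var A s q \<omega> / 2))"
    have "(CLINT y|children_kernel q \<omega>. \<Phi> (\<omega>, y)) =
        stopped A s c q \<omega> * ((CLINT y|children_kernel q \<omega>. iexp (s * (\<Sum>n\<in>?A. h (X n \<omega>, y n)))) * ?e)"
      unfolding \<Phi>_def using True by simp
    moreover have "complex_of_real (exp (- (gen_var A s q \<omega> / 2))) * ?e = 1"
      unfolding of_real_mult[symmetric] exp_add[symmetric] by simp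
    moreover have "z * (I * e) - z = z * e * (I - e')" if "e' * e = 1" for z I e e' :: complex
    proof -
      have "z * e * (I - e') = z * (I * e) - z * (e' * e)" by (simp only: algebra_simps)
      then show ?thesis using that by simp
    qed
    ultimately have "norm ((CLINT y|children_kernel q \<omega>. \<Phi> (\<omega>, y)) - stopped A s c q \<omega>) =
        norm (stopped A s c q \<omega> * ?e * ((CLINT y|children_kernel q \<omega>. iexp (s * (\<Sum>n\<in>?A. h (X n \<omega>, y n)))) -
          complex_of_real (exp (- (gen_var A s q \<omega> / 2)))))"
      by (simp only:)
    also have "\<dots> = norm (stopped A s c q \<omega>) * exp (gen_var A s q \<omega> / 2) *
        norm ((CLINT y|children_kernel q \<omega>. iexp (s * (\<Sum>n\<in>?A. h (X n \<omega>, y n)))) -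
          complex_of_real (exp (- (gen_var A s q \<omega> / 2))))"
      by (simp add: norm_mult)
    also have "\<dots> \<le> exp (c / 2) * (s ^ 3 * (\<Sum>i\<in>?A. u (X i \<omega>)))"
      unfolding gen_var_def[of A s q]
      by (intro mult_mono norm_stopped_times_exp[OF True, unfolded gen_var_def[of A s q]] children_char_bound s) auto
    finally show ?thesis by (simp add: mult.assoc)
  next
    case False
    interpret K: prob_space "children_kernel q \<omega>" by (rule prob_space_children_kernel)
    have "(CLINT y|children_kernel q \<omega>. \<Phi> (\<omega>, y)) = stopped A s c q \<omega>"
      unfolding \<Phi>_def using False K.prob_space by simp
    then show ?thesis using s u_nonneg by (auto intro!: mult_nonneg_nonneg sum_nonneg)
  qed
  have "norm ((CLINT \<omega>|M. stopped A s c (Suc q) \<omega>) - (CLINT \<omega>|M. stopped A s c q \<omega>)) =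
      norm (CLINT \<omega>|M. (CLINT y|children_kernel q \<omega>. \<Phi> (\<omega>, y)) - stopped A s c q \<omega>)"
    using complex_integral_children[OF \<Phi> bound] I integrable_stopped[OF c]
    by (simp add: \<Phi>_children)
  also have "\<dots> \<le> (\<integral>\<omega>. norm ((CLINT y|children_kernel q \<omega>. \<Phi> (\<omega>, y)) - stopped A s c q \<omega>) \<partial>M)"
    by (rule integral_norm_bound)
  also have "\<dots> \<le> (\<integral>\<omega>. exp (c / 2) * s ^ 3 * (\<Sum>i\<in>?A. u (X i \<omega>)) \<partial>M)"
    using I integrable_stopped[OF c] integrable_sum_u[of ?A] generation_subset[of q] step
    by (intro integral_mono) auto
  finally show ?thesis by simp
qed

lemma stopped_bound:
  assumes s: "0 \<le> s" "s \<le> 1" and c: "0 \<le> c"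
  shows "norm ((CLINT \<omega>|M. stopped A s c R \<omega>) - 1) \<le>
    exp (c / 2) * s ^ 3 * (\<Sum>q<R. \<integral>\<omega>. (\<Sum>i\<in>A \<inter> generation q. u (X i \<omega>)) \<partial>M)"
proof (induction R)
  case 0
  then show ?case by (simp add: stopped_def prob_space)
next
  case (Suc R)
  have "norm ((CLINT \<omega>|M. stopped A s c (Suc R) \<omega>) - 1) \<le>
      norm ((CLINT \<omega>|M. stopped A s c (Suc R) \<omega>) - (CLINT \<omega>|M. stopped A s c R \<omega>)) + norm ((CLINT \<omega>|M. stopped A s c R \<omega>) - 1)"
    by (rule norm_diff_triangle_ineq[of _ "CLINT \<omega>|M. stopped A s c R \<omega>" "CLINT \<omega>|M. stopped A s c R \<omega>", simplified])
  then show ?case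
    using stopped_step[OF s c, of A R] Suc.IH by (simp add: distrib_left)
qed

text \<open>The comparison is between iexp S times exp (\<sigma> / 2) and the stopped product. If
  \<open>V\<close> is at most \<open>c\<close>, nothing was stopped and they differ in modulus by
  |exp (\<sigma> / 2) - exp (V / 2)|. Otherwise |V - \<sigma>| > 1, and this factor absorbs the
  trivial bound 2 exp (c / 2). Dividing by exp (\<sigma> / 2) \<ge> 1 at the end only helps. The
  bound has to hold for every \<open>A\<close>, because it will be averaged over random
  sets.\<close>

theorem char_bound_fixed_set:
  assumes A: "A \<subseteq> (\<Union>q<R. generation q)" and s: "0 \<le> s" "s \<le> 1" and \<sigma>: "0 \<le> \<sigma>"
  shows "norm ((CLINT \<omega>|M. iexp (s * (\<Sum>i\<in>A. h (triangle X i \<omega>)))) - complex_of_real (exp (- \<sigma> / 2))) \<le>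
    exp ((\<sigma> + 1) / 2) * (s ^ 3 * (\<integral>\<omega>. (\<Sum>i\<in>A. u (X i \<omega>)) \<partial>M) +
      2 * (\<integral>\<omega>. \<bar>s\<^sup>2 * (\<Sum>i\<in>A. cond_var (X i \<omega>)) - \<sigma>\<bar> \<partial>M))"
proof -
  define c where "c = \<sigma> + 1"
  have c: "0 \<le> c" using \<sigma> by (simp add: c_def)
  define V where "V = (\<lambda>\<omega>. s\<^sup>2 * (\<Sum>i\<in>A. cond_var (X i \<omega>)))"
  define S where "S = (\<lambda>\<omega>. s * (\<Sum>i\<in>A. h (triangle X i \<omega>)))"
  have A1: "A \<subseteq> {1..}" using A generation_pos by fastforce
  have V: "V \<omega> = (\<Sum>q<R. gen_var A s q \<omega>)" for \<omega>
    unfolding V_def gen_var_def sum_split_generations[OF A] sum_distrib_left ..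
  have S: "S \<omega> = (\<Sum>q<R. gen_sum A s q \<omega>)" for \<omega>
    unfolding S_def gen_sum_def sum_split_generations[OF A] sum_distrib_left ..
  have Sm [measurable]: "S \<in> borel_measurable M"
  proof -
    have "gen_sum A s q \<in> borel_measurable M" for q by (rule measurable_Fil[OF gen_sum_measurable])
    then show ?thesis unfolding S by simp
  qed
  have iV: "integrable M (\<lambda>\<omega>. V \<omega>)"
    unfolding V_def using A1
    by (intro Bochner_Integration.integrable_mult_right Bochner_Integration.integrable_sum integrable_F cond_var_in_F) auto
  have iS: "complex_integrable M (\<lambda>\<omega>. iexp (S \<omega>))"
    by (intro integrable_const_bound[where B=1]) auto
  have pointwise: "norm (iexp (S \<omega>) * exp (\<sigma> / 2) - stopped A s c R \<omega>) \<le> 2 * exp (c / 2) * \<bar>V \<omega> - \<sigma>\<bar>" for \<omega>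
  proof (cases "V \<omega> \<le> c")
    case True
    have "(\<Sum>k\<le>q. gen_var A s k \<omega>) \<le> c" if "q < R" for q
    proof -
      have "(\<Sum>k\<le>q. gen_var A s k \<omega>) \<le> (\<Sum>k<R. gen_var A s k \<omega>)"
        using that gen_var_nonneg by (intro sum_mono2) auto
      then show ?thesis using True V by simp
    qed
    then have "stopped A s c R \<omega> = (\<Prod>q<R. iexp (gen_sum A s q \<omega>) * exp (gen_var A s q \<omega> / 2))"
      unfolding stopped_def by (intro prod.cong) auto
    also have "\<dots> = iexp (S \<omega>) * exp (V \<omega> / 2)"
      unfolding S V by (simp add: prod.distrib exp_sum sum_divide_distrib sum_distrib_left)
    finally have "norm (iexp (S \<omega>) * exp (\<sigma> / 2) - stopped A s c R \<omega>) =
        norm (iexp (S \<omega>) * complex_of_real (exp (\<sigma> / 2) - exp (V \<omega> / 2)))"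
      by (simp add: right_diff_distrib)
    also have "\<dots> = \<bar>exp (\<sigma> / 2) - exp (V \<omega> / 2)\<bar>"
      unfolding norm_mult norm_of_real by simp
    also have "\<dots> \<le> exp (c / 2) * \<bar>\<sigma> / 2 - V \<omega> / 2\<bar>"
      using True by (intro exp_diff_le) (auto simp: c_def)
    also have "\<dots> \<le> exp (c / 2) * (2 * \<bar>V \<omega> - \<sigma>\<bar>)"
    proof (rule mult_left_mono)
      show "\<bar>\<sigma> / 2 - V \<omega> / 2\<bar> \<le> 2 * \<bar>V \<omega> - \<sigma>\<bar>"
        by (cases "V \<omega> \<le> \<sigma>") (auto simp: abs_of_nonneg abs_of_nonpos)
    qed simp
    finally show ?thesis by (simp add: mult_ac)
  next
    case False
    have "norm (iexp (S \<omega>) * exp (\<sigma> / 2) - stopped A s c R \<omega>) \<le> exp (\<sigma> / 2) + exp (c / 2)"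
      by (intro order_trans[OF norm_triangle_ineq4] add_mono norm_stopped_le[OF c]) (simp add: norm_mult)
    also have "\<dots> \<le> 2 * exp (c / 2)" by (simp add: c_def)
    also have "\<dots> \<le> 2 * exp (c / 2) * \<bar>V \<omega> - \<sigma>\<bar>"
      using False by (simp add: c_def)
    finally show ?thesis .
  qed
  have "norm ((CLINT \<omega>|M. iexp (S \<omega>)) * exp (\<sigma> / 2) - (CLINT \<omega>|M. stopped A s c R \<omega>)) =
      norm (CLINT \<omega>|M. iexp (S \<omega>) * exp (\<sigma> / 2) - stopped A s c R \<omega>)"
    using iS integrable_stopped[OF c] by simp
  also have "\<dots> \<le> (\<integral>\<omega>. norm (iexp (S \<omega>) * exp (\<sigma> / 2) - stopped A s c R \<omega>) \<partial>M)"
    by (rule integral_norm_bound)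
  also have "\<dots> \<le> (\<integral>\<omega>. 2 * exp (c / 2) * \<bar>V \<omega> - \<sigma>\<bar> \<partial>M)"
    using iS iV integrable_stopped[OF c] pointwise by (intro integral_mono) auto
  finally have 1: "norm ((CLINT \<omega>|M. iexp (S \<omega>)) * exp (\<sigma> / 2) - (CLINT \<omega>|M. stopped A s c R \<omega>)) \<le>
      2 * exp (c / 2) * (\<integral>\<omega>. \<bar>V \<omega> - \<sigma>\<bar> \<partial>M)" by simp
  have U: "(\<Sum>q<R. \<integral>\<omega>. (\<Sum>i\<in>A \<inter> generation q. u (X i \<omega>)) \<partial>M) = (\<integral>\<omega>. (\<Sum>i\<in>A. u (X i \<omega>)) \<partial>M)"
  proof -
    have "A \<inter> generation q \<subseteq> {1..}" for q using A1 by auto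
    then show ?thesis
      unfolding sum_split_generations[OF A]
      by (intro Bochner_Integration.integral_sum[symmetric] integrable_sum_u)
  qed
  define D where "D = (CLINT \<omega>|M. iexp (S \<omega>)) - complex_of_real (exp (- \<sigma> / 2))"
  have D: "D * exp (\<sigma> / 2) = (CLINT \<omega>|M. iexp (S \<omega>)) * exp (\<sigma> / 2) - 1"
    unfolding D_def left_diff_distrib of_real_mult[symmetric] exp_add[symmetric] by simp
  have "norm D \<le> norm D * exp (\<sigma> / 2)"
    using \<sigma> by (simp add: mult_le_cancel_left1)
  also have "\<dots> = norm (D * exp (\<sigma> / 2))" by (simp add: norm_mult)
  also have "\<dots> \<le> norm ((CLINT \<omega>|M. iexp (S \<omega>)) * exp (\<sigma> / 2) - (CLINT \<omega>|M. stopped A s c R \<omega>)) +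
      norm ((CLINT \<omega>|M. stopped A s c R \<omega>) - 1)"
    unfolding D by (rule norm_diff_triangle_ineq[of _ "CLINT \<omega>|M. stopped A s c R \<omega>" "CLINT \<omega>|M. stopped A s c R \<omega>", simplified])
  also have "\<dots> \<le> 2 * exp (c / 2) * (\<integral>\<omega>. \<bar>V \<omega> - \<sigma>\<bar> \<partial>M) + exp (c / 2) * s ^ 3 * (\<integral>\<omega>. (\<Sum>i\<in>A. u (X i \<omega>)) \<partial>M)"
    using 1 stopped_bound[OF s c, of A R] unfolding U by (rule add_mono)
  finally show ?thesis unfolding D_def S_def V_def c_def by (simp add: algebra_simps)
qed

end

section \<open>Averaging over uniform permutations\<close>

lemma permutation_sum_square_le:
  fixes x :: "'i \<Rightarrow> real"
  assumes G: "finite G" and B: "B \<subseteq> G"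
  shows "(\<Sum>p | p permutes G. (\<Sum>i\<in>B. x (p i))\<^sup>2) \<le> fact (card G) * ((\<Sum>i\<in>G. (x i)\<^sup>2) + (\<Sum>i\<in>G. x i)\<^sup>2)"
proof -
  let ?\<Pi> = "{p. p permutes G}"
  define e where "e k l = (\<Sum>p\<in>?\<Pi>. x (p k) * x (p l))" for k l
  define off where "off C = {(k, l) \<in> C \<times> C. k \<noteq> l}" for C :: "'i set"
  have fin\<Pi>: "finite ?\<Pi>" and card\<Pi>: "card ?\<Pi> = fact (card G)"
    by (rule finite_permutations[OF G]) (rule card_permutations[OF refl G])
  have finB: "finite B" using G B finite_subset by blast
  have sym: "e (\<tau> k) (\<tau> l) = e k l" if "\<tau> permutes G" for \<tau> k l
    unfolding e_def using sum_permutations_compose_right[OF that, of "\<lambda>p. x (p k) * x (p l)"] by simp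
  have e_eq: "e k l = e k' l'" if kl: "(k, l) \<in> off G" "(k', l') \<in> off G" for k l k' l'
  proof -
    have in_G: "k \<in> G" "l \<in> G" "k' \<in> G" "l' \<in> G" "k \<noteq> l" "k' \<noteq> l'" using kl by (auto simp: off_def)
    \<comment> \<open>Two transpositions carry (k, l) to (k', l'). The first moves l exactly if l =
      k'; the second fixes k', because neither \<open>l1\<close> nor l' equals it.\<close>
    define l1 where "l1 = Transposition.transpose k k' l"
    have l1: "l1 \<in> G" "l1 \<noteq> k'" using in_G by (auto simp: l1_def Transposition.transpose_def)
    have "e k l = e k' l1"
      using sym[of "Transposition.transpose k k'" k l] permutes_swap_id[of k G k'] in_G by (simp add: l1_def)
    also have "\<dots> = e k' l'"
      using sym[of "Transposition.transpose l1 l'" k' l1] permutes_swap_id[of l1 G l'] in_G l1 by simp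
    finally show ?thesis .
  qed
  have split: "(\<Sum>p\<in>?\<Pi>. (\<Sum>i\<in>C. x (p i))\<^sup>2) = (\<Sum>k\<in>C. e k k) + (\<Sum>(k, l)\<in>off C. e k l)" if "C \<subseteq> G" for C
  proof -
    have finC: "finite C" using that G finite_subset by blast
    have "(\<Sum>p\<in>?\<Pi>. (\<Sum>i\<in>C. x (p i))\<^sup>2) = (\<Sum>p\<in>?\<Pi>. \<Sum>(k, l)\<in>C \<times> C. x (p k) * x (p l))"
      by (simp add: power2_eq_square sum_product sum.cartesian_product)
    also have "\<dots> = (\<Sum>(k, l)\<in>C \<times> C. e k l)"
      unfolding e_def by (subst sum.swap) (simp add: split_beta')
    also have "C \<times> C = (\<lambda>k. (k, k)) ` C \<union> off C" unfolding off_def by auto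
    also have "(\<Sum>(k, l)\<in>(\<lambda>k. (k, k)) ` C \<union> off C. e k l) = (\<Sum>(k, l)\<in>(\<lambda>k. (k, k)) ` C. e k l) + (\<Sum>(k, l)\<in>off C. e k l)"
    proof (rule sum.union_disjoint)
      show "finite (off C)"
        by (rule finite_subset[of _ "C \<times> C"]) (use finC in \<open>auto simp: off_def\<close>)
    qed (use finC in \<open>auto simp: off_def\<close>)
    also have "(\<Sum>(k, l)\<in>(\<lambda>k. (k, k)) ` C. e k l) = (\<Sum>k\<in>C. e k k)"
      by (subst sum.reindex) (auto simp: inj_on_def)
    finally show ?thesis .
  qed
  have perm_sum: "(\<Sum>i\<in>G. f (p i)) = (\<Sum>i\<in>G. f i)" if "p permutes G" for p and f :: "'i \<Rightarrow> real"
    using sum.permute[OF that, of f] by simp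
  have diagG: "(\<Sum>k\<in>G. e k k) = fact (card G) * (\<Sum>i\<in>G. (x i)\<^sup>2)"
  proof -
    have "(\<Sum>k\<in>G. e k k) = (\<Sum>p\<in>?\<Pi>. \<Sum>k\<in>G. (x (p k))\<^sup>2)"
      unfolding e_def power2_eq_square by (rule sum.swap)
    also have "\<dots> = (\<Sum>p\<in>?\<Pi>. \<Sum>i\<in>G. (x i)\<^sup>2)"
      by (rule sum.cong[OF refl]) (rule perm_sum[where f="\<lambda>i. (x i)\<^sup>2"], erule CollectD)
    finally show ?thesis by (simp only: sum_constant card\<Pi> of_nat_fact)
  qed
  have allG: "(\<Sum>p\<in>?\<Pi>. (\<Sum>i\<in>G. x (p i))\<^sup>2) = fact (card G) * (\<Sum>i\<in>G. x i)\<^sup>2"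
  proof -
    have "(\<Sum>p\<in>?\<Pi>. (\<Sum>i\<in>G. x (p i))\<^sup>2) = (\<Sum>p\<in>?\<Pi>. (\<Sum>i\<in>G. x i)\<^sup>2)"
      by (rule sum.cong[OF refl]) (simp only: mem_Collect_eq perm_sum[where f=x])
    then show ?thesis by (simp only: sum_constant card\<Pi> of_nat_fact)
  qed
  have ekk: "0 \<le> e k k" for k unfolding e_def by (intro sum_nonneg) simp
  have diag: "(\<Sum>k\<in>B. e k k) \<le> fact (card G) * (\<Sum>i\<in>G. (x i)\<^sup>2)"
    unfolding diagG[symmetric] using G B ekk by (intro sum_mono2) auto
  have offB: "(\<Sum>(k, l)\<in>off B. e k l) \<le> fact (card G) * (\<Sum>i\<in>G. x i)\<^sup>2"
  proof (cases "off B = {}")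
    case True
    then show ?thesis by simp
  next
    case False
    then obtain k0 l0 where kl0: "(k0, l0) \<in> off B" by auto
    have sub: "off B \<subseteq> off G" using B by (auto simp: off_def)
    have const: "(\<Sum>(k, l)\<in>off C. e k l) = card (off C) * e k0 l0" if "off C \<subseteq> off G" for C
    proof -
      have "(\<Sum>(k, l)\<in>off C. e k l) = (\<Sum>(k, l)\<in>off C. e k0 l0)"
      proof (rule sum.cong[OF refl], clarify)
        fix k l assume "(k, l) \<in> off C"
        then show "e k l = e k0 l0" using that kl0 sub by (intro e_eq) blast+
      qed
      then show ?thesis by simp
    qed
    have fin_off: "finite (off G)"
      by (rule finite_subset[of _ "G \<times> G"]) (use G in \<open>auto simp: off_def\<close>)
    have total: "card (off G) * e k0 l0 \<le> fact (card G) * (\<Sum>i\<in>G. x i)\<^sup>2"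
      using split[OF subset_refl] const[OF subset_refl] allG sum_nonneg[of G "\<lambda>k. e k k", OF ekk] by linarith
    show ?thesis
    proof (cases "0 \<le> e k0 l0")
      case True
      have "card (off B) * e k0 l0 \<le> card (off G) * e k0 l0"
        using True card_mono[OF fin_off sub] by (intro mult_right_mono) auto
      then show ?thesis using total const[OF sub] by linarith
    next
      case False
      then have "card (off B) * e k0 l0 \<le> 0" by (simp add: mult_nonneg_nonpos)
      also have "0 \<le> fact (card G) * (\<Sum>i\<in>G. x i)\<^sup>2" by simp
      finally show ?thesis using const[OF sub] by simp
    qed
  qed
  show ?thesis
    unfolding split[OF B] distrib_left by (intro add_mono diag offB)
qed

section \<open>Freezing a function of an independent variable\<close>

lemma (in prob_space) expectation_indicator_independent:
  fixes \<Psi> :: "'c \<Rightarrow> 'e::{banach, second_countable_topology}"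
  assumes ind: "independent_rvs M A Y B Z" and C: "C \<in> sets A" and \<Psi>: "\<Psi> \<in> borel_measurable B"
  shows "(\<integral>\<omega>. indicator C (Y \<omega>) *\<^sub>R \<Psi> (Z \<omega>) \<partial>M) = prob {\<omega>\<in>space M. Y \<omega> \<in> C} *\<^sub>R (\<integral>\<omega>. \<Psi> (Z \<omega>) \<partial>M)"
proof -
  have Y [measurable]: "Y \<in> M \<rightarrow>\<^sub>M A" and Z [measurable]: "Z \<in> M \<rightarrow>\<^sub>M B"
    and ind': "indep_set {Y -` C \<inter> space M |C. C \<in> sets A} {Z -` D \<inter> space M |D. D \<in> sets B}"
    using ind by (auto simp: independent_rvs_def)
  have C' [measurable]: "C \<in> sets A" by fact
  define c where "c = prob {\<omega>\<in>space M. Y \<omega> \<in> C}"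
  have eq: "distr (density M (\<lambda>\<omega>. ennreal (indicator C (Y \<omega>)))) B Z = density (distr M B Z) (\<lambda>_. ennreal c)"
  proof (rule measure_eqI)
    fix D assume "D \<in> sets (distr (density M (\<lambda>\<omega>. ennreal (indicator C (Y \<omega>)))) B Z)"
    then have D [measurable]: "D \<in> sets B" by simp
    have "emeasure (distr (density M (\<lambda>\<omega>. ennreal (indicator C (Y \<omega>)))) B Z) D =
        (\<integral>\<^sup>+\<omega>. ennreal (indicator C (Y \<omega>)) * indicator (Z -` D \<inter> space M) \<omega> \<partial>M)"
      by (subst emeasure_distr) (auto simp: emeasure_density)
    also have "\<dots> = (\<integral>\<^sup>+\<omega>. indicator ((Y -` C \<inter> space M) \<inter> (Z -` D \<inter> space M)) \<omega> \<partial>M)"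
      by (intro nn_integral_cong) (auto simp: indicator_def)
    also have "\<dots> = emeasure M ((Y -` C \<inter> space M) \<inter> (Z -` D \<inter> space M))"
      by (intro nn_integral_indicator) measurable
    also have "\<dots> = ennreal (prob (Y -` C \<inter> space M) * prob (Z -` D \<inter> space M))"
      unfolding emeasure_eq_measure using C D by (subst indep_setD[OF ind']) auto
    also have "\<dots> = emeasure (density (distr M B Z) (\<lambda>_. ennreal c)) D"
      by (simp add: emeasure_density_const emeasure_distr emeasure_eq_measure ennreal_mult c_def
          vimage_def Int_def conj_commute)
    finally show "emeasure (distr (density M (\<lambda>\<omega>. ennreal (indicator C (Y \<omega>)))) B Z) D =
        emeasure (density (distr M B Z) (\<lambda>_. ennreal c)) D" .
  qed simp
  have "(\<integral>\<omega>. indicator C (Y \<omega>) *\<^sub>R \<Psi> (Z \<omega>) \<partial>M) = (\<integral>\<omega>. \<Psi> (Z \<omega>) \<partial>density M (\<lambda>\<omega>. ennreal (indicator C (Y \<omega>))))"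
    using measurable_compose[OF Z \<Psi>] by (intro integral_density[symmetric]) auto
  also have "\<dots> = (\<integral>z. \<Psi> z \<partial>density (distr M B Z) (\<lambda>_. ennreal c))"
    unfolding eq[symmetric] using \<Psi> by (intro integral_distr[symmetric]) auto
  also have "\<dots> = (\<integral>z. c *\<^sub>R \<Psi> z \<partial>distr M B Z)"
    using \<Psi> by (intro integral_density) (auto simp: c_def)
  also have "\<dots> = c *\<^sub>R (\<integral>\<omega>. \<Psi> (Z \<omega>) \<partial>M)"
    using \<Psi> by (subst integral_distr) auto
  finally show ?thesis unfolding c_def .
qed

text \<open>T (Y) takes finitely many values, so the expectation splits over events on each of which
  the integrand no longer depends on Y. T will be the permutation of one generation, or the image of
  {1..n}; either way the result is an average of quantities for the unpermuted chain.\<close>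

lemma (in prob_space)
  fixes \<Psi> :: "'t \<Rightarrow> 'c \<Rightarrow> 'e::{banach, second_countable_topology}"
  assumes ind: "independent_rvs M A Y B Z" and fin: "finite \<T>"
    and T: "\<And>\<omega>. \<omega> \<in> space M \<Longrightarrow> T (Y \<omega>) \<in> \<T>"
    and T_meas: "\<And>t. t \<in> \<T> \<Longrightarrow> {y\<in>space A. T y = t} \<in> sets A"
    and \<Psi>: "\<And>t. t \<in> \<T> \<Longrightarrow> \<Psi> t \<in> borel_measurable B"
    and int: "\<And>t. t \<in> \<T> \<Longrightarrow> integrable M (\<lambda>\<omega>. \<Psi> t (Z \<omega>))"
  shows integrable_independent: "integrable M (\<lambda>\<omega>. \<Psi> (T (Y \<omega>)) (Z \<omega>))"
    and expectation_independent: "(\<integral>\<omega>. \<Psi> (T (Y \<omega>)) (Z \<omega>) \<partial>M) =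
      (\<Sum>t\<in>\<T>. prob {\<omega>\<in>space M. T (Y \<omega>) = t} *\<^sub>R (\<integral>\<omega>. \<Psi> t (Z \<omega>) \<partial>M))"
proof -
  have Y: "Y \<in> M \<rightarrow>\<^sub>M A" using ind by (simp add: independent_rvs_def)
  define C where "C t = {y\<in>space A. T y = t}" for t
  have YC: "Y \<omega> \<in> C t \<longleftrightarrow> T (Y \<omega>) = t" if "\<omega> \<in> space M" for \<omega> t
    using measurable_space[OF Y that] by (simp add: C_def)
  have CY: "{\<omega>\<in>space M. Y \<omega> \<in> C t} = {\<omega>\<in>space M. T (Y \<omega>) = t}" for t
    using YC by auto
  have C: "C t \<in> sets A" if "t \<in> \<T>" for t using T_meas[OF that] by (simp add: C_def)
  have eq: "\<Psi> (T (Y \<omega>)) (Z \<omega>) = (\<Sum>t\<in>\<T>. indicator (C t) (Y \<omega>) *\<^sub>R \<Psi> t (Z \<omega>))" if "\<omega> \<in> space M" for \<omega>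
  proof -
    have "(\<Sum>t\<in>\<T>. indicator (C t) (Y \<omega>) *\<^sub>R \<Psi> t (Z \<omega>)) = (\<Sum>t\<in>\<T>. if t = T (Y \<omega>) then \<Psi> t (Z \<omega>) else 0)"
      using YC[OF that] by (intro sum.cong) (auto simp: indicator_def)
    then show ?thesis using fin T[OF that] by simp
  qed
  have i: "integrable M (\<lambda>\<omega>. indicator (C t) (Y \<omega>) *\<^sub>R \<Psi> t (Z \<omega>))" if "t \<in> \<T>" for t
  proof -
    have "integrable M (\<lambda>\<omega>. indicator (Y -` C t \<inter> space M) \<omega> *\<^sub>R \<Psi> t (Z \<omega>))"
      using measurable_sets[OF Y C[OF that]] int[OF that] by (rule integrable_mult_indicator)
    then show ?thesis
      by (rule Bochner_Integration.integrable_cong[THEN iffD1, rotated 2]) (auto simp: indicator_def)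
  qed
  show "integrable M (\<lambda>\<omega>. \<Psi> (T (Y \<omega>)) (Z \<omega>))"
    using i eq by (simp cong: Bochner_Integration.integrable_cong)
  have "(\<integral>\<omega>. \<Psi> (T (Y \<omega>)) (Z \<omega>) \<partial>M) = (\<integral>\<omega>. (\<Sum>t\<in>\<T>. indicator (C t) (Y \<omega>) *\<^sub>R \<Psi> t (Z \<omega>)) \<partial>M)"
    using eq by (rule Bochner_Integration.integral_cong[OF refl])
  also have "\<dots> = (\<Sum>t\<in>\<T>. \<integral>\<omega>. indicator (C t) (Y \<omega>) *\<^sub>R \<Psi> t (Z \<omega>) \<partial>M)"
    using i by (rule Bochner_Integration.integral_sum)
  also have "\<dots> = (\<Sum>t\<in>\<T>. prob {\<omega>\<in>space M. T (Y \<omega>) = t} *\<^sub>R (\<integral>\<omega>. \<Psi> t (Z \<omega>) \<partial>M))"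
    using expectation_indicator_independent[OF ind C \<Psi>] by (intro sum.cong) (simp_all add: CY)
  finally show "(\<integral>\<omega>. \<Psi> (T (Y \<omega>)) (Z \<omega>) \<partial>M) =
      (\<Sum>t\<in>\<T>. prob {\<omega>\<in>space M. T (Y \<omega>) = t} *\<^sub>R (\<integral>\<omega>. \<Psi> t (Z \<omega>) \<partial>M))" .
qed

section \<open>The randomly permuted chain\<close>

text \<open>This is the recursion of the weighted sums of b 0, ..., b r with weights 2 ^ q / 2 ^ r,
  in which the recent terms dominate. The constant e / 4 is chosen because e / 2 is the fixed point
  of x \<mapsto> x / 2 + e / 4.\<close>

lemma halving_recursion_tendsto_0:
  fixes b c :: "nat \<Rightarrow> real"
  assumes b: "b \<longlonglongrightarrow> 0" and c: "\<And>r. 0 \<le> c r" and rec: "\<And>r. c (Suc r) \<le> c r / 2 + b (Suc r)"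
  shows "c \<longlonglongrightarrow> 0"
proof (rule LIMSEQ_I)
  fix e :: real assume e: "e > 0"
  then have "\<forall>\<^sub>F q in sequentially. b q < e / 4" using b by (intro order_tendstoD) auto
  then obtain N where N: "\<And>q. q \<ge> N \<Longrightarrow> b q < e / 4" by (auto simp: eventually_sequentially)
  have bound: "c (N + k) \<le> c N * (1/2) ^ k + e / 2" for k
  proof (induction k)
    case (Suc k)
    then show ?case using rec[of "N + k"] N[of "Suc (N + k)"] by simp
  qed (use e in simp)
  have "(\<lambda>k. c N * (1/2) ^ k) \<longlonglongrightarrow> c N * 0"
    by (intro tendsto_mult tendsto_const LIMSEQ_power_zero) auto
  then have "\<forall>\<^sub>F k in sequentially. c N * (1/2) ^ k < e / 2"
    using e by (intro order_tendstoD) auto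
  then obtain K where K: "\<And>k. k \<ge> K \<Longrightarrow> c N * (1/2) ^ k < e / 2" by (auto simp: eventually_sequentially)
  show "\<exists>n0. \<forall>n\<ge>n0. norm (c n - 0) < e"
  proof (intro exI allI impI)
    fix n assume n: "n \<ge> N + K"
    then have "K \<le> n - N" "N + (n - N) = n" by auto
    then have "c n < e" using bound[of "n - N"] K[of "n - N"] by simp
    then show "norm (c n - 0) < e" using c[of n] by simp
  qed
qed

lemma gen_index_bounds:
  assumes "1 \<le> n"
  shows "2 ^ gen_index n \<le> n" "n < 2 ^ Suc (gen_index n)"
proof -
  obtain q where "n \<in> generation q" using ex_generation[OF assms] by blast
  moreover from this have "gen_index n = q" by (rule gen_index_generation)
  ultimately show "2 ^ gen_index n \<le> n" "n < 2 ^ Suc (gen_index n)"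
    by (auto simp: generation_def)
qed

lemma gen_index_at_top: "filterlim gen_index at_top at_top"
  unfolding filterlim_at_top
proof
  fix Z
  show "\<forall>\<^sub>F n in sequentially. Z \<le> gen_index n"
    unfolding eventually_sequentially
  proof (intro exI allI impI)
    fix n :: nat assume n: "n \<ge> 2 ^ Z"
    then have "1 \<le> n" using order_trans[OF one_le_power[of "2::nat" Z] n] by simp
    then have "(2::nat) ^ Z < 2 ^ Suc (gen_index n)" using n gen_index_bounds(2)[of n] by linarith
    then show "Z \<le> gen_index n" by (simp only: power_strict_increasing_iff[of "2::nat"] less_Suc_eq_le)
  qed
qed

lemma atLeastAtMost_subset_generations:
  "{1..n} \<subseteq> (\<Union>q<Suc (gen_index n). generation q)"
proof
  fix i assume i: "i \<in> {1..n}"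
  then obtain q where q: "i \<in> generation q" using ex_generation[of i] by auto
  have "2 ^ q \<le> i" using q by (simp add: generation_def)
  also have "i < 2 ^ Suc (gen_index n)" using i gen_index_bounds(2)[of n] by auto
  finally have "q < Suc (gen_index n)" by (simp only: power_strict_increasing_iff[of "2::nat"])
  then show "i \<in> (\<Union>q<Suc (gen_index n). generation q)" using q by blast
qed

locale randomized_chain =
  admissible_chain M Fil X \<nu> P F \<mu> + perm: uniform_generation_permutation M \<pi>
  for M :: "'w measure" and Fil :: "nat \<Rightarrow> 'w measure" and X :: "nat \<Rightarrow> 'w \<Rightarrow> 's::topological_space"
    and \<nu> :: "'s measure" and P :: "'s \<Rightarrow> ('s \<times> 's) measure" and F :: "('s \<Rightarrow> real) set"
    and \<mu> :: "'s measure" and \<pi> :: "'w \<Rightarrow> nat \<Rightarrow> nat" +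
  assumes independent_X: "permutation_independent M \<pi> X"
begin

abbreviation perm_space :: "(nat \<Rightarrow> nat) measure" where
  "perm_space \<equiv> PiM {1..} (\<lambda>_. count_space UNIV)"

abbreviation trajectory_space :: "(nat \<Rightarrow> 's) measure" where
  "trajectory_space \<equiv> PiM {1..} (\<lambda>_. borel)"

definition trajectory :: "'w \<Rightarrow> nat \<Rightarrow> 's" where "trajectory \<omega> = restrict (\<lambda>n. X n \<omega>) {1..}"

definition rperm :: "'w \<Rightarrow> nat \<Rightarrow> nat" where "rperm \<omega> = restrict (\<pi> \<omega>) {1..}"

lemma independent_trajectory: "independent_rvs M perm_space rperm trajectory_space trajectory"
  using independent_X unfolding permutation_independent_def trajectory_def[abs_def] rperm_def[abs_def] .

lemma trajectory_eq: "1 \<le> n \<Longrightarrow> trajectory \<omega> n = X n \<omega>"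
  by (simp add: trajectory_def)

lemma rperm_eq: "1 \<le> n \<Longrightarrow> rperm \<omega> n = \<pi> \<omega> n"
  by (simp add: rperm_def)

lemma perm_generation: "\<omega> \<in> space M \<Longrightarrow> i \<in> generation q \<Longrightarrow> \<pi> \<omega> i \<in> generation q"
  using perm.invariant[of \<omega> q] by blast

lemma perm_inj: "\<omega> \<in> space M \<Longrightarrow> inj_on (\<pi> \<omega>) {1..}"
  using perm.permutation bij_betw_imp_inj_on by blast

lemma perm_measurable:
  assumes "1 \<le> n"
  shows "(\<lambda>\<omega>. \<pi> \<omega> n) \<in> M \<rightarrow>\<^sub>M count_space UNIV"
proof -
  have "rperm \<in> M \<rightarrow>\<^sub>M perm_space"
    using independent_trajectory by (simp add: independent_rvs_def)
  moreover have "(\<lambda>f. f n) \<in> perm_space \<rightarrow>\<^sub>M count_space UNIV"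
    by (rule measurable_component_singleton) (use assms in simp)
  ultimately have "(\<lambda>\<omega>. rperm \<omega> n) \<in> M \<rightarrow>\<^sub>M count_space UNIV"
    by (rule measurable_compose)
  then show ?thesis using assms by (simp add: rperm_eq)
qed

lemma rperm_set_measurable:
  assumes "n \<ge> 1"
  shows "{f \<in> space perm_space. f n = k} \<in> sets perm_space"
proof -
  have [measurable]: "(\<lambda>f. f n) \<in> perm_space \<rightarrow>\<^sub>M count_space UNIV"
    using assms by (intro measurable_component_singleton) auto
  show ?thesis by measurable
qed

lemma restrict_id_permutes:
  assumes "\<omega> \<in> space M"
  shows "restrict_id (\<pi> \<omega>) (generation q) permutes generation q"
proof (rule permutes_restrict_id)
  show "bij_betw (\<pi> \<omega>) (generation q) (generation q)"
    using inj_on_subset[OF perm_inj[OF assms] generation_subset] perm.invariant[OF assms] by (simp add: bij_betw_def)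
qed

lemma prob_restrict_id:
  assumes p: "p permutes generation q"
  shows "prob {\<omega>\<in>space M. restrict_id (\<pi> \<omega>) (generation q) = p} = 1 / fact (2 ^ q)"
proof -
  let ?\<Pi> = "{p. p permutes generation q}"
  have m: "(\<lambda>\<omega>. restrict_id (\<pi> \<omega>) (generation q)) \<in> M \<rightarrow>\<^sub>M count_space ?\<Pi>"
    using perm.independent by (simp add: indep_vars_def)
  have "measure (distr M (count_space ?\<Pi>) (\<lambda>\<omega>. restrict_id (\<pi> \<omega>) (generation q))) {p} = 1 / fact (2 ^ q)"
    unfolding perm.uniform using p
    by (subst measure_uniform_count_measure) (auto simp: finite_permutations card_permutations[OF card_generation])
  moreover have "measure (distr M (count_space ?\<Pi>) (\<lambda>\<omega>. restrict_id (\<pi> \<omega>) (generation q))) {p} =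
      prob ((\<lambda>\<omega>. restrict_id (\<pi> \<omega>) (generation q)) -` {p} \<inter> space M)"
    using p by (intro measure_distr[OF m]) auto
  ultimately show ?thesis by (simp add: vimage_def Int_def conj_commute)
qed

text \<open>For every \<omega>, \<open>permutation_sum_square_le\<close> bounds the average over the
  permutations of the generation; the expectation then turns the squared full sum into
  \<open>second_moment\<close>. \<open>B\<close> will be what {1..n} contains of the generation, all
  of it or a part.\<close>

lemma
  assumes g: "g \<in> F" and B: "B \<subseteq> generation q"
  shows integrable_permuted_square: "integrable M (\<lambda>\<omega>. (\<Sum>i\<in>B. g (X (\<pi> \<omega> i) \<omega>))\<^sup>2)"
    and permuted_square_le: "(\<integral>\<omega>. (\<Sum>i\<in>B. g (X (\<pi> \<omega> i) \<omega>))\<^sup>2 \<partial>M) \<le>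
      2 ^ q * (\<integral>x. (mean ^^ q) (\<lambda>x. (g x)\<^sup>2) x \<partial>\<nu>) + 4 ^ q * second_moment q g"
proof -
  let ?G = "generation q" let ?\<Pi> = "{p. p permutes ?G}"
  have gm [measurable]: "g \<in> borel_measurable borel" by (rule F_measurable[OF g])
  have B1: "1 \<le> i" if "i \<in> B" for i using that B generation_pos by blast
  define T where "T f = restrict_id f ?G" for f :: "nat \<Rightarrow> nat"
  define \<Psi> where "\<Psi> p x = (\<Sum>i\<in>B. g (x (p i)))\<^sup>2" for p :: "nat \<Rightarrow> nat" and x :: "nat \<Rightarrow> 's"
  have T_rperm: "T (rperm \<omega>) = restrict_id (\<pi> \<omega>) ?G" for \<omega>
    unfolding T_def by (rule restrict_id_cong) (use generation_pos rperm_eq in auto)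
  have pB: "p i \<in> ?G" if "p \<in> ?\<Pi>" "i \<in> B" for p i
    using that B permutes_in_image[of p ?G i] by auto
  have pB1: "1 \<le> p i" if "p \<in> ?\<Pi>" "i \<in> B" for p i
    using pB[OF that] by (rule generation_pos)
  have \<Psi>_trajectory: "\<Psi> p (trajectory \<omega>) = (\<Sum>i\<in>B. g (X (p i) \<omega>))\<^sup>2" if "p \<in> ?\<Pi>" for p \<omega>
    unfolding \<Psi>_def using pB1[OF that] by (simp add: trajectory_eq)
  have int: "integrable M (\<lambda>\<omega>. \<Psi> p (trajectory \<omega>))" if "p \<in> ?\<Pi>" for p
    unfolding \<Psi>_trajectory[OF that] power2_eq_square sum_product
    using pB1[OF that] g by (intro Bochner_Integration.integrable_sum integrable_F_mult) auto
  have eq: "\<Psi> (T (rperm \<omega>)) (trajectory \<omega>) = (\<Sum>i\<in>B. g (X (\<pi> \<omega> i) \<omega>))\<^sup>2" if "\<omega> \<in> space M" for \<omega>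
  proof -
    have "restrict_id (\<pi> \<omega>) ?G \<in> ?\<Pi>" using restrict_id_permutes[OF that] by simp
    then have "\<Psi> (T (rperm \<omega>)) (trajectory \<omega>) = (\<Sum>i\<in>B. g (X (restrict_id (\<pi> \<omega>) ?G i) \<omega>))\<^sup>2"
      unfolding T_rperm by (rule \<Psi>_trajectory)
    also have "(\<Sum>i\<in>B. g (X (restrict_id (\<pi> \<omega>) ?G i) \<omega>)) = (\<Sum>i\<in>B. g (X (\<pi> \<omega> i) \<omega>))"
    proof (rule sum.cong[OF refl])
      fix i assume "i \<in> B"
      then have "restrict_id (\<pi> \<omega>) ?G i = \<pi> \<omega> i" using B by (intro restrict_id_simps(1)) blast
      then show "g (X (restrict_id (\<pi> \<omega>) ?G i) \<omega>) = g (X (\<pi> \<omega> i) \<omega>)" by (simp only:)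
    qed
    finally show ?thesis .
  qed
  have T_in: "T (rperm \<omega>) \<in> ?\<Pi>" if "\<omega> \<in> space M" for \<omega>
    unfolding T_rperm using restrict_id_permutes[OF that] by simp
  have T_meas: "{f \<in> space perm_space. T f = p} \<in> sets perm_space" if "p \<in> ?\<Pi>" for p
  proof -
    have "T f = p \<longleftrightarrow> (\<forall>i\<in>?G. f i = p i)" for f
      using that permutes_not_in[of p ?G] by (auto simp: T_def fun_eq_iff restrict_id_def)
    then have "{f \<in> space perm_space. T f = p} = {f \<in> space perm_space. \<forall>i\<in>?G. f i = p i}" by simp
    also have "\<dots> \<in> sets perm_space"
      using generation_pos by (intro sets.sets_Collect_finite_All rperm_set_measurable) auto
    finally show ?thesis .
  qed
  have \<Psi>_meas: "\<Psi> p \<in> borel_measurable trajectory_space" if "p \<in> ?\<Pi>" for p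
  proof -
    have "(\<lambda>x. g (x (p i))) \<in> borel_measurable trajectory_space" if "i \<in> B" for i
    proof (rule measurable_compose[OF _ gm])
      show "(\<lambda>x. x (p i)) \<in> trajectory_space \<rightarrow>\<^sub>M borel"
        by (rule measurable_component_singleton) (use pB1[OF \<open>p \<in> ?\<Pi>\<close> that] in simp)
    qed
    then show ?thesis unfolding \<Psi>_def by (intro borel_measurable_power borel_measurable_sum)
  qed
  have fin: "finite ?\<Pi>" by (intro finite_permutations) simp
  note I = integrable_independent[where T=T and \<Psi>=\<Psi>, OF independent_trajectory fin T_in T_meas \<Psi>_meas int]
  note E = expectation_independent[where T=T and \<Psi>=\<Psi>, OF independent_trajectory fin T_in T_meas \<Psi>_meas int]
  show "integrable M (\<lambda>\<omega>. (\<Sum>i\<in>B. g (X (\<pi> \<omega> i) \<omega>))\<^sup>2)"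
    using I eq by (simp cong: Bochner_Integration.integrable_cong)
  have g2: "(\<lambda>x. (g x)\<^sup>2) \<in> F" by (rule adm.square[OF g])
  have i2: "integrable M (\<lambda>\<omega>. \<Sum>i\<in>?G. (g (X i \<omega>))\<^sup>2)"
    by (intro Bochner_Integration.integrable_sum integrable_F[OF _ g2] generation_pos)
  have i1: "integrable M (\<lambda>\<omega>. (\<Sum>i\<in>?G. g (X i \<omega>))\<^sup>2)"
    by (rule integrable_sum_square[OF g generation_subset])
  have "(\<integral>\<omega>. (\<Sum>i\<in>B. g (X (\<pi> \<omega> i) \<omega>))\<^sup>2 \<partial>M) = (\<integral>\<omega>. \<Psi> (T (rperm \<omega>)) (trajectory \<omega>) \<partial>M)"
    using eq by (intro Bochner_Integration.integral_cong) auto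
  also have "\<dots> = (\<Sum>p\<in>?\<Pi>. prob {\<omega>\<in>space M. T (rperm \<omega>) = p} *\<^sub>R (\<integral>\<omega>. \<Psi> p (trajectory \<omega>) \<partial>M))"
    by (rule E)
  also have "\<dots> = (\<Sum>p\<in>?\<Pi>. 1 / fact (2 ^ q) * (\<integral>\<omega>. \<Psi> p (trajectory \<omega>) \<partial>M))"
    by (intro sum.cong refl) (simp add: T_rperm prob_restrict_id)
  also have "\<dots> = (\<integral>\<omega>. (\<Sum>p\<in>?\<Pi>. \<Psi> p (trajectory \<omega>)) \<partial>M) / fact (2 ^ q)"
    using int by (simp add: sum_divide_distrib)
  also have "\<dots> \<le> (\<integral>\<omega>. fact (2 ^ q) * ((\<Sum>i\<in>?G. (g (X i \<omega>))\<^sup>2) + (\<Sum>i\<in>?G. g (X i \<omega>))\<^sup>2) \<partial>M) / fact (2 ^ q)"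
  proof (intro divide_right_mono integral_mono)
    show "integrable M (\<lambda>\<omega>. \<Sum>p\<in>?\<Pi>. \<Psi> p (trajectory \<omega>))"
      using int by (intro Bochner_Integration.integrable_sum) auto
    show "integrable M (\<lambda>\<omega>. fact (2 ^ q) * ((\<Sum>i\<in>?G. (g (X i \<omega>))\<^sup>2) + (\<Sum>i\<in>?G. g (X i \<omega>))\<^sup>2))"
      using i1 i2 by simp
    show "(\<Sum>p\<in>?\<Pi>. \<Psi> p (trajectory \<omega>)) \<le> fact (2 ^ q) * ((\<Sum>i\<in>?G. (g (X i \<omega>))\<^sup>2) + (\<Sum>i\<in>?G. g (X i \<omega>))\<^sup>2)" for \<omega>
      using permutation_sum_square_le[OF finite_generation B, of "\<lambda>i. g (X i \<omega>)"]
      by (simp add: card_generation \<Psi>_trajectory)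
  qed simp
  also have "\<dots> = (\<integral>\<omega>. (\<Sum>i\<in>?G. (g (X i \<omega>))\<^sup>2) + (\<Sum>i\<in>?G. g (X i \<omega>))\<^sup>2 \<partial>M)"
    by simp
  also have "\<dots> = 2 ^ q * (\<integral>x. (mean ^^ q) (\<lambda>x. (g x)\<^sup>2) x \<partial>\<nu>) + 4 ^ q * second_moment q g"
    using i1 i2 integral_generation_sum[OF g2, of q] by (simp add: second_moment_def)
  finally show "(\<integral>\<omega>. (\<Sum>i\<in>B. g (X (\<pi> \<omega> i) \<omega>))\<^sup>2 \<partial>M) \<le>
      2 ^ q * (\<integral>x. (mean ^^ q) (\<lambda>x. (g x)\<^sup>2) x \<partial>\<nu>) + 4 ^ q * second_moment q g" .
qed

lemma integral_mean_iter_bounded: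
  assumes "f \<in> F"
  obtains C where "0 \<le> C" "\<And>q. (\<integral>x. (mean ^^ q) f x \<partial>\<nu>) \<le> C"
proof -
  obtain g where g: "g \<in> F" "\<And>r x. \<bar>(mean ^^ r) f x\<bar> \<le> g x"
    using mean_iter_dominated[OF assms] by blast
  show ?thesis
  proof
    show "0 \<le> (\<integral>x. g x \<partial>\<nu>)"
      using g(2) by (intro integral_nonneg_AE always_eventually allI) (rule order_trans[OF abs_ge_zero])
    show "(\<integral>x. (mean ^^ q) f x \<partial>\<nu>) \<le> (\<integral>x. g x \<partial>\<nu>)" for q
      using g abs_le_D1 by (intro integral_mono adm.initial_integrable mean_iter_in_F assms) blast+
  qed
qed

text \<open>Cauchy--Schwarz with weights proportional to the sizes of the generations. Equal weights
  would cost a factor R, of order log n, and \<open>second_moment\<close> tends to 0 without a rate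
  that could compensate it.\<close>

lemma sum_weighted_square_le:
  fixes a :: "nat \<Rightarrow> real"
  shows "(\<Sum>q<R. a q)\<^sup>2 \<le> 2 ^ R * (\<Sum>q<R. (a q)\<^sup>2 / 2 ^ q)"
proof -
  have "(\<Sum>q<R. a q)\<^sup>2 = (\<Sum>q<R. sqrt (2 ^ q) * (a q / sqrt (2 ^ q)))\<^sup>2" by simp
  also have "\<dots> \<le> (\<Sum>q<R. (sqrt (2 ^ q))\<^sup>2) * (\<Sum>q<R. (a q / sqrt (2 ^ q))\<^sup>2)"
    by (rule Cauchy_Schwarz_ineq_sum)
  also have "\<dots> = (\<Sum>q<R. 2 ^ q) * (\<Sum>q<R. (a q)\<^sup>2 / 2 ^ q)"
    by (simp add: power_divide)
  also have "\<dots> \<le> 2 ^ R * (\<Sum>q<R. (a q)\<^sup>2 / 2 ^ q)"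
  proof (rule mult_right_mono)
    have "(\<Sum>q<R. 2 ^ q) = (2 ^ R - 1 :: real)" by (induction R) auto
    then show "(\<Sum>q<R. 2 ^ q) \<le> (2 ^ R :: real)" by simp
  qed (simp add: sum_nonneg)
  finally show ?thesis .
qed

section \<open>Mean squares over a permuted initial segment of the tree\<close>

definition permuted_mean_square :: "('s \<Rightarrow> real) \<Rightarrow> nat \<Rightarrow> real" where
  "permuted_mean_square g n = (\<integral>\<omega>. (perm_sum1 X \<pi> n g \<omega>)\<^sup>2 \<partial>M) / (real n)\<^sup>2"

lemma perm_sum1_split:
  "perm_sum1 X \<pi> n g \<omega> = (\<Sum>q<Suc (gen_index n). \<Sum>i\<in>{1..n} \<inter> generation q. g (X (\<pi> \<omega> i) \<omega>))"
  unfolding perm_sum1_def by (rule sum_split_generations[OF atLeastAtMost_subset_generations])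

lemma permuted_measurable:
  assumes "\<And>j. 1 \<le> j \<Longrightarrow> G j \<in> borel_measurable M" and "1 \<le> i"
  shows "(\<lambda>\<omega>. G (\<pi> \<omega> i) \<omega>) \<in> borel_measurable M"
proof -
  \<comment> \<open>Composition over countably many values asks for a measurable function at every
    value, and nothing is known about vertex 0.\<close>
  have "(\<lambda>\<omega>. G (max 1 (\<pi> \<omega> i)) \<omega>) \<in> borel_measurable M"
    by (rule measurable_compose_countable[OF _ perm_measurable[OF assms(2)]]) (rule assms(1), simp)
  moreover have "max 1 (\<pi> \<omega> i) = \<pi> \<omega> i" if "\<omega> \<in> space M" for \<omega>
    using bij_betwE[OF perm.permutation[OF that]] assms(2) by auto
  ultimately show ?thesis by (simp cong: measurable_cong)
qed

lemma perm_sum1_measurable: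
  assumes "g \<in> borel_measurable borel"
  shows "perm_sum1 X \<pi> n g \<in> borel_measurable M"
  unfolding perm_sum1_def
  using measurable_compose[OF X_measurable assms]
  by (intro borel_measurable_sum permuted_measurable[where G="\<lambda>j \<omega>. g (X j \<omega>)"]) auto

lemma
  assumes g: "g \<in> F"
  shows integrable_perm_sum1_square: "integrable M (\<lambda>\<omega>. (perm_sum1 X \<pi> n g \<omega>)\<^sup>2)"
    and perm_sum1_square_le: "(\<integral>\<omega>. (perm_sum1 X \<pi> n g \<omega>)\<^sup>2 \<partial>M) \<le> 2 ^ Suc (gen_index n) *
      (\<Sum>q<Suc (gen_index n). (\<integral>x. (mean ^^ q) (\<lambda>x. (g x)\<^sup>2) x \<partial>\<nu>) + 2 ^ q * second_moment q g)"
proof -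
  let ?R = "Suc (gen_index n)"
  let ?S = "\<lambda>\<omega>. \<Sum>q<?R. (\<Sum>i\<in>{1..n} \<inter> generation q. g (X (\<pi> \<omega> i) \<omega>))\<^sup>2 / 2 ^ q"
  have le: "(perm_sum1 X \<pi> n g \<omega>)\<^sup>2 \<le> 2 ^ ?R * ?S \<omega>" for \<omega>
    unfolding perm_sum1_split by (rule sum_weighted_square_le)
  have i: "integrable M (\<lambda>\<omega>. (\<Sum>i\<in>{1..n} \<inter> generation q. g (X (\<pi> \<omega> i) \<omega>))\<^sup>2)" for q
    by (rule integrable_permuted_square[OF g]) auto
  have iS: "integrable M (\<lambda>\<omega>. 2 ^ ?R * ?S \<omega>)"
    using i by (intro Bochner_Integration.integrable_mult_right Bochner_Integration.integrable_sum
        Bochner_Integration.integrable_divide)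
  show int: "integrable M (\<lambda>\<omega>. (perm_sum1 X \<pi> n g \<omega>)\<^sup>2)"
  proof (rule Bochner_Integration.integrable_bound[OF iS])
    show "(\<lambda>\<omega>. (perm_sum1 X \<pi> n g \<omega>)\<^sup>2) \<in> borel_measurable M"
      using perm_sum1_measurable[OF F_measurable[OF g], of n] by simp
    show "AE \<omega> in M. norm ((perm_sum1 X \<pi> n g \<omega>)\<^sup>2) \<le> norm (2 ^ ?R * ?S \<omega>)"
    proof (rule always_eventually, rule allI)
      show "norm ((perm_sum1 X \<pi> n g \<omega>)\<^sup>2) \<le> norm (2 ^ ?R * ?S \<omega>)" for \<omega>
        using le[of \<omega>] abs_ge_self[of "2 ^ ?R * ?S \<omega>"] unfolding real_norm_def
        by (simp only: abs_of_nonneg[OF zero_le_power2])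
    qed
  qed
  have "(\<integral>\<omega>. (perm_sum1 X \<pi> n g \<omega>)\<^sup>2 \<partial>M) \<le> (\<integral>\<omega>. 2 ^ ?R * ?S \<omega> \<partial>M)"
    using int iS le by (rule integral_mono)
  also have "\<dots> = 2 ^ ?R * (\<Sum>q<?R. (\<integral>\<omega>. (\<Sum>i\<in>{1..n} \<inter> generation q. g (X (\<pi> \<omega> i) \<omega>))\<^sup>2 \<partial>M) / 2 ^ q)"
    using i by (simp del: power_Suc)
  also have "\<dots> \<le> 2 ^ ?R * (\<Sum>q<?R. (2 ^ q * (\<integral>x. (mean ^^ q) (\<lambda>x. (g x)\<^sup>2) x \<partial>\<nu>) + 4 ^ q * second_moment q g) / 2 ^ q)"
    by (intro mult_left_mono sum_mono divide_right_mono permuted_square_le[OF g]) auto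
  also have "\<dots> = 2 ^ ?R * (\<Sum>q<?R. (\<integral>x. (mean ^^ q) (\<lambda>x. (g x)\<^sup>2) x \<partial>\<nu>) + 2 ^ q * second_moment q g)"
  proof -
    have "(4::real) ^ q = 2 ^ q * 2 ^ q" for q by (simp add: power_mult_distrib[symmetric])
    then have "(2 ^ q * a + 4 ^ q * b) / 2 ^ q = a + 2 ^ q * b" for q and a b :: real
      by (simp add: add_divide_distrib)
    then show ?thesis by (simp only:)
  qed
  finally show "(\<integral>\<omega>. (perm_sum1 X \<pi> n g \<omega>)\<^sup>2 \<partial>M) \<le> 2 ^ Suc (gen_index n) *
      (\<Sum>q<Suc (gen_index n). (\<integral>x. (mean ^^ q) (\<lambda>x. (g x)\<^sup>2) x \<partial>\<nu>) + 2 ^ q * second_moment q g)" .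
qed

text \<open>In generation q the mean square is at most 4 ^ q b q: the diagonal part C / 2 ^ q
  vanishes geometrically, the other part by \<open>second_moment_tendsto_0\<close>. After the
  weighted Cauchy--Schwarz inequality the b q enter with weights 2 ^ q, so the early generations are
  forgotten.\<close>

theorem permuted_mean_square_tendsto_0:
  assumes g: "g \<in> F" and \<mu>: "(\<integral>x. g x \<partial>\<mu>) = 0"
  shows "permuted_mean_square g \<longlonglongrightarrow> 0"
proof -
  obtain C where C: "0 \<le> C" "\<And>q. (\<integral>x. (mean ^^ q) (\<lambda>x. (g x)\<^sup>2) x \<partial>\<nu>) \<le> C"
    using integral_mean_iter_bounded[OF adm.square[OF g]] by blast
  define b where "b q = C * (1/2) ^ q + second_moment q g" for q
  define c where "c r = (\<Sum>q<Suc r. 2 ^ q * b q) / 2 ^ r" for r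
  have b_lim: "b \<longlonglongrightarrow> 0"
  proof -
    have "(\<lambda>q. C * (1/2) ^ q + second_moment q g) \<longlonglongrightarrow> C * 0 + 0"
      by (intro tendsto_add tendsto_mult tendsto_const LIMSEQ_power_zero second_moment_tendsto_0[OF g \<mu>]) simp
    then show ?thesis unfolding b_def by simp
  qed
  have b0: "0 \<le> b q" for q unfolding b_def using C(1) second_moment_nonneg by simp
  have c_lim: "c \<longlonglongrightarrow> 0"
  proof (rule halving_recursion_tendsto_0[OF b_lim])
    show "0 \<le> c r" for r unfolding c_def using b0 by (intro divide_nonneg_nonneg sum_nonneg) auto
    show "c (Suc r) \<le> c r / 2 + b (Suc r)" for r
      unfolding c_def by (simp add: field_simps)
  qed
  \<comment> \<open>The factor 2 comes from 2 ^ Suc r, where r is the generation of n and 2 ^ r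
    \<le> n.\<close>
  have le: "permuted_mean_square g n \<le> 2 * c (gen_index n)" if n: "1 \<le> n" for n
  proof -
    let ?r = "gen_index n"
    have "(\<Sum>q<Suc ?r. (\<integral>x. (mean ^^ q) (\<lambda>x. (g x)\<^sup>2) x \<partial>\<nu>) + 2 ^ q * second_moment q g) \<le> (\<Sum>q<Suc ?r. 2 ^ q * b q)"
    proof (rule sum_mono)
      fix q
      have "2 ^ q * b q = C + 2 ^ q * second_moment q g"
        by (simp add: b_def distrib_left power_one_over)
      then show "(\<integral>x. (mean ^^ q) (\<lambda>x. (g x)\<^sup>2) x \<partial>\<nu>) + 2 ^ q * second_moment q g \<le> 2 ^ q * b q"
        using C(2)[of q] by simp
    qed
    then have "(\<integral>\<omega>. (perm_sum1 X \<pi> n g \<omega>)\<^sup>2 \<partial>M) \<le> 2 ^ Suc ?r * (\<Sum>q<Suc ?r. 2 ^ q * b q)"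
      by (intro order_trans[OF perm_sum1_square_le[OF g]] mult_left_mono) auto
    also have "\<dots> = 2 * c ?r * (2 ^ ?r)\<^sup>2"
      by (simp add: c_def power2_eq_square)
    also have "\<dots> \<le> 2 * c ?r * (real n)\<^sup>2"
    proof (intro mult_left_mono power_mono)
      have "real (2 ^ ?r) \<le> real n" using gen_index_bounds(1)[OF n] by (rule of_nat_mono)
      then show "2 ^ ?r \<le> real n" by simp
      show "0 \<le> 2 * c ?r" unfolding c_def using b0 by (intro mult_nonneg_nonneg divide_nonneg_nonneg sum_nonneg) auto
    qed simp
    finally show ?thesis unfolding permuted_mean_square_def using n by (simp add: divide_le_eq)
  qed
  show ?thesis
  proof (rule tendsto_sandwich[of "\<lambda>_. 0" _ _ "\<lambda>n. 2 * c (gen_index n)"])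
    show "\<forall>\<^sub>F n in sequentially. 0 \<le> permuted_mean_square g n"
      unfolding permuted_mean_square_def by simp
    show "\<forall>\<^sub>F n in sequentially. permuted_mean_square g n \<le> 2 * c (gen_index n)"
      using le by (auto simp: eventually_sequentially)
    have "(\<lambda>n. 2 * c (gen_index n)) \<longlonglongrightarrow> 2 * 0"
      by (intro tendsto_mult tendsto_const filterlim_compose[OF c_lim gen_index_at_top])
    then show "(\<lambda>n. 2 * c (gen_index n)) \<longlonglongrightarrow> 0" by simp
  qed simp
qed

end

section \<open>The central limit theorem\<close>

context randomized_chain
begin

lemma image_set_measurable:
  assumes "finite A"
  shows "{f \<in> space perm_space. f ` {1..n} = A} \<in> sets perm_space"
proof -
  have "{f \<in> space perm_space. f ` {1..n} = A} =
      {f \<in> space perm_space. (\<forall>i\<in>{1..n}. \<exists>a\<in>A. f i = a) \<and> (\<forall>a\<in>A. \<exists>i\<in>{1..n}. f i = a)}"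
  proof (intro Collect_cong conj_cong refl)
    fix f :: "nat \<Rightarrow> nat"
    have "f ` {1..n} \<subseteq> A \<longleftrightarrow> (\<forall>i\<in>{1..n}. \<exists>a\<in>A. f i = a)" by auto
    moreover have "A \<subseteq> f ` {1..n} \<longleftrightarrow> (\<forall>a\<in>A. \<exists>i\<in>{1..n}. f i = a)" by (auto simp: image_iff subset_iff)
    ultimately show "(f ` {1..n} = A) = ((\<forall>i\<in>{1..n}. \<exists>a\<in>A. f i = a) \<and> (\<forall>a\<in>A. \<exists>i\<in>{1..n}. f i = a))"
      by (simp only: set_eq_subset)
  qed
  also have "\<dots> \<in> sets perm_space"
    using assms
    by (intro sets.sets_Collect_conj sets.sets_Collect_finite_All sets.sets_Collect_finite_Ex rperm_set_measurable) auto
  finally show ?thesis .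
qed

lemma perm_image_subset:
  assumes "\<omega> \<in> space M"
  shows "\<pi> \<omega> ` {1..n} \<subseteq> (\<Union>q<Suc (gen_index n). generation q)"
proof
  fix j assume "j \<in> \<pi> \<omega> ` {1..n}"
  then obtain i where i: "i \<in> {1..n}" "j = \<pi> \<omega> i" by blast
  then obtain q where "q < Suc (gen_index n)" "i \<in> generation q"
    using atLeastAtMost_subset_generations by blast
  then show "j \<in> (\<Union>q<Suc (gen_index n). generation q)"
    using perm_generation[OF assms] i(2) by blast
qed

lemma rperm_image: "rperm \<omega> ` {1..n} = \<pi> \<omega> ` {1..n}"
  by (rule image_cong[OF refl]) (simp add: rperm_eq)

lemma sum_perm_image:
  assumes "\<omega> \<in> space M"
  shows "(\<Sum>i=1..n. G (\<pi> \<omega> i)) = (\<Sum>j\<in>rperm \<omega> ` {1..n}. G j)"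
  unfolding rperm_image
  by (subst sum.reindex[OF inj_on_subset[OF perm_inj[OF assms]]]) auto

lemma expectation_abs_le:
  assumes "integrable M Y" "integrable M (\<lambda>\<omega>. (Y \<omega>)\<^sup>2)"
  shows "(\<integral>\<omega>. \<bar>Y \<omega>\<bar> \<partial>M) \<le> sqrt (\<integral>\<omega>. (Y \<omega>)\<^sup>2 \<partial>M)"
proof -
  have "0 \<le> variance (\<lambda>\<omega>. \<bar>Y \<omega>\<bar>)" by (rule variance_positive)
  also have "\<dots> = (\<integral>\<omega>. (Y \<omega>)\<^sup>2 \<partial>M) - (\<integral>\<omega>. \<bar>Y \<omega>\<bar> \<partial>M)\<^sup>2"
    using variance_eq[of "\<lambda>\<omega>. \<bar>Y \<omega>\<bar>"] assms by simp
  finally show ?thesis by (intro real_le_rsqrt) simp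
qed

end

locale randomized_functional =
  randomized_chain M Fil X \<nu> P F \<mu> \<pi> + centered_functional M Fil X \<nu> P F \<mu> h u
  for M :: "'w measure" and Fil :: "nat \<Rightarrow> 'w measure" and X :: "nat \<Rightarrow> 'w \<Rightarrow> 's::topological_space"
    and \<nu> :: "'s measure" and P :: "'s \<Rightarrow> ('s \<times> 's) measure" and F :: "('s \<Rightarrow> real) set"
    and \<mu> :: "'s measure" and \<pi> :: "'w \<Rightarrow> nat \<Rightarrow> nat"
    and h :: "'s \<times> 's \<times> 's \<Rightarrow> real" and u :: "'s \<Rightarrow> real"
begin

definition limit_var :: real where
  "limit_var = (\<integral>x. cond_var x \<partial>\<mu>)"

lemma limit_var_nonneg: "0 \<le> limit_var"
  unfolding limit_var_def by (rule Bochner_Integration.integral_nonneg) (rule cond_var_nonneg)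

text \<open>As the permutation is injective, the sums depend on it only through the set of visited
  vertices, a subset \<open>A\<close> of finitely many generations. The fixed-set bound is averaged
  over \<open>A\<close>: the term with \<open>u\<close> is first enlarged to all of
  \<open>W\<close>, and the variance term reassembles into an expectation for the permuted chain,
  which can be small although single sets are bad.\<close>

lemma char_bound_permuted:
  assumes s: "0 \<le> s" "s \<le> 1"
  shows "norm ((CLINT \<omega>|M. iexp (s * (\<Sum>i=1..n. h (triangle X (\<pi> \<omega> i) \<omega>)))) - complex_of_real (exp (- limit_var / 2))) \<le>
    exp ((limit_var + 1) / 2) * (s ^ 3 * (\<integral>\<omega>. (\<Sum>i\<in>(\<Union>q<Suc (gen_index n). generation q). u (X i \<omega>)) \<partial>M) +
      2 * (\<integral>\<omega>. \<bar>s\<^sup>2 * perm_sum1 X \<pi> n cond_var \<omega> - limit_var\<bar> \<partial>M))"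
proof -
  let ?R = "Suc (gen_index n)"
  define W where "W = (\<Union>q<?R. generation q)"
  define T where "T f = f ` {1..n}" for f :: "nat \<Rightarrow> nat"
  define \<Psi> where "\<Psi> A x = iexp (s * (\<Sum>i\<in>A. h (x i, x (2 * i), x (2 * i + 1))))" for A and x :: "nat \<Rightarrow> 's"
  define D where "D A x = \<bar>s\<^sup>2 * (\<Sum>i\<in>A. cond_var (x i)) - limit_var\<bar>" for A and x :: "nat \<Rightarrow> 's"
  define p where "p A = prob {\<omega>\<in>space M. T (rperm \<omega>) = A}" for A
  define e where "e = complex_of_real (exp (- limit_var / 2))"
  have finW: "finite W" unfolding W_def by simp
  have fin: "finite (Pow W)" using finW by simp
  have W1: "1 \<le> i" if "A \<in> Pow W" "i \<in> A" for A i
    using that generation_pos unfolding W_def by blast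
  have T_in: "T (rperm \<omega>) \<in> Pow W" if "\<omega> \<in> space M" for \<omega>
    unfolding T_def rperm_image W_def using perm_image_subset[OF that] by blast
  have T_meas: "{f \<in> space perm_space. T f = A} \<in> sets perm_space" if "A \<in> Pow W" for A
    unfolding T_def using that finW finite_subset by (intro image_set_measurable) blast
  have comp: "(\<lambda>x. x i) \<in> trajectory_space \<rightarrow>\<^sub>M borel" if "1 \<le> i" for i
    by (rule measurable_component_singleton) (use that in simp)
  have \<Psi>_meas: "\<Psi> A \<in> borel_measurable trajectory_space" if "A \<in> Pow W" for A
  proof -
    have "(\<lambda>x. h (x i, x (2 * i), x (2 * i + 1))) \<in> borel_measurable trajectory_space" if "i \<in> A" for i
    proof -
      have "1 \<le> i" using W1 \<open>A \<in> Pow W\<close> that by blast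
      then have [measurable]: "(\<lambda>x. x i) \<in> trajectory_space \<rightarrow>\<^sub>M borel"
          "(\<lambda>x. x (2 * i)) \<in> trajectory_space \<rightarrow>\<^sub>M borel" "(\<lambda>x. x (2 * i + 1)) \<in> trajectory_space \<rightarrow>\<^sub>M borel"
        by (auto intro!: comp)
      have "(\<lambda>x. (x i, x (2 * i), x (2 * i + 1))) \<in> trajectory_space \<rightarrow>\<^sub>M borel3" by measurable
      then show ?thesis by (rule measurable_compose[OF _ h_measurable])
    qed
    then have [measurable]: "(\<lambda>x. \<Sum>i\<in>A. h (x i, x (2 * i), x (2 * i + 1))) \<in> borel_measurable trajectory_space"
      by (rule borel_measurable_sum)
    show ?thesis unfolding \<Psi>_def by measurable
  qed
  have D_meas: "D A \<in> borel_measurable trajectory_space" if "A \<in> Pow W" for A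
  proof -
    have [measurable]: "(\<lambda>x. \<Sum>i\<in>A. cond_var (x i)) \<in> borel_measurable trajectory_space"
      using W1[OF that] by (intro borel_measurable_sum measurable_compose[OF comp cond_var_measurable])
    show ?thesis unfolding D_def by measurable
  qed
  have \<Psi>_traj: "\<Psi> A (trajectory \<omega>) = iexp (s * (\<Sum>i\<in>A. h (triangle X i \<omega>)))" if "A \<in> Pow W" for A \<omega>
  proof -
    have "(\<Sum>i\<in>A. h (trajectory \<omega> i, trajectory \<omega> (2 * i), trajectory \<omega> (2 * i + 1))) = (\<Sum>i\<in>A. h (triangle X i \<omega>))"
      using W1[OF that] by (intro sum.cong refl) (simp add: trajectory_eq triangle_def)
    then show ?thesis unfolding \<Psi>_def by (simp only:)
  qed
  have D_traj: "D A (trajectory \<omega>) = \<bar>s\<^sup>2 * (\<Sum>i\<in>A. cond_var (X i \<omega>)) - limit_var\<bar>" if "A \<in> Pow W" for A \<omega>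
  proof -
    have "(\<Sum>i\<in>A. cond_var (trajectory \<omega> i)) = (\<Sum>i\<in>A. cond_var (X i \<omega>))"
      using W1[OF that] by (intro sum.cong refl) (simp add: trajectory_eq)
    then show ?thesis unfolding D_def by (simp only:)
  qed
  have traj: "trajectory \<in> M \<rightarrow>\<^sub>M trajectory_space"
    using independent_trajectory by (simp add: independent_rvs_def)
  have \<Psi>_int: "complex_integrable M (\<lambda>\<omega>. \<Psi> A (trajectory \<omega>))" if "A \<in> Pow W" for A
    using measurable_compose[OF traj \<Psi>_meas[OF that]]
    by (intro integrable_const_bound[where B=1]) (simp_all add: \<Psi>_def)
  have D_int: "integrable M (\<lambda>\<omega>. D A (trajectory \<omega>))" if "A \<in> Pow W" for A
    unfolding D_traj[OF that] using W1[OF that]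
    by (intro Bochner_Integration.integrable_abs Bochner_Integration.integrable_diff[OF _ integrable_const]
        Bochner_Integration.integrable_mult_right Bochner_Integration.integrable_sum integrable_F cond_var_in_F)
  note E = expectation_independent[where T=T, OF independent_trajectory fin T_in T_meas]
  \<comment> \<open>The freezing identity for the constant function 1.\<close>
  have sum_p: "(\<Sum>A\<in>Pow W. p A) = 1"
  proof -
    have "(\<integral>\<omega>. (1 :: real) \<partial>M) = (\<Sum>A\<in>Pow W. p A *\<^sub>R (\<integral>\<omega>. 1 \<partial>M))"
      unfolding p_def by (rule E[where \<Psi>="\<lambda>_ _. 1 :: real"]) simp_all
    then show ?thesis by (simp add: prob_space)
  qed
  have p0: "0 \<le> p A" for A unfolding p_def by simp
  have sum_h: "(\<Sum>i=1..n. h (triangle X (\<pi> \<omega> i) \<omega>)) = (\<Sum>i\<in>rperm \<omega> ` {1..n}. h (triangle X i \<omega>))"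
    and sum_v: "(\<Sum>i=1..n. cond_var (X (\<pi> \<omega> i) \<omega>)) = (\<Sum>i\<in>rperm \<omega> ` {1..n}. cond_var (X i \<omega>))"
    if "\<omega> \<in> space M" for \<omega>
    using sum_perm_image[OF that, of "\<lambda>i. h (triangle X i \<omega>)"] sum_perm_image[OF that, of "\<lambda>i. cond_var (X i \<omega>)"]
    by auto
  have "(CLINT \<omega>|M. iexp (s * (\<Sum>i=1..n. h (triangle X (\<pi> \<omega> i) \<omega>)))) = (CLINT \<omega>|M. \<Psi> (T (rperm \<omega>)) (trajectory \<omega>))"
    unfolding T_def
    by (intro Bochner_Integration.integral_cong refl)
      (simp only: sum_h \<Psi>_traj[OF T_in[unfolded T_def]])
  also have "\<dots> = (\<Sum>A\<in>Pow W. p A *\<^sub>R (CLINT \<omega>|M. \<Psi> A (trajectory \<omega>)))"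
    unfolding p_def by (rule E[where \<Psi>=\<Psi>]) (assumption | erule \<Psi>_meas \<Psi>_int)+
  finally have eq: "(CLINT \<omega>|M. iexp (s * (\<Sum>i=1..n. h (triangle X (\<pi> \<omega> i) \<omega>)))) - e =
      (\<Sum>A\<in>Pow W. p A *\<^sub>R ((CLINT \<omega>|M. \<Psi> A (trajectory \<omega>)) - e))"
    by (simp add: scaleR_diff_right sum_subtractf scaleR_sum_left[symmetric] sum_p)
  let ?K = "exp ((limit_var + 1) / 2)" and ?U = "\<integral>\<omega>. (\<Sum>i\<in>W. u (X i \<omega>)) \<partial>M"
  have "norm (\<Sum>A\<in>Pow W. p A *\<^sub>R ((CLINT \<omega>|M. \<Psi> A (trajectory \<omega>)) - e)) \<le>
      (\<Sum>A\<in>Pow W. p A * (?K * (s ^ 3 * ?U + 2 * (\<integral>\<omega>. D A (trajectory \<omega>) \<partial>M))))"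
  proof (rule sum_norm_le)
    fix A assume A: "A \<in> Pow W"
    have "(\<integral>\<omega>. (\<Sum>i\<in>A. u (X i \<omega>)) \<partial>M) \<le> ?U"
    proof (rule integral_mono)
      show "(\<Sum>i\<in>A. u (X i \<omega>)) \<le> (\<Sum>i\<in>W. u (X i \<omega>))" for \<omega>
        using A finW u_nonneg by (intro sum_mono2) auto
      show "integrable M (\<lambda>\<omega>. \<Sum>i\<in>A. u (X i \<omega>))"
        using W1[OF A] by (intro integrable_sum_u) blast
      show "integrable M (\<lambda>\<omega>. \<Sum>i\<in>W. u (X i \<omega>))"
        using W1[of W] by (intro integrable_sum_u) blast
    qed
    then have "?K * (s ^ 3 * (\<integral>\<omega>. (\<Sum>i\<in>A. u (X i \<omega>)) \<partial>M) + 2 * (\<integral>\<omega>. D A (trajectory \<omega>) \<partial>M)) \<le>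
        ?K * (s ^ 3 * ?U + 2 * (\<integral>\<omega>. D A (trajectory \<omega>) \<partial>M))"
      using s by (intro mult_left_mono add_right_mono) auto
    moreover have "norm ((CLINT \<omega>|M. \<Psi> A (trajectory \<omega>)) - e) \<le>
        ?K * (s ^ 3 * (\<integral>\<omega>. (\<Sum>i\<in>A. u (X i \<omega>)) \<partial>M) + 2 * (\<integral>\<omega>. D A (trajectory \<omega>) \<partial>M))"
      unfolding \<Psi>_traj[OF A] D_traj[OF A] e_def
      by (rule char_bound_fixed_set[OF _ s limit_var_nonneg]) (use A in \<open>simp add: W_def\<close>)
    ultimately have "norm ((CLINT \<omega>|M. \<Psi> A (trajectory \<omega>)) - e) \<le> ?K * (s ^ 3 * ?U + 2 * (\<integral>\<omega>. D A (trajectory \<omega>) \<partial>M))"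
      by linarith
    then show "norm (p A *\<^sub>R ((CLINT \<omega>|M. \<Psi> A (trajectory \<omega>)) - e)) \<le>
        p A * (?K * (s ^ 3 * ?U + 2 * (\<integral>\<omega>. D A (trajectory \<omega>) \<partial>M)))"
      using p0[of A] by (simp only: norm_scaleR abs_of_nonneg) (rule mult_left_mono)
  qed
  also have "\<dots> = ?K * (s ^ 3 * ?U * (\<Sum>A\<in>Pow W. p A) + 2 * (\<Sum>A\<in>Pow W. p A * (\<integral>\<omega>. D A (trajectory \<omega>) \<partial>M)))"
  proof -
    have "p A * (k * (a + 2 * b)) = k * a * p A + k * (2 * (p A * b))" for A and k a b :: real
      by (simp add: algebra_simps)
    then show ?thesis
      by (simp only: sum.distrib sum_distrib_left[symmetric] distrib_left mult.assoc)
  qed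
  also have "(\<Sum>A\<in>Pow W. p A * (\<integral>\<omega>. D A (trajectory \<omega>) \<partial>M)) = (\<integral>\<omega>. D (T (rperm \<omega>)) (trajectory \<omega>) \<partial>M)"
    unfolding p_def real_scaleR_def[symmetric]
    by (rule E[where \<Psi>=D, symmetric]) (assumption | erule D_meas D_int)+
  also have "\<dots> = (\<integral>\<omega>. \<bar>s\<^sup>2 * perm_sum1 X \<pi> n cond_var \<omega> - limit_var\<bar> \<partial>M)"
    unfolding T_def perm_sum1_def
    by (intro Bochner_Integration.integral_cong refl)
      (simp only: sum_v D_traj[OF T_in[unfolded T_def]])
  finally show ?thesis
    unfolding eq[symmetric] sum_p unfolding e_def W_def by simp
qed

text \<open>The generations up to that of n have fewer than 2 n vertices, so the moment term is of
  order n^(-3/2) n. By Jensen the variance term is at most the root of the permuted mean square of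
  \<open>cond_var - limit_var\<close>, whose \<mu>-mean is 0 by the choice of the limit
  variance.\<close>

theorem scalar_clt:
  "(\<lambda>n. CLINT \<omega>|M. iexp (1 / sqrt (real n) * (\<Sum>i=1..n. h (triangle X (\<pi> \<omega> i) \<omega>))))
    \<longlonglongrightarrow> complex_of_real (exp (- limit_var / 2))"
proof -
  define g where "g x = cond_var x - limit_var" for x
  have g: "g \<in> F" unfolding g_def by (intro F_diff cond_var_in_F adm.const)
  interpret mu: prob_space \<mu> by (rule adm.prob_limit)
  have "(\<integral>x. g x \<partial>\<mu>) = 0"
    unfolding g_def using adm.limit_integrable[OF cond_var_in_F]
    by (simp add: limit_var_def mu.prob_space)
  then have pms: "permuted_mean_square g \<longlonglongrightarrow> 0"
    using g by (intro permuted_mean_square_tendsto_0)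
  obtain C where C: "0 \<le> C" "\<And>q. (\<integral>x. (mean ^^ q) u x \<partial>\<nu>) \<le> C"
    using integral_mean_iter_bounded[OF u_in_F] by blast
  define K where "K = exp ((limit_var + 1) / 2)"
  define s where "s n = 1 / sqrt (real n)" for n
  have bound: "norm ((CLINT \<omega>|M. iexp (s n * (\<Sum>i=1..n. h (triangle X (\<pi> \<omega> i) \<omega>)))) - complex_of_real (exp (- limit_var / 2)))
      \<le> K * (2 * C * s n + 2 * sqrt (permuted_mean_square g n))" if n: "1 \<le> n" for n
  proof -
    have s: "0 \<le> s n" "s n \<le> 1" using n by (auto simp: s_def)
    have s2: "(s n)\<^sup>2 = 1 / real n" using n by (simp add: s_def power_divide)
    let ?W = "\<Union>q<Suc (gen_index n). generation q"
    have W1: "?W \<subseteq> {1..}" using generation_subset by blast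
    have "(\<integral>\<omega>. (\<Sum>i\<in>?W. u (X i \<omega>)) \<partial>M) = (\<integral>\<omega>. (\<Sum>q<Suc (gen_index n). \<Sum>i\<in>?W \<inter> generation q. u (X i \<omega>)) \<partial>M)"
      by (simp only: sum_split_generations[OF subset_refl])
    also have "\<dots> = (\<Sum>q<Suc (gen_index n). \<integral>\<omega>. (\<Sum>i\<in>?W \<inter> generation q. u (X i \<omega>)) \<partial>M)"
      using generation_subset by (intro Bochner_Integration.integral_sum integrable_sum_u) blast
    also have "\<dots> = (\<Sum>q<Suc (gen_index n). \<integral>\<omega>. (\<Sum>i\<in>generation q. u (X i \<omega>)) \<partial>M)"
    proof (rule sum.cong[OF refl])
      fix q assume "q \<in> {..<Suc (gen_index n)}"
      then have "?W \<inter> generation q = generation q" by blast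
      then show "(\<integral>\<omega>. (\<Sum>i\<in>?W \<inter> generation q. u (X i \<omega>)) \<partial>M) = (\<integral>\<omega>. (\<Sum>i\<in>generation q. u (X i \<omega>)) \<partial>M)"
        by (simp only:)
    qed
    also have "\<dots> = (\<Sum>q<Suc (gen_index n). 2 ^ q * (\<integral>x. (mean ^^ q) u x \<partial>\<nu>))"
      by (simp only: integral_generation_sum[OF u_in_F])
    also have "\<dots> \<le> (\<Sum>q<Suc (gen_index n). 2 ^ q * C)"
      by (intro sum_mono mult_left_mono C) simp
    also have "\<dots> = (2 ^ Suc (gen_index n) - 1) * C"
    proof -
      have "(\<Sum>q<R. 2 ^ q * C) = (2 ^ R - 1) * C" for R :: nat
        by (induction R) (auto simp: algebra_simps)
      then show ?thesis .
    qed
    also have "\<dots> \<le> 2 * real n * C"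
    proof (rule mult_right_mono)
      have "real (2 ^ gen_index n) \<le> real n" using gen_index_bounds(1)[OF n] by (rule of_nat_mono)
      then show "2 ^ Suc (gen_index n) - 1 \<le> 2 * real n"
        unfolding power_Suc of_nat_power of_nat_numeral by linarith
    qed (rule C)
    finally have "s n ^ 3 * (\<integral>\<omega>. (\<Sum>i\<in>?W. u (X i \<omega>)) \<partial>M) \<le> s n ^ 3 * (2 * real n * C)"
      using s by (intro mult_left_mono) auto
    also have "s n ^ 3 * (2 * real n * C) = 2 * C * s n"
    proof -
      have "s n ^ 3 = s n * (s n)\<^sup>2" by (simp add: power3_eq_cube power2_eq_square)
      then show ?thesis unfolding s2 using n by simp
    qed
    finally have U: "s n ^ 3 * (\<integral>\<omega>. (\<Sum>i\<in>?W. u (X i \<omega>)) \<partial>M) \<le> 2 * C * s n" .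
    define Y where "Y = (\<lambda>\<omega>. perm_sum1 X \<pi> n g \<omega> / real n)"
    have Y: "(s n)\<^sup>2 * perm_sum1 X \<pi> n cond_var \<omega> - limit_var = Y \<omega>" for \<omega>
      using n by (simp add: Y_def s2 perm_sum1_def g_def sum_subtractf diff_divide_distrib)
    have iY2: "integrable M (\<lambda>\<omega>. (Y \<omega>)\<^sup>2)"
      unfolding Y_def power_divide using integrable_perm_sum1_square[OF g, of n] by simp
    have "Y \<in> borel_measurable M"
      using perm_sum1_measurable[OF F_measurable[OF g], of n] unfolding Y_def by simp
    then have iY: "integrable M Y"
      using iY2 by (rule square_integrable_imp_integrable)
    have "(\<integral>\<omega>. \<bar>Y \<omega>\<bar> \<partial>M) \<le> sqrt (\<integral>\<omega>. (Y \<omega>)\<^sup>2 \<partial>M)"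
      by (rule expectation_abs_le[OF iY iY2])
    also have "(\<integral>\<omega>. (Y \<omega>)\<^sup>2 \<partial>M) = permuted_mean_square g n"
      unfolding Y_def power_divide permuted_mean_square_def by simp
    finally have D: "(\<integral>\<omega>. \<bar>(s n)\<^sup>2 * perm_sum1 X \<pi> n cond_var \<omega> - limit_var\<bar> \<partial>M) \<le> sqrt (permuted_mean_square g n)"
      unfolding Y .
    show ?thesis
      unfolding K_def
      by (rule order_trans[OF char_bound_permuted[OF s]]) (intro mult_left_mono add_mono U D, auto)
  qed
  have "(\<lambda>n. K * (2 * C * s n + 2 * sqrt (permuted_mean_square g n))) \<longlonglongrightarrow> K * (2 * C * 0 + 2 * sqrt 0)"
  proof (intro tendsto_mult tendsto_add tendsto_const tendsto_real_sqrt pms)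
    have "filterlim (\<lambda>n. sqrt (real n)) at_top sequentially"
      by (rule filterlim_compose[OF sqrt_at_top filterlim_real_sequentially])
    then show "s \<longlonglongrightarrow> 0"
      unfolding s_def by (intro tendsto_divide_0[OF tendsto_const] filterlim_at_top_imp_at_infinity)
  qed
  then have lim: "(\<lambda>n. K * (2 * C * s n + 2 * sqrt (permuted_mean_square g n))) \<longlonglongrightarrow> 0" by simp
  show ?thesis
  proof (rule Lim_null[THEN iffD2], rule Lim_null_comparison[OF _ lim])
    show "\<forall>\<^sub>F n in sequentially. norm ((CLINT \<omega>|M. iexp (1 / sqrt (real n) * (\<Sum>i=1..n. h (triangle X (\<pi> \<omega> i) \<omega>)))) -
        complex_of_real (exp (- limit_var / 2))) \<le> K * (2 * C * s n + 2 * sqrt (permuted_mean_square g n))"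
      unfolding eventually_sequentially
    proof (intro exI allI impI)
      fix n :: nat assume "1 \<le> n"
      from bound[OF this] show "norm ((CLINT \<omega>|M. iexp (1 / sqrt (real n) * (\<Sum>i=1..n. h (triangle X (\<pi> \<omega> i) \<omega>)))) -
        complex_of_real (exp (- limit_var / 2))) \<le> K * (2 * C * s n + 2 * sqrt (permuted_mean_square g n))"
        unfolding s_def .
    qed
  qed
qed

end

section \<open>From one linear combination to the vector statement\<close>

lemma borel_measurable_vec:
  fixes f :: "'a \<Rightarrow> real ^ 'd"
  assumes "\<And>i. (\<lambda>x. f x $ i) \<in> borel_measurable M"
  shows "f \<in> borel_measurable M"
  unfolding borel_measurable_euclidean_space[of f]
  using assms by (auto simp: Basis_vec_def inner_axis)

lemma (in bifurcating_markov_chain) triangle_measurable: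
  "1 \<le> i \<Longrightarrow> triangle X i \<in> M \<rightarrow>\<^sub>M borel3"
  unfolding triangle_def[abs_def] using X_measurable by (intro measurable_Pair) auto

lemma (in randomized_chain) perm_sum3_measurable:
  assumes "f \<in> borel_measurable borel3"
  shows "perm_sum3 X \<pi> n f \<in> borel_measurable M"
  unfolding perm_sum3_def
  using measurable_compose[OF triangle_measurable assms]
  by (intro borel_measurable_sum permuted_measurable[where G="\<lambda>j \<omega>. f (triangle X j \<omega>)"]) auto

context admissible_chain
begin

lemma op3_sum:
  assumes "\<And>i. i \<in> I \<Longrightarrow> op3_exists P (f i)"
  shows "op3_exists P (\<lambda>u. \<Sum>i\<in>I. c i * f i u)"
    and "op3 P (\<lambda>u. \<Sum>i\<in>I. c i * f i u) = (\<lambda>x. \<Sum>i\<in>I. c i * op3 P (f i) x)"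
  using assms by (auto simp: op3_exists_def op3_def fun_eq_iff)

text \<open>The centring function is itself in \<open>F\<close>, so the first two moments of
  \<open>h\<close> follow by expansion. The fourth is only bounded, through those of \<phi> and m,
  since its expansion would need \<open>P\<close> applied to products of three of the
  \<open>f i\<close>.\<close>

lemma centered_functional_linear_combination:
  fixes f :: "'d::finite \<Rightarrow> 's \<times> 's \<times> 's \<Rightarrow> real" and t :: "'d \<Rightarrow> real"
  assumes f [measurable]: "\<And>i. f i \<in> borel_measurable borel3"
    and f1: "\<And>i. op3_exists P (f i)" "\<And>i. op3 P (f i) \<in> F"
    and f2: "\<And>i j. op3_exists P (\<lambda>u. f i u * f j u)" "\<And>i j. op3 P (\<lambda>u. f i u * f j u) \<in> F"
    and f4: "\<And>i j k l. op3_exists P (\<lambda>u. f i u * f j u * f k u * f l u)"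
      "\<And>i j k l. op3 P (\<lambda>u. f i u * f j u * f k u * f l u) \<in> F"
  defines "h \<equiv> \<lambda>z. \<Sum>i\<in>UNIV. t i * (f i z - op3 P (f i) (fst z))"
  shows "\<exists>u. centered_functional M Fil X \<nu> P F \<mu> h u"
    and "op3 P (\<lambda>z. (h z)\<^sup>2) = (\<lambda>x. \<Sum>i\<in>UNIV. \<Sum>j\<in>UNIV. t i * t j *
      (op3 P (\<lambda>u. f i u * f j u) x - op3 P (f i) x * op3 P (f j) x))"
proof -
  define \<phi> where "\<phi> z = (\<Sum>i\<in>UNIV. t i * f i z)" for z
  define m where "m x = (\<Sum>i\<in>UNIV. t i * op3 P (f i) x)" for x
  have h: "h z = \<phi> z - m (fst z)" for z
    unfolding h_def \<phi>_def m_def by (simp add: right_diff_distrib sum_subtractf)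
  have m_F: "m \<in> F"
    unfolding m_def by (intro F_sum adm.scale f1)
  have m_meas [measurable]: "m \<in> borel_measurable borel" by (rule F_measurable[OF m_F])
  have \<phi>_meas [measurable]: "\<phi> \<in> borel_measurable borel3" unfolding \<phi>_def by measurable
  have h_meas: "h \<in> borel_measurable borel3" unfolding h by measurable
  have \<phi>1: "op3_exists P \<phi>" "op3 P \<phi> = m"
    unfolding \<phi>_def m_def using op3_sum[of UNIV f t] f1 by auto
  \<comment> \<open>Double and fourfold sums are kept as single sums over a product type, so that
    \<open>op3_sum\<close> applies to them directly.\<close>
  have sq: "(\<phi> z)\<^sup>2 = (\<Sum>(i, j)\<in>UNIV. t i * t j * (f i z * f j z))" for z
  proof -
    have "(\<phi> z)\<^sup>2 = (\<Sum>i\<in>UNIV. \<Sum>j\<in>UNIV. (t i * f i z) * (t j * f j z))"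
      unfolding \<phi>_def power2_eq_square sum_product ..
    also have "\<dots> = (\<Sum>(i, j)\<in>UNIV. (t i * f i z) * (t j * f j z))"
      by (simp only: UNIV_Times_UNIV[symmetric] sum.cartesian_product[symmetric])
    finally show ?thesis by (simp add: mult_ac)
  qed
  have \<phi>2: "op3_exists P (\<lambda>z. (\<phi> z)\<^sup>2)"
    "op3 P (\<lambda>z. (\<phi> z)\<^sup>2) = (\<lambda>x. \<Sum>(i, j)\<in>UNIV. t i * t j * op3 P (\<lambda>u. f i u * f j u) x)"
    unfolding sq split_beta' using f2 by (subst op3_sum; auto simp: op3_sum)+
  have \<phi>2_F: "op3 P (\<lambda>z. (\<phi> z)\<^sup>2) \<in> F"
    unfolding \<phi>2(2) split_beta' by (intro F_sum adm.scale f2)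
  have quart: "(\<phi> z) ^ 4 = (\<Sum>((i, j), (k, l))\<in>UNIV. t i * t j * t k * t l * (f i z * f j z * f k z * f l z))" for z
  proof -
    let ?g = "\<lambda>(i, j). t i * t j * (f i z * f j z)"
    have "(\<phi> z) ^ 4 = (\<phi> z)\<^sup>2 * (\<phi> z)\<^sup>2" by (simp add: power2_eq_square power4_eq_xxxx)
    also have "\<dots> = (\<Sum>p\<in>UNIV. \<Sum>q\<in>UNIV. ?g p * ?g q)"
      unfolding sq sum_product ..
    also have "\<dots> = (\<Sum>(p, q)\<in>UNIV. ?g p * ?g q)"
      by (simp only: UNIV_Times_UNIV[symmetric] sum.cartesian_product[symmetric])
    finally show ?thesis by (simp add: split_beta' mult_ac)
  qed
  have \<phi>4: "op3_exists P (\<lambda>z. (\<phi> z) ^ 4)"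
    "op3 P (\<lambda>z. (\<phi> z) ^ 4) = (\<lambda>x. \<Sum>((i, j), (k, l))\<in>UNIV. t i * t j * t k * t l * op3 P (\<lambda>u. f i u * f j u * f k u * f l u) x)"
    unfolding quart split_beta' using f4 by (subst op3_sum; auto simp: op3_sum)+
  have \<phi>4_F: "op3 P (\<lambda>z. (\<phi> z) ^ 4) \<in> F"
    unfolding \<phi>4(2) split_beta' by (intro F_sum adm.scale f4)
  have i1: "integrable (P x) (\<lambda>yz. \<phi> (x, yz))" and e1: "(\<integral>yz. \<phi> (x, yz) \<partial>P x) = m x" for x
    using \<phi>1 by (auto simp: op3_exists_def op3_def fun_eq_iff)
  have i2: "integrable (P x) (\<lambda>yz. (\<phi> (x, yz))\<^sup>2)" for x using \<phi>2(1) by (simp add: op3_exists_def)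
  have i4: "integrable (P x) (\<lambda>yz. (\<phi> (x, yz)) ^ 4)" for x using \<phi>4(1) by (simp add: op3_exists_def)
  have pr: "measure (P x) UNIV = 1" for x
    using prob_space.prob_space[OF prob_space_P, of x] by simp
  have fin: "integrable (P x) (\<lambda>_. c :: real)" for x c
    using prob_space_P[of x] by (simp add: prob_space.finite_measure finite_measure.integrable_const)
  have h2: "(h (x, yz))\<^sup>2 = (\<phi> (x, yz))\<^sup>2 - 2 * m x * \<phi> (x, yz) + (m x)\<^sup>2" for x yz
    by (simp add: h power2_diff)
  have ih1: "integrable (P x) (\<lambda>yz. h (x, yz))" for x
    unfolding h fst_conv using i1 fin by (intro Bochner_Integration.integrable_diff)
  have ih2: "integrable (P x) (\<lambda>yz. (h (x, yz))\<^sup>2)" for x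
    unfolding h2 using i1[of x] i2[of x] fin by simp
  have eh1: "(\<integral>yz. h (x, yz) \<partial>P x) = 0" for x
    unfolding h fst_conv using i1[of x] fin by (simp add: e1 pr)
  have eh2: "op3 P (\<lambda>z. (h z)\<^sup>2) x = op3 P (\<lambda>z. (\<phi> z)\<^sup>2) x - (m x)\<^sup>2" for x
    unfolding op3_def h2 using i1[of x] i2[of x] fin by (simp add: e1 pr power2_eq_square)
  have h2_F: "op3 P (\<lambda>z. (h z)\<^sup>2) \<in> F"
  proof -
    have "op3 P (\<lambda>z. (h z)\<^sup>2) = (\<lambda>x. op3 P (\<lambda>z. (\<phi> z)\<^sup>2) x - (m x)\<^sup>2)"
      by (rule ext) (rule eh2)
    then show ?thesis using F_diff[OF \<phi>2_F adm.square[OF m_F]] by simp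
  qed
  \<comment> \<open>The 8 comes from (a - b)^2 \<le> 2 a^2 + 2 b^2 applied twice.\<close>
  have h4: "(h (x, yz)) ^ 4 \<le> 8 * (\<phi> (x, yz)) ^ 4 + 8 * (m x) ^ 4" for x yz
  proof -
    have sq_le: "(a - b)\<^sup>2 \<le> 2 * a\<^sup>2 + 2 * b\<^sup>2" for a b :: real
      using zero_le_power2[of "a + b"] unfolding power2_sum power2_diff by linarith
    have "(a - b) ^ 4 \<le> 8 * a ^ 4 + 8 * b ^ 4" for a b :: real
    proof -
      have "((a - b)\<^sup>2)\<^sup>2 \<le> (2 * a\<^sup>2 + 2 * b\<^sup>2)\<^sup>2"
        using sq_le[of a b] by (intro power_mono) auto
      also have "\<dots> \<le> 2 * (2 * a\<^sup>2)\<^sup>2 + 2 * (2 * b\<^sup>2)\<^sup>2"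
        using sq_le[of "2 * a\<^sup>2" "- (2 * b\<^sup>2)"] by simp
      finally show ?thesis by (simp add: power_mult_distrib)
    qed
    then show ?thesis unfolding h fst_conv .
  qed
  have i48: "integrable (P x) (\<lambda>yz. 8 * (\<phi> (x, yz)) ^ 4 + 8 * (m x) ^ 4)" for x
    using i4[of x] fin by simp
  have ih4: "integrable (P x) (\<lambda>yz. (h (x, yz)) ^ 4)" for x
  proof (rule Bochner_Integration.integrable_bound[OF i48[of x]])
    show "(\<lambda>yz. (h (x, yz)) ^ 4) \<in> borel_measurable (P x)"
      using measurable_compose[OF measurable_Pair1'[of x borel borel2] h_meas]
      by (simp add: measurable_cong_sets[OF sets_P refl])
    show "AE yz in P x. norm ((h (x, yz)) ^ 4) \<le> norm (8 * (\<phi> (x, yz)) ^ 4 + 8 * (m x) ^ 4)"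
      using h4 by (intro always_eventually allI) (simp add: abs_of_nonneg)
  qed
  have eh4: "op3 P (\<lambda>z. (h z) ^ 4) x \<le> 8 * op3 P (\<lambda>z. (\<phi> z) ^ 4) x + 8 * ((m x)\<^sup>2)\<^sup>2" for x
  proof -
    have "op3 P (\<lambda>z. (h z) ^ 4) x \<le> (\<integral>yz. 8 * (\<phi> (x, yz)) ^ 4 + 8 * (m x) ^ 4 \<partial>P x)"
      unfolding op3_def using ih4 i48 h4 by (rule integral_mono)
    also have "\<dots> = 8 * op3 P (\<lambda>z. (\<phi> z) ^ 4) x + 8 * ((m x)\<^sup>2)\<^sup>2"
      unfolding op3_def using i4[of x] fin by (simp add: pr)
    finally show ?thesis .
  qed
  define u where "u x = op3 P (\<lambda>z. (h z)\<^sup>2) x + (8 * op3 P (\<lambda>z. (\<phi> z) ^ 4) x + 8 * ((m x)\<^sup>2)\<^sup>2)" for x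
  have u_F: "u \<in> F"
    unfolding u_def by (intro adm.add adm.scale adm.square h2_F \<phi>4_F m_F)
  have "centered_functional M Fil X \<nu> P F \<mu> h u"
    by unfold_locales (use h_meas ih1 eh1 ih2 ih4 h2_F u_F eh4 in \<open>auto simp: u_def\<close>)
  then show "\<exists>u. centered_functional M Fil X \<nu> P F \<mu> h u" by (intro exI)
  show "op3 P (\<lambda>z. (h z)\<^sup>2) = (\<lambda>x. \<Sum>i\<in>UNIV. \<Sum>j\<in>UNIV. t i * t j *
      (op3 P (\<lambda>u. f i u * f j u) x - op3 P (f i) x * op3 P (f j) x))"
  proof (rule ext)
    fix x
    have "(m x)\<^sup>2 = (\<Sum>i\<in>UNIV. \<Sum>j\<in>UNIV. t i * t j * (op3 P (f i) x * op3 P (f j) x))"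
      unfolding m_def power2_eq_square sum_product by (simp add: mult_ac)
    then show "op3 P (\<lambda>z. (h z)\<^sup>2) x = (\<Sum>i\<in>UNIV. \<Sum>j\<in>UNIV. t i * t j *
      (op3 P (\<lambda>u. f i u * f j u) x - op3 P (f i) x * op3 P (f j) x))"
      unfolding eh2 \<phi>2(2) UNIV_Times_UNIV[symmetric] sum.cartesian_product[symmetric]
      by (simp add: right_diff_distrib sum_subtractf)
  qed
qed

end

theorem corollary24:
  fixes M :: "'w measure" and Fil :: "nat \<Rightarrow> 'w measure"
    and X :: "nat \<Rightarrow> 'w \<Rightarrow> 's::metric_space"
    and \<nu> \<mu> :: "'s measure"
    and P :: "'s \<Rightarrow> ('s \<times> 's) measure"
    and \<pi> :: "'w \<Rightarrow> nat \<Rightarrow> nat"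
    and F :: "('s \<Rightarrow> real) set"
    and f :: "'d::finite \<Rightarrow> 's \<times> 's \<times> 's \<Rightarrow> real"
  assumes "bifurcating_markov_chain M Fil X \<nu> P"
    and "uniform_generation_permutation M \<pi>"
    and "permutation_independent M \<pi> X"
    and "admissible_space P \<nu> F \<mu>"
    and "\<And>i. f i \<in> borel_measurable borel3"
    and "\<And>i. op3_exists P (f i) \<and> op3 P (f i) \<in> F"
    and "\<And>i j. op3_exists P (\<lambda>u. f i u * f j u) \<and> op3 P (\<lambda>u. f i u * f j u) \<in> F"
    and "\<And>i j k l. op3_exists P (\<lambda>u. f i u * f j u * f k u * f l u) \<and>
           op3 P (\<lambda>u. f i u * f j u * f k u * f l u) \<in> F"
  shows "\<exists>N. gaussian_law 0
           (\<chi> i j. (\<integral>x. op3 P (\<lambda>u. f i u * f j u) x \<partial>\<mu>)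
                    - (\<integral>x. op3 P (f i) x * op3 P (f j) x \<partial>\<mu>)) N \<and>
         converges_in_distribution M
           (\<lambda>n \<omega>. (1 / sqrt (real n)) *\<^sub>R
              ((\<chi> i. perm_sum3 X \<pi> n (f i) \<omega>) - (\<chi> i. perm_sum1 X \<pi> n (op3 P (f i)) \<omega>))) N"
proof -
  interpret bmc: bifurcating_markov_chain M Fil X \<nu> P by fact
  interpret adm: admissible_space P \<nu> F \<mu> by fact
  interpret ugp: uniform_generation_permutation M \<pi> by fact
  interpret randomized_chain M Fil X \<nu> P F \<mu> \<pi> by unfold_locales fact
  define C :: "real ^ 'd ^ 'd" where "C = (\<chi> i j. (\<integral>x. op3 P (\<lambda>u. f i u * f j u) x \<partial>\<mu>)
    - (\<integral>x. op3 P (f i) x * op3 P (f j) x \<partial>\<mu>))"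
  define Z where "Z = (\<lambda>n \<omega>. (1 / sqrt (real n)) *\<^sub>R
    ((\<chi> i. perm_sum3 X \<pi> n (f i) \<omega>) - (\<chi> i. perm_sum1 X \<pi> n (op3 P (f i)) \<omega>)))"
  have fF: "op3 P (f i) \<in> F" "op3 P (\<lambda>u. f i u * f j u) \<in> F" for i j
    using assms(6,7) by auto
  \<comment> \<open>Nonnegativity is obtained along with the limit, since t \<bullet> (C t) is the
    limit variance of the combination with coefficients t. Thus \<open>C\<close> is positive
    semidefinite, as the existence of \<open>N\<close> requires.\<close>
  have clt: "0 \<le> t \<bullet> (C *v t) \<and> (\<lambda>n. CLINT \<omega>|M. iexp (t \<bullet> Z n \<omega>)) \<longlonglongrightarrow>
      complex_of_real (exp (- (t \<bullet> (C *v t)) / 2))" for t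
  proof -
    define h where "h = (\<lambda>z. \<Sum>i\<in>UNIV. t $ i * (f i z - op3 P (f i) (fst z)))"
    obtain u where "centered_functional M Fil X \<nu> P F \<mu> h u"
      unfolding h_def using centered_functional_linear_combination(1)[of f "\<lambda>i. t $ i"] assms(5-8) by auto
    then interpret centered_functional M Fil X \<nu> P F \<mu> h u .
    interpret randomized_functional M Fil X \<nu> P F \<mu> \<pi> h u ..
    have cv: "cond_var = (\<lambda>x. \<Sum>i\<in>UNIV. \<Sum>j\<in>UNIV. t $ i * t $ j *
        (op3 P (\<lambda>u. f i u * f j u) x - op3 P (f i) x * op3 P (f j) x))"
    proof -
      have "cond_var = op3 P (\<lambda>z. (h z)\<^sup>2)" by (rule cond_var_def)
      then show ?thesis
        unfolding h_def using centered_functional_linear_combination(2)[of f "\<lambda>i. t $ i"] assms(5-8) by auto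
    qed
    have i: "integrable \<mu> (op3 P (\<lambda>u. f i u * f j u))" "integrable \<mu> (\<lambda>x. op3 P (f i) x * op3 P (f j) x)" for i j
      by (intro adm.limit_integrable fF F_mult)+
    have lv: "limit_var = t \<bullet> (C *v t)"
    proof -
      have "limit_var = (\<Sum>i\<in>UNIV. \<Sum>j\<in>UNIV. t $ i * t $ j * C $ i $ j)"
        unfolding limit_var_def cv using i by (simp add: C_def)
      then show ?thesis
        by (simp add: inner_vec_def matrix_vector_mult_def sum_distrib_left mult_ac)
    qed
    have "t \<bullet> Z n \<omega> = 1 / sqrt (real n) * (\<Sum>k=1..n. h (triangle X (\<pi> \<omega> k) \<omega>))" for n \<omega>
    proof -
      have "(\<Sum>k=1..n. h (triangle X (\<pi> \<omega> k) \<omega>)) =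
          (\<Sum>i\<in>UNIV. t $ i * (perm_sum3 X \<pi> n (f i) \<omega> - perm_sum1 X \<pi> n (op3 P (f i)) \<omega>))"
        unfolding h_def perm_sum3_def perm_sum1_def sum_subtractf[symmetric] sum_distrib_left
        by (subst sum.swap) (simp add: triangle_def)
      then show ?thesis
        by (simp add: Z_def inner_vec_def sum_divide_distrib)
    qed
    then show ?thesis
      using scalar_clt limit_var_nonneg unfolding lv by simp
  qed
  have sym: "C $ i $ j = C $ j $ i" for i j
    unfolding C_def by (simp add: mult.commute)
  obtain N where N: "gaussian_law 0 C N"
    using gaussian_law_exists[of C] sym clt by blast
  have Z_meas: "Z n \<in> borel_measurable M" for n
  proof (rule borel_measurable_vec)
    show "(\<lambda>\<omega>. Z n \<omega> $ i) \<in> borel_measurable M" for i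
      using perm_sum3_measurable[OF assms(5), of n i] perm_sum1_measurable[OF F_measurable[OF fF(1)], of n i]
      unfolding Z_def by simp
  qed
  have "converges_in_distribution M Z N"
    unfolding converges_in_distribution_def
  proof (intro conjI allI impI Z_meas)
    fix \<phi> :: "real ^ 'd \<Rightarrow> real"
    assume \<phi>: "continuous_on UNIV \<phi>" "bounded (range \<phi>)"
    show "(\<lambda>n. \<integral>x. \<phi> x \<partial>distr M borel (Z n)) \<longlonglongrightarrow> (\<integral>x. \<phi> x \<partial>N)"
    proof (rule levy_continuity_euclidean[OF _ _ _ _ _ \<phi>])
      show "prob_space (distr M borel (Z n))" for n
        by (rule bmc.prob_space_distr[OF Z_meas])
      show "prob_space N" "sets N = sets borel" using N by (auto simp: gaussian_law_def)
      show "(\<lambda>n. CLINT x|distr M borel (Z n). iexp (t \<bullet> x)) \<longlonglongrightarrow> (CLINT x|N. iexp (t \<bullet> x))" for t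
      proof -
        have "(CLINT x|distr M borel (Z n). iexp (t \<bullet> x)) = (CLINT \<omega>|M. iexp (t \<bullet> Z n \<omega>))" for n
          by (rule integral_distr[OF Z_meas]) measurable
        moreover have "(CLINT x|N. iexp (t \<bullet> x)) = complex_of_real (exp (- (t \<bullet> (C *v t)) / 2))"
          using N by (simp add: gaussian_law_def exp_of_real[symmetric])
        ultimately show ?thesis using clt[of t] by simp
      qed
    qed simp
  qed
  then show ?thesis
    using N unfolding C_def Z_def by blast
qed

end
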